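(* For a prime $p\ge 11$ put $T=\varphi(p-1)-1$ and let $(s_n)$ be the $T$-periodic binary sequence of parities of sums of consecutive primitive roots modulo $p$, that is, $s_n\equiv g_{n+1}+g_{n+2}\bmod 2$ for $n=0,1,\ldots,T-1$, where $1<g_1<g_2<\cdots<g_{\varphi(p-1)}<p-1$ are all primitive roots modulo $p$ in increasing order. Let $N(1)$ and $N(0)$ denote the number of $1$s and $0$s, respectively, in a period of $(s_n)$, that is, among $s_0,\ldots,s_{T-1}$. Then, as $p\to\infty$ through the primes, $$N(1)=\left(\frac{1}{2-\varphi(p-1)/p}+o(1)\right)T$$ and $$N(0)=\left(\frac{1-\varphi(p-1)/p}{2-\varphi(p-1)/p}+o(1)\right)T.$$
   Context: $\varphi$ is Euler's totient function. Primitive roots modulo $p$ are represented by integers in $\{1,\ldots,p-1\}$. The symbol $o(1)$ denotes a quantity depending only on $p$ that tends to $0$ as $p\to\infty$ through the primes. The quantities $T$, $g_i$, $(s_n)$, $N(0)$, $N(1)$ all depend on $p$. *)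

theory Defs
  imports Complex_Main "HOL-Number_Theory.Number_Theory"
begin

definition primitive_roots :: "nat \<Rightarrow> nat set" where
  "primitive_roots p = {g \<in> {1..p - 1}. residue_primroot p g}"

(* Indexed from 1, so only 1 <= i <= totient (p - 1) is meaningful. *)
definition primitive_root_nth :: "nat \<Rightarrow> nat \<Rightarrow> nat" where
  "primitive_root_nth p i = sorted_list_of_set (primitive_roots p) ! (i - 1)"

definition period_length :: "nat \<Rightarrow> nat" where
  "period_length p = totient (p - 1) - 1"

definition parity_seq :: "nat \<Rightarrow> nat \<Rightarrow> nat" where
  "parity_seq p n =
     (let m = n mod period_length p
      in (primitive_root_nth p (m + 1) + primitive_root_nth p (m + 2)) mod 2)"

definition symbol_count :: "nat \<Rightarrow> nat \<Rightarrow> nat" where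
  "symbol_count p b = card {n \<in> {..<period_length p}. parity_seq p n = b}"

definition primes_at_top :: "nat filter" where
  "primes_at_top = inf at_top (principal {p. prime p})"

end

theory Submission
  imports Defs "Berlekamp_Zassenhaus.Finite_Field"
begin

text \<open>
  Only lower bounds are needed: the main terms for \<open>N(0)\<close> and \<open>N(1)\<close> add up to \<open>T\<close>, so a lower bound
  for each of them is an asymptotic formula for both. If primitive roots were independent events of
  density \<open>\<theta> = \<phi>(p - 1) / (p - 1)\<close>, a gap would equal \<open>h\<close> with probability \<open>\<theta> (1 - \<theta>)^(h - 1)\<close>, and
  summing over odd \<open>h\<close> gives \<open>1 / (2 - \<theta>)\<close>. Inclusion-exclusion truncated at a bounded depth reduces
  the count of gaps \<open>h \<le> C / \<theta>\<close> to counting \<open>x\<close> such that \<open>x + a\<close> is a primitive root for all \<open>a\<close>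
  in a set of bounded size. A second truncated inclusion-exclusion, over the small primes
  dividing \<open>p - 1\<close>, reduces this to the joint distribution of power residues among the \<open>x + a\<close>,
  that is, to character sums over products of linear factors.

  Any power saving suffices for these sums, and Stepanov's method gives one without Weil's theorem:
  an auxiliary polynomial with high-order zeros bounds from above each level set of \<open>f^((p - 1) / d)\<close>,
  and since the level sets partition the field, this also bounds them from below on average. The
  parameters leave so much room that the auxiliary polynomial is seen to be nonzero by taking a norm
  from the field generated by a \<open>d\<close>-th root of \<open>1 / f\<close>.
\<close>

subsection \<open>Irreducible binomials\<close>

text \<open>The density \<open>\<theta>\<close> can be arbitrarily small, so each count needs an
  error that is small relative to \<open>p * \<theta> ^ K\<close>, not merely to \<open>p\<close>.
  The crude bound \<open>\<theta> \<ge> 1 / (l + 1)\<close>, with \<open>l\<close> bounding the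
  number of primes dividing \<open>p - 1\<close>, is enough, provided the sieve error beats the
  corresponding power of \<open>1 / l\<close>. This dictates the scale. For \<open>p\<close> near
  \<open>2^(4k\<^sup>2)\<close> there are O(k^2) such primes; the sieve has depth \<open>k\<close>
  and its limit is a power of \<open>k\<close>, so both the product of the moduli and the number of
  terms are exp(O(k log k)), which a saving of \<open>2^(k\<^sup>2)\<close> in the character sums
  outweighs. Primes above the limit are treated by a union bound on indices.

  Typical gaps have length about \<open>1 / \<theta>\<close>, which may grow with \<open>p\<close>,
  so the counts must be uniform in the set of shifts, of which only the size is bounded. What
  governs the expansion over the interior of a gap \<open>h\<close> is \<open>\<theta> * h\<close>,
  not \<open>h\<close>.\<close>

lemma coeff_pcompose_scale:
  fixes h :: "'b::comm_ring_1 poly"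
  shows "coeff (pcompose h [:0, c:]) n = c ^ n * coeff h n"
proof (induction h arbitrary: n rule: pCons_induct)
  case (pCons a h)
  show ?case
    by (cases n) (simp_all add: pcompose_pCons pCons.IH coeff_pCons algebra_simps)
qed simp

lemma degree_pcompose_scale:
  fixes h :: "'b::idom poly"
  assumes "c \<noteq> 0"
  shows "degree (pcompose h [:0, c:]) = degree h"
  using assms by (simp add: degree_pcompose)

lemma pcompose_power': "pcompose (h ^ n) q = pcompose h q ^ n"
  for h q :: "'b::comm_ring_1 poly"
  by (induction n) (simp_all add: pcompose_mult pcompose_1)

lemma ex_pcompose_monom:
  fixes P :: "'b::comm_ring_1 poly"
  assumes "d > 0" and "\<And>n. coeff P n \<noteq> 0 \<Longrightarrow> d dvd n"
  obtains Q where "P = pcompose Q (monom 1 d)" and "\<And>m. coeff Q m = coeff P (d * m)"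
proof -
  define Q where "Q = (\<Sum>m\<le>degree P. monom (coeff P (d * m)) m)"
  have cQ: "coeff Q m = coeff P (d * m)" for m
  proof (cases "m \<le> degree P")
    case True
    then show ?thesis by (simp add: Q_def coeff_sum if_distrib cong: if_cong)
  next
    case False
    then have "d * m > degree P" using assms(1)
      by (metis le_neq_implies_less linorder_le_less_linear mult_le_mono nat_mult_1 not_less_eq_eq
          less_eq_Suc_le One_nat_def order_less_le_trans)
    then show ?thesis using False by (simp add: Q_def coeff_sum coeff_eq_0)
  qed
  have "pcompose (monom c m) (monom 1 d) = monom c (d * m)" for c :: 'b and m
  proof -
    have "pcompose (monom c m) (monom 1 d) = smult c (pcompose [:0, 1:] (monom 1 d) ^ m)"
      by (simp add: monom_altdef[of c m] pcompose_smult pcompose_power')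
    also have "\<dots> = monom c (d * m)"
      by (simp add: pcompose_pCons monom_power smult_monom)
    finally show ?thesis .
  qed
  then have "pcompose Q (monom 1 d) = (\<Sum>m\<le>degree P. monom (coeff P (d * m)) (d * m))"
    by (simp add: Q_def pcompose_sum)
  also have "\<dots> = P"
  proof (rule poly_eqI)
    fix n
    show "coeff (\<Sum>m\<le>degree P. monom (coeff P (d * m)) (d * m)) n = coeff P n"
    proof (cases "d dvd n")
      case True
      then obtain k where k: "n = d * k" by blast
      have "coeff (\<Sum>m\<le>degree P. monom (coeff P (d * m)) (d * m)) n
          = (\<Sum>m\<le>degree P. if m = k then coeff P (d * k) else 0)"
        unfolding coeff_sum k using assms(1) by (intro sum.cong) auto
      also have "\<dots> = coeff P n"
      proof (cases "k \<le> degree P")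
        case False
        then have "d * k > degree P" using assms(1)
          by (metis le_neq_implies_less linorder_le_less_linear mult_le_mono nat_mult_1 not_less_eq_eq
          less_eq_Suc_le One_nat_def order_less_le_trans)
        then show ?thesis using False k by (simp add: coeff_eq_0)
      qed (simp add: k)
      finally show ?thesis .
    next
      case False
      then have "coeff P n = 0" using assms(2) by blast
      moreover have "coeff (\<Sum>m\<le>degree P. monom (coeff P (d * m)) (d * m)) n = 0"
        unfolding coeff_sum using False by (intro sum.neutral) auto
      ultimately show ?thesis by simp
    qed
  qed
  finally show ?thesis using that cQ by metis
qed

section \<open>Norms under the substitutions X -> zX by roots of unity\<close>

definition unity_group :: "nat \<Rightarrow> 'b::comm_ring_1 set \<Rightarrow> bool" where
  "unity_group d Z \<longleftrightarrow> d > 0 \<and> finite Z \<and> card Z = d \<and> 1 \<in> Z \<and> (\<forall>z\<in>Z. z ^ d = 1) \<and>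
     (\<exists>z0. (*) z0 ` Z = Z \<and> (\<forall>n. z0 ^ n = 1 \<longrightarrow> d dvd n))"

text \<open>When \<open>Z\<close> consists of the \<open>d\<close>-th roots of unity, this is the
  norm from K(X) to K(X^d), written as a polynomial in X.\<close>

definition scale_norm :: "'b::idom set \<Rightarrow> 'b poly \<Rightarrow> 'b poly" where
  "scale_norm Z h = (\<Prod>z\<in>Z. pcompose h [:0, z:])"

lemma unity_groupD:
  fixes Z :: "'b::idom set"
  assumes "unity_group d Z"
  shows "d > 0" "finite Z" "card Z = d" "1 \<in> Z" "z \<in> Z \<Longrightarrow> z ^ d = 1" "z \<in> Z \<Longrightarrow> z \<noteq> 0"
proof -
  show 1: "d > 0" "finite Z" "card Z = d" "1 \<in> Z" using assms by (auto simp: unity_group_def)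
  show 2: "z \<in> Z \<Longrightarrow> z ^ d = 1" using assms by (auto simp: unity_group_def)
  show "z \<in> Z \<Longrightarrow> z \<noteq> 0" using 1 2 by (cases "z = 0") (auto simp: power_0_left)
qed

text \<open>The substitution X -> z0 X permutes the factors of the norm, so multiplication by
  \<open>z0 ^ n\<close> fixes its \<open>n\<close>-th coefficient; a nonzero coefficient forces
  \<open>z0 ^ n = 1\<close>.\<close>

lemma scale_norm_coeff_dvd:
  fixes Z :: "'b::idom set"
  assumes "unity_group d Z" "coeff (scale_norm Z h) n \<noteq> 0"
  shows "d dvd n"
proof -
  obtain z0 where z0: "(*) z0 ` Z = Z" "\<And>n. z0 ^ n = 1 \<Longrightarrow> d dvd n"
    using assms(1) by (auto simp: unity_group_def)
  have ne: "z0 \<noteq> 0" using z0(1) unity_groupD[OF assms(1)] by force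
  have "pcompose (scale_norm Z h) [:0, z0:] = (\<Prod>z\<in>Z. pcompose h [:0, z0 * z:])"
    by (simp add: scale_norm_def pcompose_prod pcompose_pCons ac_simps flip: pcompose_assoc)
  also have "\<dots> = (\<Prod>z\<in>(*) z0 ` Z. pcompose h [:0, z:])"
    using ne by (subst prod.reindex) (auto simp: inj_on_def)
  finally have inv: "pcompose (scale_norm Z h) [:0, z0:] = scale_norm Z h"
    by (simp add: z0(1) scale_norm_def)
  have "z0 ^ n * coeff (scale_norm Z h) n = coeff (scale_norm Z h) n"
    using inv coeff_pcompose_scale[of "scale_norm Z h" z0 n] by simp
  then show ?thesis using assms(2) z0(2) by simp
qed

lemma scale_norm_eq_pcompose:
  fixes Z :: "'b::idom set"
  assumes "unity_group d Z"
  obtains Q where "scale_norm Z h = pcompose Q (monom 1 d)"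
    and "\<And>m. coeff Q m = coeff (scale_norm Z h) (d * m)"
  using ex_pcompose_monom[of d "scale_norm Z h"] unity_groupD(1)[OF assms]
    scale_norm_coeff_dvd[OF assms] by blast

lemma scale_norm_0 [simp]: "unity_group d Z \<Longrightarrow> scale_norm Z (0::'b::idom poly) = 0"
  using unity_groupD[of d Z] by (auto simp: scale_norm_def)

lemma scale_norm_mult: "scale_norm Z (g * h) = scale_norm Z g * scale_norm Z h"
  by (simp add: scale_norm_def pcompose_mult prod.distrib)

lemma degree_scale_norm:
  fixes Z :: "'b::idom set"
  assumes "unity_group d Z"
  shows "degree (scale_norm Z h) = d * degree h"
proof (cases "h = 0")
  case False
  have "pcompose h [:0, z:] \<noteq> 0" if "z \<in> Z" for z
    using that False unity_groupD(6)[OF assms] by (simp add: pcompose_eq_0_iff)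
  then have "degree (scale_norm Z h) = (\<Sum>z\<in>Z. degree (pcompose h [:0, z:]))"
    unfolding scale_norm_def by (intro degree_prod_eq_sum_degree) auto
  also have "\<dots> = (\<Sum>z\<in>Z. degree h)"
    using unity_groupD(6)[OF assms] by (intro sum.cong) (auto simp: degree_pcompose_scale)
  finally show ?thesis using unity_groupD(3)[OF assms] by simp
qed (use assms in simp)

lemma lead_coeff_scale_norm:
  fixes Z :: "'b::idom set"
  assumes "unity_group d Z"
  shows "lead_coeff (scale_norm Z h) = (\<Prod>Z) ^ degree h * lead_coeff h ^ d"
proof -
  have "lead_coeff (scale_norm Z h) = (\<Prod>z\<in>Z. lead_coeff (pcompose h [:0, z:]))"
    by (simp add: scale_norm_def lead_coeff_prod)
  also have "\<dots> = (\<Prod>z\<in>Z. z ^ degree h * lead_coeff h)"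
    using unity_groupD(6)[OF assms]
    by (intro prod.cong) (auto simp: degree_pcompose_scale coeff_pcompose_scale)
  finally show ?thesis using unity_groupD(3)[OF assms]
    by (simp add: prod.distrib prod_power_distrib)
qed

lemma coeff_0_scale_norm:
  fixes Z :: "'b::idom set"
  assumes "unity_group d Z"
  shows "coeff (scale_norm Z h) 0 = coeff h 0 ^ d"
  using unity_groupD(3)[OF assms]
  by (simp add: scale_norm_def coeff_pcompose_scale flip: poly_0_coeff_0 add: poly_prod poly_pcompose)

lemma scale_norm_binomial:
  fixes Z :: "'b::idom set"
  assumes "unity_group d Z"
  shows "scale_norm Z (monom 1 d - [:a:]) = (monom 1 d - [:a:]) ^ d"
proof -
  have "pcompose (monom 1 d - [:a:]) [:0, z:] = monom 1 d - [:a:]" if "z \<in> Z" for z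
    using unity_groupD(5)[OF assms that]
    by (intro poly_eqI) (auto simp: coeff_pcompose_scale coeff_pCons split: nat.splits)
  then show ?thesis using unity_groupD(3)[OF assms] by (simp add: scale_norm_def)
qed

lemma pcompose_monom_inj:
  fixes P Q :: "'b::idom poly"
  assumes "d > 0" "pcompose P (monom 1 d) = pcompose Q (monom 1 d)"
  shows "P = Q"
proof -
  have "pcompose (P - Q) (monom 1 d) = 0" using assms by (simp add: pcompose_diff)
  then show ?thesis using assms(1) by (simp add: pcompose_eq_0_iff degree_monom_eq)
qed

lemma degree_binomial:
  fixes a :: "'b::comm_ring_1"
  assumes "d > 0"
  shows "degree (monom 1 d - [:a:]) = d"
proof -
  have "monom 1 d - [:a:] = monom 1 d + [:-a:]"
    by (rule poly_eqI) (simp add: coeff_pCons split: nat.splits)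
  moreover have "degree (monom (1::'b) d + [:-a:]) = d"
    using assms by (subst degree_add_eq_left) (auto simp: degree_monom_eq)
  ultimately show ?thesis by metis
qed

text \<open>The norm of the binomial is its own \<open>d\<close>-th power, so the norm of a proper
  factor \<open>m\<close> is a constant times a power of X^d - a. Comparing constant and leading
  coefficients then exhibits \<open>(- \<Prod>Z * a) ^ degree m\<close> as a \<open>d\<close>-th
  power. The factor \<open>\<Prod>Z\<close> stems from the leading coefficients of the polynomials
  m(zX).\<close>

lemma irreducible_binomial:
  fixes Z :: "'b::field set"
  assumes Z: "unity_group d Z"
    and not_power: "\<And>e w. 0 < e \<Longrightarrow> e < d \<Longrightarrow> w ^ d \<noteq> (- \<Prod>Z * a) ^ e"
  shows "irreducible (monom 1 d - [:a:])"
proof -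
  have d: "d > 0" using unity_groupD[OF Z] by simp
  have deg: "degree (monom 1 d - [:a:]) = d" by (rule degree_binomial[OF d])
  have base: "monom 1 d - [:a:] = pcompose [:-a, 1:] (monom 1 d)"
    by (simp add: pcompose_pCons)
  show ?thesis
  proof (rule irreducibleI)
    show "monom 1 d - [:a:] \<noteq> 0" using deg d by force
    show "\<not> monom 1 d - [:a:] dvd 1" using deg d by (simp add: is_unit_iff_degree)
    fix m q :: "'b poly"
    assume mq: "monom 1 d - [:a:] = m * q"
    have nz: "m \<noteq> 0" "q \<noteq> 0" using mq deg d by auto
    have dd: "degree m + degree q = d" using mq deg nz by (metis degree_mult_eq)
    show "m dvd 1 \<or> q dvd 1"
    proof (rule ccontr)
      assume "\<not> (m dvd 1 \<or> q dvd 1)"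
      then have e: "0 < degree m" "degree m < d" using nz dd by (auto simp: is_unit_iff_degree)
      obtain P where P: "scale_norm Z m = pcompose P (monom 1 d)"
        "\<And>i. coeff P i = coeff (scale_norm Z m) (d * i)" using scale_norm_eq_pcompose[OF Z] by blast
      obtain R where R: "scale_norm Z q = pcompose R (monom 1 d)"
        "\<And>i. coeff R i = coeff (scale_norm Z q) (d * i)" using scale_norm_eq_pcompose[OF Z] by blast
      have "pcompose (P * R) (monom 1 d) = scale_norm Z (m * q)"
        by (simp add: P(1) R(1) pcompose_mult scale_norm_mult)
      also have "\<dots> = pcompose ([:-a, 1:] ^ d) (monom 1 d)"
        unfolding mq[symmetric] scale_norm_binomial[OF Z] by (simp only: base pcompose_power')
      finally have PR: "P * R = [:-a, 1:] ^ d" using pcompose_monom_inj d by blast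
      have nzP: "P \<noteq> 0" "R \<noteq> 0" using PR by auto
      have degP: "degree P = degree m" "degree R = degree q"
        using arg_cong[OF P(1), of degree] arg_cong[OF R(1), of degree] d degree_scale_norm[OF Z]
        by (simp_all add: degree_pcompose degree_monom_eq)
      \<comment> \<open>The orders at \<open>a\<close> are bounded by degrees that also add up to
        \<open>d\<close>, so both bounds are equalities and \<open>P\<close> has no zero besides
        \<open>a\<close>.\<close>
      have "order a P + order a R = d"
        using order_mult[of P R a] nzP PR by (simp add: order_power_n_n)
      moreover have "order a P \<le> degree P" "order a R \<le> degree R"
        using nzP by (auto intro: order_degree)
      ultimately have ordP: "order a P = degree m" using degP dd by linarith
      obtain S where S: "P = [:-a, 1:] ^ degree m * S"
        using order_1[of a P] ordP by (auto simp: dvd_def)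
      have "degree P = degree m + degree S" using S nzP
        by (subst S, subst degree_mult_eq) (auto simp: degree_power_eq)
      then have "degree S = 0" using degP by simp
      then obtain s where s: "S = [:s:]" by (meson degree_eq_zeroE)
      have lc: "lead_coeff P = s"
        by (simp add: S s lead_coeff_mult lead_coeff_power)
      have "lead_coeff P = lead_coeff (scale_norm Z m)"
        by (simp add: P(2) degP degree_scale_norm[OF Z])
      then have s': "s = (\<Prod>Z) ^ degree m * lead_coeff m ^ d"
        using lc lead_coeff_scale_norm[OF Z] by metis
      have "coeff m 0 ^ d = poly P 0"
        using P(2)[of 0] coeff_0_scale_norm[OF Z, of m] by (simp add: poly_0_coeff_0)
      also have "\<dots> = (-a) ^ degree m * s" by (simp add: S s)
      finally have "(coeff m 0 / lead_coeff m) ^ d = (- \<Prod>Z * a) ^ degree m"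
        using nz by (simp add: s' power_divide field_simps power_mult_distrib flip: power_mult_distrib)
      then show False using not_power e by blast
    qed
  qed
qed

lemma power_diff_dvd: "(x - y) dvd (x ^ n - y ^ n)" for x y :: "'b::comm_ring_1"
  by (simp add: power_diff_sumr2)

lemma poly_altdef_le:
  fixes P :: "'b::comm_ring_1 poly"
  assumes "degree P \<le> n"
  shows "poly P x = (\<Sum>i\<le>n. coeff P i * x ^ i)"
  unfolding poly_altdef using assms
  by (intro sum.mono_neutral_left) (auto simp: coeff_eq_0)

lemma degree_coeff_mult_le:
  fixes g h :: "'b::comm_ring_1 poly poly"
  assumes "\<And>i. degree (coeff g i) \<le> A" "\<And>i. degree (coeff h i) \<le> B"
  shows "degree (coeff (g * h) n) \<le> A + B"
  unfolding coeff_mult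
proof (rule degree_sum_le)
  fix i
  show "degree (coeff g i * coeff h (n - i)) \<le> A + B"
    using degree_mult_le[of "coeff g i" "coeff h (n - i)"] assms(1)[of i] assms(2)[of "n - i"] by linarith
qed simp

lemma degree_coeff_prod_le:
  fixes g :: "'i \<Rightarrow> 'b::comm_ring_1 poly poly"
  assumes "finite I" "\<And>x i. x \<in> I \<Longrightarrow> degree (coeff (g x) i) \<le> B"
  shows "degree (coeff (prod g I) n) \<le> card I * B"
  using assms
proof (induction I arbitrary: n)
  case empty
  then show ?case by (cases n) auto
next
  case (insert x I)
  have "degree (coeff (g x * prod g I) n) \<le> B + card I * B"
    by (intro degree_coeff_mult_le) (use insert in auto)
  then show ?case using insert by simp
qed

text \<open>Guarantees that \<open>Y ^ d - c / f\<close> is irreducible over the rational functions.\<close>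
definition nondegenerate :: "nat \<Rightarrow> 'a::field poly \<Rightarrow> bool" where
  "nondegenerate d f \<longleftrightarrow> (\<forall>e u v k. 0 < e \<longrightarrow> e < d \<longrightarrow> k \<noteq> 0 \<longrightarrow> u \<noteq> 0 \<longrightarrow> v \<noteq> 0 \<longrightarrow>
     u ^ d * f ^ e \<noteq> smult k (v ^ d))"

lemma prime_elem_dvd_prodE:
  assumes "prime_elem p" "finite A" "p dvd prod g A"
  obtains x where "x \<in> A" "p dvd g x"
  using assms(2,1,3) that
  by (induction A arbitrary: thesis rule: finite_induct)
    (auto simp: prime_elem_dvd_mult_iff dest: prime_elem_not_unit)

lemma to_fract_power: "to_fract (x ^ n) = to_fract x ^ n"
  by (induction n) auto

lemma fract_poly_prod: "fract_poly (prod g A) = (\<Prod>x\<in>A. fract_poly (g x))"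
  by (induction A rule: infinite_finite_induct) auto

text \<open>Moves the roots of unity from the coefficient field to the constant polynomials and to
  the constant rational functions, where the norms are taken.\<close>

lemma unity_group_image:
  fixes Z :: "'b::idom set" and \<phi> :: "'b \<Rightarrow> 'c::idom"
  assumes "unity_group d Z" "inj \<phi>" "\<phi> 1 = 1" "\<And>x y. \<phi> (x * y) = \<phi> x * \<phi> y"
  shows "unity_group d (\<phi> ` Z)"
proof -
  obtain z0 where z0: "(*) z0 ` Z = Z" "\<And>n. z0 ^ n = 1 \<Longrightarrow> d dvd n"
    using assms(1) by (auto simp: unity_group_def)
  have pow: "\<phi> (x ^ n) = \<phi> x ^ n" for x n by (induction n) (simp_all add: assms)
  have "(*) (\<phi> z0) ` (\<phi> ` Z) = \<phi> ` ((*) z0 ` Z)"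
    by (simp add: image_image assms(4))
  moreover have "d dvd n" if "\<phi> z0 ^ n = 1" for n
  proof -
    have "\<phi> (z0 ^ n) = \<phi> 1" using that pow assms(3) by simp
    then show ?thesis using z0(2) assms(2) by (simp add: inj_eq)
  qed
  moreover have "card (\<phi> ` Z) = card Z"
    using assms(2) by (simp add: card_image inj_on_subset)
  ultimately show ?thesis
    using assms(1) z0(1) pow assms(3) unfolding unity_group_def
    by (metis (mono_tags, lifting) finite_imageI image_eqI image_iff)
qed

text \<open>With the supposed \<open>d\<close>-th root written as \<open>u / v\<close>, clearing
  denominators turns the power identity to be excluded into one that \<open>nondegenerate\<close>
  forbids.\<close>

lemma irreducible_fract_binomial:
  fixes f :: "'a::field poly" and Z :: "'a set"
  assumes Z: "unity_group d Z" and nd: "nondegenerate d f" and nz: "f \<noteq> 0" "c \<noteq> 0"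
  shows "irreducible (monom 1 d - [:to_fract [:c:] / to_fract f:])"
proof (rule irreducible_binomial)
  define \<phi> where "\<phi> = (\<lambda>z::'a. to_fract [:z:])"
  have mult: "\<phi> (x * y) = \<phi> x * \<phi> y" for x y
    unfolding \<phi>_def to_fract_mult[symmetric] by simp
  have one: "\<phi> 1 = 1"
    unfolding \<phi>_def one_pCons[symmetric] by simp
  show Z': "unity_group d (\<phi> ` Z)"
    by (rule unity_group_image[OF Z]) (auto simp: inj_on_def mult one, simp add: \<phi>_def)
  have \<phi>_prod: "\<phi> (\<Prod>Z) = \<Prod>(\<phi> ` Z)"
  proof -
    have "\<phi> (prod (\<lambda>x. x) A) = (\<Prod>x\<in>A. \<phi> x)" for A
      by (induction A rule: infinite_finite_induct) (simp_all add: mult one)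
    then have "\<phi> (\<Prod>Z) = (\<Prod>x\<in>Z. \<phi> x)" .
    also have "\<dots> = \<Prod>(\<phi> ` Z)"
      by (subst prod.reindex) (auto simp: \<phi>_def inj_on_def)
    finally show ?thesis .
  qed
  define k where "k = - (\<Prod>Z) * c"
  have k: "k \<noteq> 0" using unity_groupD[OF Z] nz by (auto simp: k_def)
  fix e w
  assume e: "0 < e" "e < d"
  show "w ^ d \<noteq> (- \<Prod>(\<phi> ` Z) * (to_fract [:c:] / to_fract f)) ^ e"
  proof
    assume eq: "w ^ d = (- \<Prod>(\<phi> ` Z) * (to_fract [:c:] / to_fract f)) ^ e"
    have "- \<Prod>(\<phi> ` Z) * to_fract [:c:] = \<phi> k"
    proof -
      have "\<phi> k = - \<phi> (\<Prod>Z * c)" unfolding \<phi>_def k_def to_fract_uminus[symmetric] by simp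
      then show ?thesis by (simp add: mult \<phi>_prod) (simp add: \<phi>_def)
    qed
    then have eq2: "w ^ d = (to_fract [:k:] / to_fract f) ^ e"
      using eq by (simp add: \<phi>_def)
    obtain u v where uv: "w = to_fract u / to_fract v" "v \<noteq> 0"
      by (cases w) (auto simp: Fract_conv_to_fract)
    have "to_fract (u ^ d * f ^ e) = to_fract ([:k:] ^ e * v ^ d)"
      using eq2 uv nz by (simp add: to_fract_power power_divide field_simps)
    then have "u ^ d * f ^ e = [:k:] ^ e * v ^ d" by (simp only: to_fract_eq_iff)
    then have "u ^ d * f ^ e = smult (k ^ e) (v ^ d)" by (simp add: poly_const_pow)
    moreover from this have "u \<noteq> 0" using uv k e by (auto simp: power_0_left)
    ultimately show False using nd e uv k unfolding nondegenerate_def by (metis power_not_zero)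
  qed
qed

text \<open>
  With \<open>V\<close> in the role of a \<open>d\<close>-th root of \<open>c / f\<close> modulo \<open>w\<close>, the norm of \<open>h(V)\<close> is a polynomial of small
  degree divisible by \<open>w\<close>, hence zero, contradicting irreducibility.
\<close>
lemma zero_estimate:
  fixes f V w :: "'a::field poly" and h :: "'a poly poly" and Z :: "'a set"
  assumes Z: "unity_group d Z" and nd: "nondegenerate d f" and nz: "f \<noteq> 0" "c \<noteq> 0"
    and h: "h \<noteq> 0" "degree h < d" "\<And>i. degree (coeff h i) \<le> B"
    and V: "w dvd f * V ^ d - [:c:]" "w dvd poly h V"
    and small: "d * B + (d - 1) * degree f < degree w"
  shows False
proof -
  define \<phi> where "\<phi> = (\<lambda>z::'a. [:z:])"
  have Z1: "unity_group d (\<phi> ` Z)"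
    by (rule unity_group_image[OF Z]) (auto simp: \<phi>_def inj_on_def)
  define P where "P = scale_norm (\<phi> ` Z) h"
  obtain Q where Q: "P = pcompose Q (monom 1 d)" "\<And>m. coeff Q m = coeff P (d * m)"
    using scale_norm_eq_pcompose[OF Z1, of h] unfolding P_def by blast
  have d: "d > 0" using unity_groupD[OF Z] by simp
  have degP: "degree P = d * degree h" unfolding P_def by (rule degree_scale_norm[OF Z1])
  have Q0: "coeff Q m = 0" if "m \<ge> d" for m
    unfolding Q(2) by (rule coeff_eq_0) (use that h(2) degP d in simp)
  have degP_coeff: "degree (coeff P n) \<le> d * B" for n
  proof -
    have "degree (coeff P n) \<le> card (\<phi> ` Z) * B"
      unfolding P_def scale_norm_def
    proof (rule degree_coeff_prod_le)
      fix x i assume "x \<in> \<phi> ` Z"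
      then have "degree (x ^ i) = 0" by (auto simp: \<phi>_def poly_const_pow)
      then show "degree (coeff (pcompose h [:0, x:]) i) \<le> B"
        using h(3)[of i] degree_mult_le[of "x ^ i" "coeff h i"] by (simp add: coeff_pcompose_scale)
    qed (use unity_groupD[OF Z1] in auto)
    then show ?thesis using unity_groupD(3)[OF Z1] by simp
  qed
  \<comment> \<open>Only powers of \<open>V ^ d\<close> occur in \<open>poly P V\<close>, and
    \<open>f * V ^ d\<close> is congruent to \<open>c\<close> modulo \<open>w\<close>. Multiplying
    by \<open>f ^ (d - 1)\<close> clears the denominators and eliminates \<open>V\<close>, which may
    have large degree.\<close>
  define N where "N = (\<Sum>m<d. coeff Q m * [:c:] ^ m * f ^ (d - 1 - m))"
  have "w dvd f ^ (d - 1) * poly P V - N"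
  proof -
    have "poly P V = (\<Sum>m\<le>d-1. coeff Q m * (V ^ d) ^ m)"
      unfolding Q(1) poly_pcompose poly_monom mult_1_left
      by (rule poly_altdef_le) (use Q0 d in \<open>auto intro!: degree_le\<close>)
    also have "{..d-1} = {..<d}" using d by auto
    finally have "f ^ (d - 1) * poly P V - N =
        (\<Sum>m<d. f ^ (d - 1) * (coeff Q m * (V ^ d) ^ m) - coeff Q m * [:c:] ^ m * f ^ (d - 1 - m))"
      by (simp add: N_def sum_distrib_left sum_subtractf)
    also have "\<dots> = (\<Sum>m<d. coeff Q m * f ^ (d - 1 - m) * ((f * V ^ d) ^ m - [:c:] ^ m))"
    proof (intro sum.cong refl)
      fix m assume "m \<in> {..<d}"
      then have "f ^ (d - 1) = f ^ (d - 1 - m) * f ^ m" by (simp flip: power_add)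
      then show "f ^ (d - 1) * (coeff Q m * (V ^ d) ^ m) - coeff Q m * [:c:] ^ m * f ^ (d - 1 - m) =
        coeff Q m * f ^ (d - 1 - m) * ((f * V ^ d) ^ m - [:c:] ^ m)"
        by (simp add: algebra_simps power_mult_distrib)
    qed
    also have "w dvd \<dots>"
      by (intro dvd_sum dvd_mult) (meson V(1) dvd_trans power_diff_dvd)
    finally show ?thesis .
  qed
  moreover have "w dvd poly P V"
  proof -
    have "poly P V = (\<Prod>x\<in>\<phi> ` Z. poly h (V * x))"
      by (simp add: P_def scale_norm_def poly_prod poly_pcompose mult.commute)
    moreover have "poly h (V * 1) dvd (\<Prod>x\<in>\<phi> ` Z. poly h (V * x))"
      using unity_groupD[OF Z1] by (intro dvd_prodI) auto
    ultimately show ?thesis using V(2) by (metis dvd_trans mult_1_right)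
  qed
  ultimately have wN: "w dvd N"
    using dvd_diff[of w "f ^ (d - 1) * poly P V" "f ^ (d - 1) * poly P V - N"] by simp
  have "degree N \<le> d * B + (d - 1) * degree f"
    unfolding N_def
  proof (rule degree_sum_le)
    fix m assume m: "m \<in> {..<d}"
    have "degree (coeff Q m * [:c:] ^ m * f ^ (d - 1 - m)) \<le> degree (coeff Q m) + degree ([:c:] ^ m) + degree (f ^ (d - 1 - m))"
      by (meson add_mono degree_mult_le le_refl order_trans)
    also have "degree ([:c:] ^ m) = 0" by (simp add: poly_const_pow)
    also have "degree (f ^ (d - 1 - m)) \<le> (d - 1) * degree f"
      by (rule order_trans[OF degree_power_le]) (metis diff_le_self mult.commute mult_le_mono1)
    finally show "degree (coeff Q m * [:c:] ^ m * f ^ (d - 1 - m)) \<le> d * B + (d - 1) * degree f"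
      using degP_coeff[of "d * m"] Q(2) by simp
  qed simp
  then have N0: "N = 0" using wN small by (metis dvd_imp_degree_le leD le_less_trans)
  \<comment> \<open>That \<open>N\<close> vanishes means that \<open>a = c / f\<close> is a zero of
    \<open>Q\<close>. Hence Y^d - a divides the norm of \<open>h\<close> over the rational
    functions; being prime, it divides one factor h(xY), whose degree is less than
    \<open>d\<close>.\<close>
  define a where "a = to_fract [:c:] / to_fract f"
  define Q' where "Q' = fract_poly Q"
  have "poly Q' a = (\<Sum>m\<le>d-1. coeff Q' m * a ^ m)"
    by (rule poly_altdef_le) (use Q0 d in \<open>auto intro!: degree_le simp: Q'_def coeff_map_poly\<close>)
  also have "{..d-1} = {..<d}" using d by auto
  finally have "to_fract f ^ (d - 1) * poly Q' a = (\<Sum>m<d. to_fract f ^ (d - 1) * (coeff Q' m * a ^ m))"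
    by (simp add: sum_distrib_left)
  also have "\<dots> = (\<Sum>m<d. to_fract (coeff Q m * [:c:] ^ m * f ^ (d - 1 - m)))"
  proof (intro sum.cong refl)
    fix m assume "m \<in> {..<d}"
    then have "to_fract f ^ (d - 1) = to_fract f ^ (d - 1 - m) * to_fract f ^ m" by (simp flip: power_add)
    then show "to_fract f ^ (d - 1) * (coeff Q' m * a ^ m) = to_fract (coeff Q m * [:c:] ^ m * f ^ (d - 1 - m))"
      using nz by (simp add: Q'_def coeff_map_poly a_def to_fract_power power_divide)
  qed
  also have "\<dots> = to_fract N" by (simp add: N_def)
  finally have "poly Q' a = 0" using N0 nz by simp
  then have "[:-a, 1:] dvd Q'" by (simp add: poly_eq_0_iff_dvd)
  then have "pcompose [:-a, 1:] (monom 1 d) dvd pcompose Q' (monom 1 d)"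
    by (metis dvd_def pcompose_mult)
  moreover have "pcompose [:-a, 1:] (monom 1 d) = monom 1 d - [:a:]" by (simp add: pcompose_pCons)
  moreover have "pcompose Q' (monom 1 d) = fract_poly P"
  proof -
    have dv: "d dvd n" if "coeff (fract_poly P) n \<noteq> 0" for n
    proof -
      have "coeff P n \<noteq> 0" using that by (auto simp: coeff_map_poly)
      then show ?thesis using scale_norm_coeff_dvd[OF Z1] P_def by blast
    qed
    obtain Q2 where Q2: "fract_poly P = pcompose Q2 (monom 1 d)" "\<And>m. coeff Q2 m = coeff (fract_poly P) (d * m)"
      using ex_pcompose_monom[OF d dv] by blast
    have "Q2 = Q'" by (rule poly_eqI) (simp add: Q2(2) Q'_def coeff_map_poly Q(2))
    then show ?thesis using Q2(1) by simp
  qed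
  ultimately have "monom 1 d - [:a:] dvd fract_poly P" by metis
  also have "fract_poly P = (\<Prod>x\<in>\<phi> ` Z. fract_poly (pcompose h [:0, x:]))"
    by (simp add: P_def scale_norm_def fract_poly_prod)
  finally have "monom 1 d - [:a:] dvd (\<Prod>x\<in>\<phi> ` Z. fract_poly (pcompose h [:0, x:]))" .
  moreover have "prime_elem (monom 1 d - [:a:])"
    unfolding a_def by (intro field_poly_irreducible_imp_prime irreducible_fract_binomial[OF Z nd nz])
  ultimately obtain x where x: "x \<in> \<phi> ` Z" "monom 1 d - [:a:] dvd fract_poly (pcompose h [:0, x:])"
    using prime_elem_dvd_prodE unity_groupD(2)[OF Z1] by blast
  have xne: "x \<noteq> 0" using x unity_groupD(6)[OF Z1] by blast
  have "fract_poly (pcompose h [:0, x:]) \<noteq> 0" using h(1) xne by (simp add: pcompose_eq_0_iff)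
  then have "degree (monom 1 d - [:a:]) \<le> degree (fract_poly (pcompose h [:0, x:]))"
    using x(2) by (rule dvd_imp_degree_le[rotated])
  also have "\<dots> \<le> degree (pcompose h [:0, x:])" by (rule degree_map_poly_le)
  also have "\<dots> = degree h" using xne by (simp add: degree_pcompose_scale)
  also have "degree (monom 1 d - [:a:]) = d" by (rule degree_binomial[OF d])
  finally show False using h(2) by simp
qed

subsection \<open>Stepanov's method\<close>

text \<open>Pigeonhole over a finite field: there are more vectors than value vectors, and the
  difference of two vectors with equal values is a nontrivial solution.\<close>

lemma homogeneous_system_nontrivial:
  fixes M :: "'e \<Rightarrow> 'i \<Rightarrow> 'a::{finite,field}"
  assumes "finite I" "finite E" "card E < card I"
  obtains u where "\<exists>i\<in>I. u i \<noteq> 0" "\<And>e. e \<in> E \<Longrightarrow> (\<Sum>i\<in>I. M e i * u i) = 0"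
proof -
  define \<Phi> where "\<Phi> = (\<lambda>u. restrict (\<lambda>e. \<Sum>i\<in>I. M e i * u i) E)"
  define q where "q = CARD('a)"
  have "card {0, 1 :: 'a} \<le> q" unfolding q_def by (rule card_mono) auto
  then have q: "q \<ge> 2" by simp
  have "\<not> inj_on \<Phi> (I \<rightarrow>\<^sub>E UNIV)"
  proof
    assume "inj_on \<Phi> (I \<rightarrow>\<^sub>E UNIV)"
    moreover have "\<Phi> ` (I \<rightarrow>\<^sub>E UNIV) \<subseteq> E \<rightarrow>\<^sub>E UNIV" by (auto simp: \<Phi>_def)
    ultimately have "card (I \<rightarrow>\<^sub>E (UNIV :: 'a set)) \<le> card (E \<rightarrow>\<^sub>E (UNIV :: 'a set))"
      using assms by (intro card_inj_on_le[of \<Phi>]) (auto intro!: finite_PiE)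
    then have "q ^ card I \<le> q ^ card E" using assms by (simp add: card_PiE q_def)
    then show False using assms(3) q by (meson leD one_less_numeral_iff power_strict_increasing_iff
      semiring_norm(76) less_le_trans)
  qed
  then obtain v w where vw: "v \<in> I \<rightarrow>\<^sub>E UNIV" "w \<in> I \<rightarrow>\<^sub>E UNIV" "v \<noteq> w" "\<Phi> v = \<Phi> w"
    by (auto simp: inj_on_def)
  then obtain i where "i \<in> I" "v i \<noteq> w i" by (meson PiE_ext)
  then have "\<exists>i\<in>I. v i - w i \<noteq> 0" by auto
  moreover have "(\<Sum>i\<in>I. M e i * (v i - w i)) = 0" if "e \<in> E" for e
    using fun_cong[OF vw(4), of e] that by (simp add: \<Phi>_def right_diff_distrib sum_subtractf)
  ultimately show ?thesis by (rule that)
qed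

lemma card_mult_le_degree:
  fixes R :: "'a::field poly"
  assumes "finite A" "R \<noteq> 0" "\<And>x. x \<in> A \<Longrightarrow> [:-x, 1:] ^ M dvd R"
  shows "M * card A \<le> degree R"
  using assms
proof (induction A arbitrary: R rule: finite_induct)
  case (insert x A)
  obtain S where S: "R = [:-x, 1:] ^ M * S" using insert.prems(2)[of x] by (auto simp: dvd_def)
  have "[:-y, 1:] ^ M dvd S" if "y \<in> A" for y
  proof -
    have "order y ([:-x, 1:] ^ M) = 0" using that insert.hyps by (intro order_0I) auto
    then have "order y R = order y S" using insert.prems(1) unfolding S by (subst order_mult) auto
    moreover have "M \<le> order y R" using insert.prems that by (simp add: order_divides)
    ultimately show ?thesis by (simp add: order_divides)
  qed
  then have "M * card A \<le> degree S" using insert.IH[of S] insert.prems(1) S by auto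
  moreover have "degree R = M + degree S"
    using insert.prems(1) unfolding S by (subst degree_mult_eq) (auto simp: degree_linear_power)
  ultimately show ?case using insert.hyps by simp
qed simp

text \<open>As \<open>f\<close> does not vanish at \<open>x\<close>, the derivation
  \<open>f * pderiv\<close> lowers the multiplicity of a zero at \<open>x\<close> by exactly one as
  long as that multiplicity is nonzero in the field. This is where \<open>M\<close> must not exceed
  the characteristic.\<close>

lemma linear_power_dvd_of_iterated_deriv:
  fixes R f :: "'a::field poly"
  assumes "M \<le> CHAR('a)" "poly f x \<noteq> 0"
    and "\<And>l. l < M \<Longrightarrow> poly (((\<lambda>R. f * pderiv R) ^^ l) R) x = 0"
  shows "[:-x, 1:] ^ M dvd R"
  using assms
proof (induction M arbitrary: R)
  case (Suc M)
  have "[:-x, 1:] ^ M dvd f * pderiv R"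
  proof (rule Suc.IH)
    fix l assume "l < M"
    then show "poly (((\<lambda>R. f * pderiv R) ^^ l) (f * pderiv R)) x = 0"
      using Suc.prems(3)[of "Suc l"] by (simp add: funpow_Suc_right del: funpow.simps)
  qed (use Suc.prems in auto)
  show ?case
  proof (rule ccontr)
    assume nd: "\<not> [:-x, 1:] ^ Suc M dvd R"
    then have R0: "R \<noteq> 0" by auto
    define r where "r = order x R"
    have r: "r \<le> M" using nd R0 by (simp add: r_def order_divides not_less_eq_eq del: power_Suc)
    have "poly R x = 0" using Suc.prems(3)[of 0] by simp
    then have r0: "r > 0" using R0 by (simp add: r_def order_root)
    obtain U where U: "R = [:-x, 1:] ^ r * U" "\<not> [:-x, 1:] dvd U"
      using order_decomp[OF R0, of x] r_def by blast
    obtain r' where r': "r = Suc r'" using r0 by (cases r) auto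
    have "pderiv R = [:-x, 1:] ^ r' * (smult (of_nat r) U + [:-x, 1:] * pderiv U)"
      unfolding U(1) r' pderiv_mult pderiv_power_Suc by (simp add: pderiv_pCons algebra_simps del: of_nat_Suc)
    then have fR: "f * pderiv R = [:-x, 1:] ^ r' * (f * (smult (of_nat r) U + [:-x, 1:] * pderiv U))"
      by (simp add: mult_ac)
    have "[:-x, 1:] ^ r dvd [:-x, 1:] ^ M" using r by (simp add: le_imp_power_dvd)
    then have "[:-x, 1:] ^ r' * [:-x, 1:] dvd [:-x, 1:] ^ r' * (f * (smult (of_nat r) U + [:-x, 1:] * pderiv U))"
      using \<open>[:-x, 1:] ^ M dvd f * pderiv R\<close> unfolding fR r' power_Suc2 by (rule dvd_trans)
    then have "[:-x, 1:] dvd f * (smult (of_nat r) U + [:-x, 1:] * pderiv U)"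
      by (subst (asm) dvd_mult_cancel_left) auto
    then have "poly (f * (smult (of_nat r) U + [:-x, 1:] * pderiv U)) x = 0"
      unfolding poly_eq_0_iff_dvd .
    then have "of_nat r * poly U x = 0" using Suc.prems(2) by simp
    moreover have "poly U x \<noteq> 0" using U(2) by (simp add: poly_eq_0_iff_dvd)
    ultimately have "CHAR('a) dvd r" by (simp add: of_nat_eq_0_iff_char_dvd)
    then show False using r r0 Suc.prems(1) by (auto dest: dvd_imp_le)
  qed
qed simp

text \<open>The derivation \<open>f * pderiv\<close> acts on \<open>k * f ^ N\<close> through the coefficient \<open>k\<close> alone.\<close>
definition twist :: "'a::field poly \<Rightarrow> nat \<Rightarrow> 'a poly \<Rightarrow> 'a poly" where
  "twist f N k = f * pderiv k + of_nat N * pderiv f * k"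

lemma twist_pow_add: "((twist f N) ^^ l) (k1 + k2) = ((twist f N) ^^ l) k1 + ((twist f N) ^^ l) k2"
  by (induction l) (simp_all add: twist_def pderiv_add algebra_simps)

lemma twist_pow_smult: "((twist f N) ^^ l) (smult a k) = smult a (((twist f N) ^^ l) k)"
  by (induction l) (simp_all add: twist_def pderiv_smult smult_add_right)

lemma twist_pow_0: "((twist f N) ^^ l) 0 = 0"
  by (induction l) (simp_all add: twist_def)

lemma twist_pow_sum: "((twist f N) ^^ l) (sum k A) = (\<Sum>x\<in>A. ((twist f N) ^^ l) (k x))"
  by (induction A rule: infinite_finite_induct) (simp_all add: twist_pow_add twist_pow_0)

lemma degree_twist_pow: "degree (((twist f N) ^^ l) k) \<le> degree k + l * degree f"
proof (induction l)
  case (Suc l)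
  define K where "K = ((twist f N) ^^ l) k"
  have pd: "degree (pderiv q) \<le> degree q" for q :: "'a poly"
    by (rule degree_le) (auto simp: coeff_pderiv coeff_eq_0)
  have "degree (f * pderiv K) \<le> degree K + degree f"
    using degree_mult_le[of f "pderiv K"] pd[of K] by linarith
  moreover have "degree (of_nat N * pderiv f * K) \<le> degree K + degree f"
    using degree_mult_le[of "of_nat N * pderiv f" K] degree_mult_le[of "of_nat N" "pderiv f"] pd[of f]
    by simp
  ultimately have "degree (twist f N K) \<le> degree K + degree f"
    unfolding twist_def by (rule degree_add_le)
  then show ?case using Suc by (simp add: K_def)
qed simp

lemma deriv_pow_add:
  "((\<lambda>R. f * pderiv R) ^^ l) (A + B) = ((\<lambda>R. f * pderiv R) ^^ l) A + ((\<lambda>R. f * pderiv R) ^^ l) B"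
  for f :: "'a::field poly"
  by (induction l) (simp_all add: pderiv_add algebra_simps)

lemma deriv_pow_sum:
  "((\<lambda>R. f * pderiv R) ^^ l) (sum g A) = (\<Sum>x\<in>A. ((\<lambda>R. f * pderiv R) ^^ l) (g x))"
  for f :: "'a::field poly"
proof (induction A rule: infinite_finite_induct)
  case (infinite A)
  then show ?case by (induction l) auto
next
  case empty
  then show ?case by (induction l) auto
qed (simp add: deriv_pow_add)

lemma deriv_pow_twist:
  fixes f w :: "'a::field poly"
  assumes "pderiv w = 0"
  shows "((\<lambda>R. f * pderiv R) ^^ l) (k * f ^ N * w) = ((twist f N) ^^ l) k * f ^ N * w"
proof -
  have fN: "f * pderiv (f ^ N) = of_nat N * pderiv f * f ^ N"
  proof (cases N)
    case (Suc n)
    show ?thesis unfolding Suc pderiv_power_Suc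
      by (simp add: of_nat_poly algebra_simps del: of_nat_Suc)
  qed simp
  have step: "f * pderiv (k * f ^ N * w) = twist f N k * f ^ N * w" for k
  proof -
    have "f * pderiv (k * f ^ N * w) = (k * (f * pderiv (f ^ N)) + f * f ^ N * pderiv k) * w"
      using assms by (simp add: pderiv_mult algebra_simps)
    then show ?thesis by (simp add: fN twist_def algebra_simps)
  qed
  show ?thesis by (induction l) (simp_all add: step)
qed

text \<open>The freshman's dream holds for the characteristic, the fixing of constants for the
  cardinality; the assumption makes the two exponents equal. With \<open>V = f ^ g\<close> and
  \<open>d * g = p - 1\<close>, the left term is \<open>f * V ^ d\<close>, which yields the
  congruence that the zero estimate requires.\<close>

lemma frobenius_congruence:
  fixes f :: "'a::finite_field poly"
  assumes "CARD('a) = CHAR('a)"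
  shows "[:-b, 1:] ^ CARD('a) dvd f ^ CARD('a) - [:poly f b:]"
proof -
  have "[:-b, 1:] dvd f - [:poly f b:]" by (simp flip: poly_eq_0_iff_dvd)
  then have "[:-b, 1:] ^ CARD('a) dvd (f - [:poly f b:]) ^ CARD('a)" by (rule dvd_power_same)
  moreover have "f ^ CARD('a) = ((f - [:poly f b:]) + [:poly f b:]) ^ CARD('a)" by simp
  moreover have "\<dots> = (f - [:poly f b:]) ^ CARD('a) + [:poly f b:] ^ CARD('a)"
    by (rule freshmans_dream) (simp_all add: assms)
  moreover have "[:poly f b:] ^ CARD('a) = [:poly f b:]"
    by (simp add: poly_const_pow finite_field_power_card_eq_same)
  ultimately show ?thesis by simp
qed

text \<open>
  The auxiliary polynomial is \<open>\<Sum> k\<^bsub>ij\<^esub> f^(ig) (X - b)^(jp)\<close> with \<open>i < d\<close>, \<open>j < J\<close> and \<open>deg k\<^bsub>ij\<^esub> < A\<close>; it vanishes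
  to order \<open>M\<close> on the level set.
\<close>
lemma stepanov:
  fixes f :: "'a::finite_field poly" and Z :: "'a set"
  assumes card: "CARD('a) = p" "CHAR('a) = p"
    and Z: "unity_group d Z" and dg: "d * g = p - 1" and nd: "nondegenerate d f"
    and b: "poly f b \<noteq> 0"
    and M: "M \<le> p" "M * (A + M * degree f + J) < d * J * A"
    and small: "d * (A - 1) + (d - 1) * degree f < p"
  shows "M * card {x. poly f x ^ g = c \<and> poly f x \<noteq> 0} \<le> A + (d - 1) * g * degree f + J * p"
proof -
  define I where "I = {..<d} \<times> {..<J} \<times> {..<A}"
  \<comment> \<open>One linear condition for each order of derivative and each coefficient; the
    inequality in assumption \<open>M\<close> says that there are fewer conditions than
    unknowns.\<close>
  define E where "E = {..<M} \<times> {..<A + M * degree f + J}"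
  \<comment> \<open>Represents the \<open>l\<close>-th derivative of a basis term on the level set,
    where \<open>f ^ g\<close> may be replaced by \<open>c\<close> and \<open>(X - b)^p\<close> by
    \<open>X - b\<close>. These replacements keep the degree, and hence the number of conditions,
    small.\<close>
  define W where "W = (\<lambda>l (i, j, a). smult (c ^ i) ([:-b, 1:] ^ j * ((twist f (i * g)) ^^ l) (monom 1 a)))"
  have f0: "f \<noteq> 0" using b by auto
  have d0: "d > 0" using unity_groupD[OF Z] by simp
  have pp: "p > 0" using card(1) by (metis finite_UNIV_card_ge_0 finite)
  have degW: "degree (W l t) < A + M * degree f + J" if "l < M" "t \<in> I" for l t
  proof -
    obtain i j a where t: "t = (i, j, a)" by (cases t) auto
    have bd: "j < J" "a < A" using that t by (auto simp: I_def)
    have "degree (W l t) \<le> degree ([:-b, 1:] ^ j * ((twist f (i * g)) ^^ l) (monom 1 a))"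
      unfolding W_def t by (simp add: degree_smult_le)
    also have "\<dots> \<le> j + (a + l * degree f)"
      by (rule order_trans[OF degree_mult_le])
        (use degree_twist_pow[of l f "i * g" "monom 1 a"] in \<open>auto simp: degree_linear_power degree_monom_eq\<close>)
    also have "\<dots> < A + M * degree f + J"
      using bd that(1) mult_le_mono1[of l M "degree f"] by linarith
    finally show ?thesis .
  qed
  have "card E < card I" using M by (simp add: E_def I_def mult_ac)
  then obtain u where u: "\<exists>t\<in>I. u t \<noteq> 0"
    "\<And>e. e \<in> E \<Longrightarrow> (\<Sum>t\<in>I. coeff (W (fst e) t) (snd e) * u t) = 0"
    using homogeneous_system_nontrivial[of I E "\<lambda>e t. coeff (W (fst e) t) (snd e)"]
    unfolding I_def E_def by blast
  \<comment> \<open>The combinations vanish identically as polynomials, hence at every point of the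
    level set, wherever these points lie.\<close>
  have G: "(\<Sum>t\<in>I. smult (u t) (W l t)) = 0" if "l < M" for l
  proof (rule poly_eqI)
    fix n
    show "coeff (\<Sum>t\<in>I. smult (u t) (W l t)) n = coeff 0 n"
    proof (cases "n < A + M * degree f + J")
      case True
      then show ?thesis using u(2)[of "(l, n)"] that by (simp add: E_def coeff_sum mult.commute)
    next
      case False
      then have "coeff (W l t) n = 0" if "t \<in> I" for t
        using degW[OF \<open>l < M\<close> that] by (intro coeff_eq_0) simp
      then show ?thesis by (simp add: coeff_sum)
    qed
  qed
  define k where "k = (\<lambda>i j. \<Sum>a<A. smult (u (i, j, a)) (monom 1 a))"
  define w where "w = [:-b, 1:] ^ p"
  define R where "R = (\<Sum>i<d. \<Sum>j<J. k i j * f ^ (i * g) * w ^ j)"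
  have dw: "pderiv w = 0"
  proof -
    obtain p' where p': "p = Suc p'" using pp by (cases p) auto
    have "of_nat (Suc p') = (0::'a)" using of_nat_CHAR card(2) p' by metis
    then show ?thesis
      unfolding w_def p' pderiv_power_Suc by (simp only: smult_0_left mult_zero_left)
  qed
  have dwj: "pderiv (w ^ j) = 0" for j
    by (cases j) (simp_all add: pderiv_power_Suc dw del: power_Suc)
  have degk: "degree (k i j) \<le> A - 1" for i j
    unfolding k_def
    by (rule degree_sum_le) (auto simp: degree_monom_eq intro: order_trans[OF degree_smult_le])
  have coeffk: "coeff (k i j) a = u (i, j, a)" if "a < A" for i j a
    using that by (simp add: k_def coeff_sum if_distrib cong: if_cong)
  have vanish: "[:-x, 1:] ^ M dvd R" if x: "x \<in> {x. poly f x ^ g = c \<and> poly f x \<noteq> 0}" for x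
  proof (rule linear_power_dvd_of_iterated_deriv)
    show "M \<le> CHAR('a)" using M card by simp
    show "poly f x \<noteq> 0" using x by simp
    fix l assume l: "l < M"
    have wx: "poly (w ^ j) x = (x - b) ^ j" for j
      using finite_field_power_card_eq_same[of "x - b"] card(1) by (simp add: w_def)
    have fx: "poly (f ^ (i * g)) x = c ^ i" for i
      using x by (simp add: mult.commute[of i] power_mult)
    have "poly (((\<lambda>R. f * pderiv R) ^^ l) R) x
       = poly (\<Sum>i<d. \<Sum>j<J. ((twist f (i * g)) ^^ l) (k i j) * f ^ (i * g) * w ^ j) x"
      by (simp add: R_def deriv_pow_sum deriv_pow_twist[OF dwj])
    also have "\<dots> = (\<Sum>i<d. \<Sum>j<J. poly (((twist f (i * g)) ^^ l) (k i j)) x * c ^ i * (x - b) ^ j)"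
      by (simp add: poly_sum wx fx del: poly_power)
    also have "\<dots> = (\<Sum>i<d. \<Sum>j<J. \<Sum>a<A. u (i, j, a) * poly (W l (i, j, a)) x)"
      by (simp add: k_def twist_pow_sum twist_pow_smult poly_sum W_def sum_distrib_left sum_distrib_right mult_ac)
    also have "\<dots> = poly (\<Sum>t\<in>I. smult (u t) (W l t)) x"
      by (simp add: I_def sum.cartesian_product poly_sum case_prod_unfold)
    also have "\<dots> = 0" using G[OF l] by simp
    finally show "poly (((\<lambda>R. f * pderiv R) ^^ l) R) x = 0" .
  qed
  have R0: "R \<noteq> 0"
  proof
    assume R0: "R = 0"
    define H where "H = (\<lambda>j. \<Sum>i<d. k i j * f ^ (i * g))"
    have RH: "(\<Sum>j<J. w ^ j * H j) = 0"
      using R0 unfolding R_def by (subst (asm) sum.swap) (simp add: H_def sum_distrib_left mult_ac)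
    obtain i1 j1 a1 where t1: "i1 < d" "j1 < J" "a1 < A" "u (i1, j1, a1) \<noteq> 0"
      using u(1) by (auto simp: I_def)
    then have ex: "\<exists>j. j < J \<and> (\<exists>i<d. k i j \<noteq> 0)" using coeffk by (metis coeff_0)
    \<comment> \<open>Cancelling the lowest power of \<open>w\<close> that occurs shows that
      \<open>w\<close> divides \<open>H j0\<close>. This is a polynomial in \<open>f ^ g\<close> of
      degree less than \<open>d\<close> with small coefficients, so the zero estimate
      applies.\<close>
    define j0 where "j0 = (LEAST j. j < J \<and> (\<exists>i<d. k i j \<noteq> 0))"
    obtain i0 where j0: "j0 < J" "i0 < d" "k i0 j0 \<noteq> 0" using LeastI_ex[OF ex] by (auto simp: j0_def)
    have less: "H j = 0" if "j < j0" for j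
    proof -
      have "\<not> (j < J \<and> (\<exists>i<d. k i j \<noteq> 0))"
        using not_less_Least[of j "\<lambda>j. j < J \<and> (\<exists>i<d. k i j \<noteq> 0)"] that unfolding j0_def by blast
      then have "k i j = 0" if "i < d" for i using that \<open>j < j0\<close> j0(1) by auto
      then show ?thesis by (simp add: H_def)
    qed
    have w0: "w \<noteq> 0" by (simp add: w_def)
    have "0 = (\<Sum>j<J. w ^ j * H j)" using RH by simp
    also have "\<dots> = (\<Sum>j\<in>{j0..<J}. w ^ j * H j)"
      by (rule sum.mono_neutral_right) (use less in auto)
    also have "\<dots> = w ^ j0 * H j0 + (\<Sum>j\<in>{Suc j0..<J}. w ^ j * H j)"
      using j0(1) by (rule sum.atLeast_Suc_lessThan)
    finally have "w ^ j0 * H j0 = - (\<Sum>j\<in>{Suc j0..<J}. w ^ j * H j)" by (simp add: eq_neg_iff_add_eq_0)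
    also have "w ^ Suc j0 dvd \<dots>"
      unfolding dvd_minus_iff by (intro dvd_sum dvd_mult2 le_imp_power_dvd) auto
    finally have "w ^ j0 * w dvd w ^ j0 * H j0" by (simp add: mult.commute)
    then have wH: "w dvd H j0" using w0 by simp
    define h where "h = (\<Sum>i<d. monom (k i j0) i)"
    have ch: "coeff h i = (if i < d then k i j0 else 0)" for i
      by (simp add: h_def coeff_sum if_distrib cong: if_cong)
    have "poly h (f ^ g) = H j0"
      by (simp add: h_def H_def poly_sum poly_monom power_mult[symmetric] mult.commute)
    show False
    proof (rule zero_estimate[OF Z nd f0 b, of h "A - 1" w "f ^ g"])
      show "h \<noteq> 0" using ch[of i0] j0 by auto
      show "degree h < d" using ch d0
        by (metis (no_types, lifting) degree_lessI h_def coeff_0 not_le_imp_less leD)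
      show "degree (coeff h i) \<le> A - 1" for i using degk by (simp add: ch)
      have "f * (f ^ g) ^ d = f ^ CARD('a)"
      proof -
        have "f * (f ^ g) ^ d = f ^ Suc (d * g)" by (simp add: mult.commute flip: power_mult)
        then show ?thesis using pp card dg by simp
      qed
      then show "w dvd f * (f ^ g) ^ d - [:poly f b:]"
        using frobenius_congruence[of b f] card by (simp add: w_def)
      show "w dvd poly h (f ^ g)" using wH \<open>poly h (f ^ g) = H j0\<close> by simp
      show "d * (A - 1) + (d - 1) * degree f < degree w" using small by (simp add: w_def degree_linear_power)
    qed
  qed
  have "M * card {x. poly f x ^ g = c \<and> poly f x \<noteq> 0} \<le> degree R"
    using vanish R0 by (intro card_mult_le_degree) auto
  also have "degree R \<le> A + (d - 1) * g * degree f + J * p"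
    unfolding R_def
  proof (intro degree_sum_le)
    fix i j assume ij: "i \<in> {..<d}" "j \<in> {..<J}"
    have "degree (k i j * f ^ (i * g) * w ^ j) \<le> degree (k i j) + degree (f ^ (i * g)) + degree (w ^ j)"
      by (meson add_mono degree_mult_le le_refl order_trans)
    moreover have "i \<le> d - 1" using ij by auto
    then have "degree (f ^ (i * g)) \<le> (d - 1) * g * degree f"
    proof -
      assume "i \<le> d - 1"
      then have "i * g * degree f \<le> (d - 1) * g * degree f" by (intro mult_le_mono1)
      then show ?thesis by (simp add: degree_power_eq[OF f0] mult_ac)
    qed
    moreover have "degree (w ^ j) \<le> J * p"
      using ij by (simp add: w_def degree_linear_power mult.commute flip: power_mult)
    ultimately show "degree (k i j * f ^ (i * g) * w ^ j) \<le> A + (d - 1) * g * degree f + J * p"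
      using degk[of i j] by linarith
  qed auto
  finally show ?thesis .
qed

lemma order_prod_linear_powers:
  fixes r :: "'i \<Rightarrow> 'a::field"
  assumes "finite S" "inj_on r S" "i \<in> S"
  shows "order (r i) (\<Prod>j\<in>S. [:- r j, 1:] ^ e j) = e i"
proof -
  have eq: "(\<Prod>j\<in>S. [:- r j, 1:] ^ e j) = [:- r i, 1:] ^ e i * (\<Prod>j\<in>S - {i}. [:- r j, 1:] ^ e j)"
    using assms by (simp add: prod.remove)
  have nz: "(\<Prod>j\<in>S - {i}. [:- r j, 1:] ^ e j) \<noteq> 0" using assms by simp
  have o0: "order (r i) (\<Prod>j\<in>S - {i}. [:- r j, 1:] ^ e j) = 0"
    using assms by (intro order_0I) (auto simp: poly_prod inj_on_def)
  show ?thesis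
    unfolding eq using nz o0 by (subst order_mult) (auto simp: order_power_n_n)
qed

lemma order_power: "f \<noteq> 0 \<Longrightarrow> order a (f ^ n) = n * order a f" for f :: "'a::field poly"
  by (induction n) (simp_all add: order_mult)

text \<open>Comparing orders at the root \<open>r i\<close> gives \<open>d dvd n * e i\<close>.
  Together with \<open>d dvd n * d\<close>, the gcd condition forces \<open>d dvd n\<close>,
  impossible for \<open>0 < n < d\<close>.\<close>

lemma nondegenerate_prod:
  fixes r :: "'i \<Rightarrow> 'a::field"
  assumes S: "finite S" "inj_on r S" and gcd: "Gcd (insert d (e ` S)) = 1"
  shows "nondegenerate d (\<Prod>i\<in>S. [:- r i, 1:] ^ e i)"
  unfolding nondegenerate_def
proof (intro allI impI notI)
  fix n u v k
  let ?f = "\<Prod>i\<in>S. [:- r i, 1:] ^ e i"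
  assume n: "0 < n" "n < d" and nz: "k \<noteq> 0" "u \<noteq> 0" "v \<noteq> 0" and eq: "u ^ d * ?f ^ n = smult k (v ^ d)"
  have f0: "?f \<noteq> 0" using S by simp
  have "d dvd n * e i" if "i \<in> S" for i
  proof -
    have "order (r i) (u ^ d * ?f ^ n) = d * order (r i) u + n * e i"
      using nz f0 S order_prod_linear_powers[OF S that, of e] by (subst order_mult) (auto simp: order_power)
    moreover have "order (r i) (smult k (v ^ d)) = d * order (r i) v"
      using nz by (simp add: order_smult order_power)
    ultimately show ?thesis using eq by (metis dvd_add_right_iff dvd_triv_left)
  qed
  then have "d dvd Gcd ((*) n ` insert d (e ` S))" by (auto intro!: Gcd_greatest)
  also have "\<dots> = n" unfolding Gcd_mult gcd by simp
  finally show False using n by (auto dest: dvd_imp_le)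
qed

lemma unity_group_of_generator:
  fixes \<gamma> :: "'a::field"
  assumes \<gamma>: "\<gamma> ^ n = 1" "\<And>i. \<gamma> ^ i = 1 \<Longrightarrow> n dvd i" and n: "n = d * g" "n > 0"
  shows "unity_group d ((\<lambda>i. (\<gamma> ^ g) ^ i) ` {..<d})"
proof -
  define z where "z = \<gamma> ^ g"
  have dg: "d > 0" "g > 0" using n by auto
  have zd: "z ^ d = 1" using \<gamma> n by (simp add: z_def mult.commute flip: power_mult)
  have zn: "d dvd i" if "z ^ i = 1" for i
    using that \<gamma>(2)[of "g * i"] n dg by (simp add: z_def mult.commute flip: power_mult)
  have z0: "z \<noteq> 0" using zd dg by (auto simp: power_0_left)
  have le: "i = j" if "i \<le> j" "j < d" "z ^ i = z ^ j" for i j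
  proof -
    have "z ^ j = z ^ i * z ^ (j - i)" using that(1) by (metis le_add_diff_inverse power_add)
    then have "z ^ (j - i) = 1" using that(3) z0 by simp
    then have "d dvd j - i" by (rule zn)
    then show ?thesis using that by (meson diff_le_self dvd_imp_le le_less_trans leD le_antisym
        less_imp_diff_less nat_less_le not_less_iff_gr_or_eq zero_less_diff)
  qed
  have inj: "inj_on (\<lambda>i. z ^ i) {..<d}"
    by (rule inj_onI) (metis le lessThan_iff linear)
  have "z * z ^ i \<in> (\<lambda>i. z ^ i) ` {..<d}" if "i < d" for i
  proof (cases "Suc i < d")
    case True
    then show ?thesis by (intro image_eqI[of _ _ "Suc i"]) auto
  next
    case False
    then have "Suc i = d" using that by auto
    then have "z * z ^ i = z ^ 0" using zd by (metis power_0 power_Suc)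
    then show ?thesis using dg by blast
  qed
  then have "(*) z ` ((\<lambda>i. z ^ i) ` {..<d}) \<subseteq> (\<lambda>i. z ^ i) ` {..<d}" by auto
  moreover have "card ((*) z ` ((\<lambda>i. z ^ i) ` {..<d})) = card ((\<lambda>i. z ^ i) ` {..<d})"
    using z0 by (intro card_image) (auto simp: inj_on_def)
  ultimately have "(*) z ` ((\<lambda>i. z ^ i) ` {..<d}) = (\<lambda>i. z ^ i) ` {..<d}"
    by (intro card_subset_eq) auto
  moreover have "(z ^ i) ^ d = 1" for i
    using zd by (metis mult.commute power_mult power_one)
  moreover have "1 \<in> (\<lambda>i. z ^ i) ` {..<d}" using dg by (metis image_eqI lessThan_iff power_0)
  ultimately show ?thesis
    using dg inj zn unfolding unity_group_def z_def[symmetric] by (auto simp: card_image)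
qed

text \<open>Stepanov's bound with \<open>A = n ^ 2\<close>, \<open>J = n\<close> and
  \<open>M = d * s\<close>. The main term \<open>J * p / M\<close> equals
  \<open>(p / d) * (n / s)\<close>, so the loss is governed by how close \<open>s\<close> is to
  \<open>n\<close>. The zero estimate asks for roughly \<open>d * n ^ 2 < p\<close>, which
  \<open>n ^ 4 \<le> p\<close> leaves ample room for.\<close>

lemma level_set_upper:
  fixes f :: "'a::finite_field poly" and Z :: "'a set" and n m p d g :: nat
  assumes card: "CARD('a) = p" "CHAR('a) = p"
    and Z: "unity_group d Z" and dg: "d * g = p - 1" and nd: "nondegenerate d f"
    and m: "degree f = m" "m > 0"
    and n: "n ^ 4 \<le> p" "2 * (d * m + 1) \<le> n"
  shows "real (d * card {x. poly f x ^ g = c \<and> poly f x \<noteq> 0}) \<le> p + 4 * p * (d * m + 1) / n"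
proof -
  define N where "N = card {x. poly f x ^ g = c \<and> poly f x \<noteq> 0}"
  have d0: "d > 0" using unity_groupD[OF Z] by simp
  have dm: "d \<le> d * m" "m \<le> d * m" using m d0 by auto
  have dmn: "2 * (d * m) + 2 \<le> n" using n(2) by simp
  have n1: "1 \<le> n" using n by simp
  have n2: "n ^ 2 \<le> n ^ 4" "n \<le> n ^ 4" "n ^ 3 \<le> n ^ 4"
    using n1 by (auto intro: power_increasing self_le_power)
  have f0: "f \<noteq> 0" using m by auto
  have "m < p"
  proof -
    have "m < n" using dm(2) dmn by linarith
    then show ?thesis using n n2 by linarith
  qed
  obtain b where b: "poly f b \<noteq> 0"
  proof (rule ccontr)
    assume "\<not> thesis"
    then have "{x. poly f x = 0} = UNIV" using that by auto
    then show False using card_poly_roots_bound[OF f0] \<open>m < p\<close> m card by simp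
  qed
  \<comment> \<open>In the count of conditions, the deficit \<open>d * m + 1\<close> pays for the
    degree growth \<open>M * m\<close> caused by the derivatives and for the extra
    \<open>J\<close>.\<close>
  define s where "s = n - d * m - 1"
  have s: "n = s + d * m + 1" "n \<le> 2 * s" "s > 0" using n by (auto simp: s_def)
  have key: "(d * s) * (n ^ 2 + (d * s) * m + n) < d * n * n ^ 2"
  proof -
    have "s * (d * s * m + n) \<le> s * (n * (d * m + 1))"
    proof -
      have "d * s * m + n \<le> n * (d * m + 1)"
        using mult_le_mono1[of s n "d * m"] s by (simp add: algebra_simps)
      then show ?thesis by simp
    qed
    also have "\<dots> < n * (n * (d * m + 1))" using s by (intro mult_strict_right_mono) auto
    finally have "s * (n ^ 2 + d * s * m + n) < s * n ^ 2 + n ^ 2 * (d * m + 1)"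
      by (simp add: algebra_simps power2_eq_square)
    also have "\<dots> = n * n ^ 2" unfolding s(1) by (simp add: algebra_simps power2_eq_square)
    finally have "d * (s * (n ^ 2 + d * s * m + n)) < d * (n * n ^ 2)" using d0 by simp
    then show ?thesis by (simp add: mult_ac)
  qed
  have M: "d * s \<le> p"
  proof -
    have "d * s \<le> n * n" using dm(1) dmn s(1) by (intro mult_le_mono) linarith+
    then show ?thesis using n(1) n2(1) unfolding power2_eq_square by linarith
  qed
  have small: "d * (n ^ 2 - 1) + (d - 1) * m < p"
  proof -
    have "2 * (d * (n ^ 2 - 1)) \<le> (n - 2) * n ^ 2"
    proof -
      have "2 * d \<le> n - 2" using dm(1) dmn by linarith
      then have "(2 * d) * (n ^ 2 - 1) \<le> (n - 2) * n ^ 2" by (rule mult_le_mono) simp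
      then show ?thesis by (simp only: mult.assoc)
    qed
    moreover have "2 * ((d - 1) * m) < n"
      using mult_le_mono1[of "d - 1" d m] dmn by linarith
    moreover have "(n - 2) * n ^ 2 + n \<le> n ^ 3"
    proof -
      have "n \<ge> 2" using n by simp
      then obtain k where "n = k + 2" by (metis add.commute le_Suc_ex)
      then show ?thesis by (simp add: algebra_simps power2_eq_square power3_eq_cube)
    qed
    ultimately show ?thesis using n n2 by linarith
  qed
  have "d * s * N \<le> n ^ 2 + (d - 1) * g * m + n * p"
    unfolding N_def using stepanov[OF card Z dg nd b M, of "n ^ 2" n c] key small m by simp
  also have "(d - 1) * g \<le> p"
    using mult_le_mono1[of "d - 1" d g] dg by linarith
  then have "(d - 1) * g * m \<le> p * m" by simp
  finally have "s * (d * N) \<le> n ^ 2 + p * m + n * p" by (simp add: mult_ac)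
  then have "real (s * (d * N)) \<le> real (n ^ 2 + p * m + n * p)" by (simp only: of_nat_le_iff)
  also have "n ^ 2 \<le> p" using n(1) n2(1) by linarith
  then have "real (n ^ 2 + p * m + n * p) \<le> real (p + p * m + n * p)" by simp
  also have "real (p + p * m + n * p) = real s * p + real p * (m + d * m + 2)"
    by (simp add: s(1) algebra_simps)
  also have "\<dots> \<le> real s * p + real p * (2 * (d * m + 1))"
  proof -
    have "real m \<le> real d * real m" using dm(2) by (metis of_nat_le_iff of_nat_mult)
    then show ?thesis by (intro add_left_mono mult_left_mono) auto
  qed
  finally have "real (d * N) * real s \<le> real s * p + real p * (2 * (d * m + 1))"
    by (simp only: of_nat_mult mult_ac)
  then have "real (d * N) \<le> (real s * p + real p * (2 * (d * m + 1))) / real s"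
    using s(3) by (simp only: pos_le_divide_eq of_nat_0_less_iff)
  also have "\<dots> = p + real p * (2 * (d * m + 1)) / s"
    using s(3) by (simp add: add_divide_distrib)
  also have "real p * (2 * (d * m + 1)) / s \<le> real p * (2 * (d * m + 1)) / (n / 2)"
  proof (rule divide_left_mono)
    show "real n / 2 \<le> real s" using s(2) by linarith
    show "0 < real s * (real n / 2)" using s(3) n1 by simp
  qed simp
  also have "\<dots> = 4 * p * (d * m + 1) / n" by (simp add: algebra_simps)
  finally show ?thesis by (simp add: N_def)
qed

subsection \<open>Transfer to arbitrary primes\<close>

text \<open>Phrased with natural numbers and congruences, so that no field type occurs. The
  polynomial has the roots \<open>-a\<close> for \<open>a \<in> S\<close> with multiplicities
  \<open>e a\<close>, and \<open>sum e S\<close> is its degree.\<close>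

definition level_set_bound :: "nat \<Rightarrow> bool" where
  "level_set_bound p \<longleftrightarrow> (\<forall>S (e :: nat \<Rightarrow> nat) (d :: nat) (g :: nat) (n :: nat) (c :: nat). S \<subseteq> {..<p} \<longrightarrow> d * g = p - 1 \<longrightarrow>
     Gcd (insert d (e ` S)) = 1 \<longrightarrow> sum e S > 0 \<longrightarrow> n ^ 4 \<le> p \<longrightarrow> 2 * (d * sum e S + 1) \<le> n \<longrightarrow>
     real (d * card {x\<in>{..<p}. [(\<Prod>a\<in>S. (x + a) ^ e a) ^ g = c] (mod p) \<and> \<not> p dvd (\<Prod>a\<in>S. (x + a) ^ e a)})
       \<le> p + 4 * p * (d * sum e S + 1) / n)"

lemma level_set_bound_of_field:
  assumes card: "CARD('a::finite_field) = p" "CHAR('a) = p"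
  shows "level_set_bound p"
  unfolding level_set_bound_def
proof (intro allI impI)
  fix S :: "nat set" and e :: "nat \<Rightarrow> nat" and d g n c :: nat
  assume S: "S \<subseteq> {..<p}" and dg: "d * g = p - 1" and gcd: "Gcd (insert d (e ` S)) = 1"
    and e: "sum e S > 0" and n: "n ^ 4 \<le> p" "2 * (d * sum e S + 1) \<le> n"
  have p: "prime p" using card CHAR_prime[where 'a = 'a] by simp
  then have p1: "p > 1" by (rule prime_gt_1_nat)
  have fin: "finite S" using S finite_subset by blast
  define r where "r = (\<lambda>a. - of_nat a :: 'a)"
  have eqc: "(of_nat x :: 'a) = of_nat y \<longleftrightarrow> [x = y] (mod p)" for x y
    by (simp add: of_nat_eq_iff_cong_CHAR card)
  have inj: "inj_on (of_nat :: nat \<Rightarrow> 'a) {..<p}"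
    by (rule inj_onI) (auto simp: eqc cong_def)
  have injr: "inj_on r S"
    using inj_on_subset[OF inj S] by (auto simp: r_def inj_on_def)
  define f where "f = (\<Prod>a\<in>S. [:- r a, 1:] ^ e a)"
  have pf: "poly f (of_nat x) = of_nat (\<Prod>a\<in>S. (x + a) ^ e a)" for x
    by (simp add: f_def r_def poly_prod add.commute)
  have deg: "degree f = sum e S"
    by (simp add: f_def degree_prod_eq_sum_degree degree_linear_power)
  obtain \<gamma> where \<gamma>: "residue_primroot p \<gamma>" using prime_primitive_root_exists[of p] p p1 by blast
  have ord: "ord p \<gamma> = p - 1" using \<gamma> p by (simp add: residue_primroot_def totient_prime)
  have pow1: "(of_nat \<gamma> :: 'a) ^ i = 1 \<longleftrightarrow> p - 1 dvd i" for i
    using eqc[of "\<gamma> ^ i" 1] ord_divides[of \<gamma> i p] ord by simp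
  have Z: "unity_group d ((\<lambda>i. ((of_nat \<gamma> :: 'a) ^ g) ^ i) ` {..<d})"
    by (rule unity_group_of_generator[of _ "p - 1"]) (use pow1 dg p1 in auto)
  let ?A = "{x\<in>{..<p}. [(\<Prod>a\<in>S. (x + a) ^ e a) ^ g = c] (mod p) \<and> \<not> p dvd (\<Prod>a\<in>S. (x + a) ^ e a)}"
  have "of_nat ` ?A \<subseteq> {x. poly f x ^ g = of_nat c \<and> poly f x \<noteq> 0}"
  proof (rule image_subsetI)
    fix x assume "x \<in> ?A"
    then have x: "[(\<Prod>a\<in>S. (x + a) ^ e a) ^ g = c] (mod p)" "\<not> p dvd (\<Prod>a\<in>S. (x + a) ^ e a)"
      by blast+
    have "of_nat ((\<Prod>a\<in>S. (x + a) ^ e a) ^ g) = (of_nat c :: 'a)" using x(1) eqc by blast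
    moreover have "of_nat (\<Prod>a\<in>S. (x + a) ^ e a) \<noteq> (0 :: 'a)"
      unfolding of_nat_eq_0_iff_char_dvd card(2) by (rule x(2))
    ultimately show "of_nat x \<in> {x. poly f x ^ g = of_nat c \<and> poly f x \<noteq> 0}"
      unfolding pf mem_Collect_eq of_nat_power by blast
  qed
  then have "card (of_nat ` ?A :: 'a set) \<le> card {x. poly f x ^ g = of_nat c \<and> poly f x \<noteq> 0}"
    by (intro card_mono) auto
  moreover have "card (of_nat ` ?A :: 'a set) = card ?A"
    by (intro card_image inj_on_subset[OF inj]) auto
  ultimately have "real (d * card ?A) \<le> real (d * card {x. poly f x ^ g = of_nat c \<and> poly f x \<noteq> 0})"
    by (simp add: mult_left_mono)
  also have "\<dots> \<le> p + 4 * p * (d * sum e S + 1) / n"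
    by (rule level_set_upper[OF card Z dg _ deg e n])
      (use nondegenerate_prod[OF fin injr gcd] in \<open>simp add: f_def\<close>)
  finally show "real (d * card ?A) \<le> p + 4 * p * (d * sum e S + 1) / n" .
qed

text \<open>A type cannot depend on a prime, but it may depend on a hypothetical prime counterexample.\<close>
definition bad_prime :: nat where
  "bad_prime = (if \<exists>p. prime p \<and> \<not> level_set_bound p
     then SOME p. prime p \<and> \<not> level_set_bound p else 2)"

lemma bad_prime_spec:
  assumes "prime p" "\<not> level_set_bound p"
  shows "prime bad_prime" "\<not> level_set_bound bad_prime"
proof -
  have ex: "\<exists>p. prime p \<and> \<not> level_set_bound p" using assms by blast
  then have "bad_prime = (SOME p. prime p \<and> \<not> level_set_bound p)" by (simp only: bad_prime_def if_True)
  then show "prime bad_prime" "\<not> level_set_bound bad_prime" using someI_ex[OF ex] by metis+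
qed

text \<open>The type below is built whether or not a counterexample exists, and its size must be
  prime in both cases; hence the default value 2.\<close>

lemma prime_bad_prime: "prime bad_prime"
proof (cases "\<exists>p. prime p \<and> \<not> level_set_bound p")
  case False
  then have "bad_prime = 2" by (simp only: bad_prime_def if_False)
  then show ?thesis by (metis two_is_prime_nat)
qed (use bad_prime_spec in blast)

typedef bad_index = "{..<bad_prime}"
  using prime_gt_0_nat[OF prime_bad_prime] by auto

lemma CARD_bad_index: "CARD(bad_index) = bad_prime"
  using type_definition.card[OF type_definition_bad_index] by simp

instance bad_index :: prime_card
  by standard (simp add: CARD_bad_index prime_bad_prime)

lemma level_set_bound_prime:
  assumes "prime p"
  shows "level_set_bound p"
proof (rule ccontr)
  assume "\<not> level_set_bound p"
  then have "\<not> level_set_bound bad_prime"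
    using assms bad_prime_spec by blast
  moreover have "level_set_bound bad_prime"
    by (rule level_set_bound_of_field[where 'a = "bad_index mod_ring"]) (simp_all add: CARD_bad_index)
  ultimately show False by simp
qed

subsection \<open>Indices and character sums\<close>

text \<open>Determined only modulo \<open>p - 1\<close>, and arbitrary at multiples of
  \<open>p\<close>. It is used through divisibility by divisors of \<open>p - 1\<close> and through
  characters of such moduli, at arguments prime to \<open>p\<close>.\<close>

definition dlog :: "nat \<Rightarrow> nat \<Rightarrow> nat \<Rightarrow> nat" where
  "dlog p \<gamma> x = (SOME i. [\<gamma> ^ i = x] (mod p))"

lemma dlog_cong:
  assumes "prime p" "residue_primroot p \<gamma>" "\<not> p dvd x"
  shows "[\<gamma> ^ dlog p \<gamma> x = x] (mod p)"
proof -
  have "p > 1" using assms(1) prime_gt_1_nat by blast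
  have "x mod p \<in> totatives p"
    using assms(1,3) by (metis coprime_commute coprime_mod_left_iff in_totatives_iff mod_greater_zero_iff_not_dvd
        mod_less_divisor less_imp_le prime_gt_0_nat prime_imp_coprime less_nat_zero_code not_gr_zero)
  then have "x mod p \<in> (\<lambda>i. \<gamma> ^ i mod p) ` {..<totient p}"
    using residue_primroot_is_generator[OF \<open>p > 1\<close> assms(2)] unfolding bij_betw_def by blast
  then obtain i where "x mod p = \<gamma> ^ i mod p" by blast
  then have "[\<gamma> ^ i = x] (mod p)" by (simp add: cong_def)
  then have "\<exists>i. [\<gamma> ^ i = x] (mod p)" by blast
  then show ?thesis unfolding dlog_def by (rule someI_ex)
qed

text \<open>The additive character e(m/d). For \<open>d dvd p - 1\<close>, its composition with
  \<open>dlog\<close> is a multiplicative character modulo \<open>p\<close> of order dividing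
  \<open>d\<close>.\<close>

definition ec :: "nat \<Rightarrow> nat \<Rightarrow> complex" where
  "ec d m = cis (2 * pi * real m / real d)"

lemma ec_add: "ec d (a + b) = ec d a * ec d b"
  by (simp add: ec_def cis_mult ring_distribs add_divide_distrib)

lemma ec_sum: "ec d (sum f A) = (\<Prod>x\<in>A. ec d (f x))"
  by (induction A rule: infinite_finite_induct) (simp_all add: ec_add, simp_all add: ec_def)

lemma ec_mult_self:
  assumes "d > 0"
  shows "ec d (d * k) = 1"
proof -
  have "2 * pi * real (d * k) / real d = 2 * pi * real k" using assms by simp
  then show ?thesis unfolding ec_def by (simp only: cis_multiple_2pi[OF Ints_of_nat])
qed

lemma ec_mod: "d > 0 \<Longrightarrow> ec d (m mod d) = ec d m"
proof -
  assume d: "d > 0"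
  have "ec d m = ec d (d * (m div d) + m mod d)" by simp
  also have "\<dots> = ec d (m mod d)" unfolding ec_add using d by (simp add: ec_mult_self)
  finally show ?thesis by simp
qed

lemma ec_power: "ec d m ^ n = ec d (n * m)"
proof -
  have "real n * (2 * pi * real m / real d) = 2 * pi * real (n * m) / real d" by simp
  then show ?thesis unfolding ec_def Complex.DeMoivre by (rule arg_cong)
qed

lemma ec_eq_1_iff:
  assumes "d > 0"
  shows "ec d m = 1 \<longleftrightarrow> d dvd m"
proof
  assume "ec d m = 1"
  then obtain k :: int where "2 * pi * real m / real d = 2 * pi * k"
  proof -
    have "cos (2 * pi * real m / real d) = 1"
      using arg_cong[OF \<open>ec d m = 1\<close>, of Re] by (simp add: ec_def)
    then show ?thesis using that by (auto simp: cos_one_2pi_int)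
  qed
  then have "real m = real d * real_of_int k" using assms by (simp add: field_simps)
  then have "int m = int d * k" by (metis of_int_eq_iff of_int_mult of_int_of_nat_eq)
  then show "d dvd m" by (metis dvd_triv_left of_nat_dvd_iff)
next
  assume "d dvd m"
  then obtain k where "m = d * k" by (rule dvdE)
  then show "ec d m = 1" using ec_mult_self[OF assms] by simp
qed

lemma norm_ec [simp]: "norm (ec d m) = 1"
  by (simp add: ec_def)

lemma sum_ec:
  assumes "d > 0"
  shows "(\<Sum>j<d. ec d (j * m)) = (if d dvd m then of_nat d else 0)"
proof (cases "d dvd m")
  case True
  then have "ec d (j * m) = 1" for j using assms by (simp add: ec_eq_1_iff)
  then show ?thesis using True by simp
next
  case False
  then have ne: "ec d m \<noteq> 1" using assms by (simp add: ec_eq_1_iff)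
  have "(\<Sum>j<d. ec d (j * m)) = (\<Sum>j<d. ec d m ^ j)" by (simp add: ec_power)
  also have "\<dots> = (ec d m ^ d - 1) / (ec d m - 1)" using ne by (rule geometric_sum)
  also have "ec d m ^ d = 1" using assms by (simp add: ec_power ec_mult_self)
  finally show ?thesis using False by simp
qed

definition nonzero_shifts :: "nat \<Rightarrow> nat set \<Rightarrow> nat set" where
  "nonzero_shifts p S = {x\<in>{..<p}. \<forall>a\<in>S. \<not> p dvd (x + a)}"

lemma nonzero_shifts_bounds:
  assumes "p > 0" "finite S"
  shows "card (nonzero_shifts p S) \<le> p" "p \<le> card (nonzero_shifts p S) + card S"
proof -
  show "card (nonzero_shifts p S) \<le> p"
    using card_mono[of "{..<p}" "nonzero_shifts p S"] by (auto simp: nonzero_shifts_def)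
  have one: "card {x\<in>{..<p}. p dvd (x + a)} \<le> 1" for a
  proof -
    have "x = y" if "x < p" "y < p" "p dvd x + a" "p dvd y + a" for x y
    proof -
      have "(x + a) mod p = (y + a) mod p" using that(3,4) by (simp only: dvd_imp_mod_0)
      then have "[x = y] (mod p)" using cong_add_rcancel_nat[of x a y p] by (simp add: cong_def)
      then show ?thesis using that(1,2) by (simp add: cong_def)
    qed
    then have "card {x\<in>{..<p}. p dvd (x + a)} \<le> Suc 0"
      by (subst card_le_Suc0_iff_eq) auto
    then show ?thesis by simp
  qed
  have "{..<p} - nonzero_shifts p S = (\<Union>a\<in>S. {x\<in>{..<p}. p dvd (x + a)})"
    by (auto simp: nonzero_shifts_def)
  then have "card ({..<p} - nonzero_shifts p S) \<le> (\<Sum>a\<in>S. card {x\<in>{..<p}. p dvd (x + a)})"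
    using card_UN_le[OF assms(2)] by metis
  also have "\<dots> \<le> (\<Sum>a\<in>S. 1)" by (intro sum_mono one)
  finally have "card ({..<p} - nonzero_shifts p S) \<le> card S" by simp
  moreover have "card ({..<p} - nonzero_shifts p S) = p - card (nonzero_shifts p S)"
    by (subst card_Diff_subset) (auto simp: nonzero_shifts_def)
  ultimately show "p \<le> card (nonzero_shifts p S) + card S" by linarith
qed

text \<open>Fixing the index of the product modulo \<open>d\<close> fixes its \<open>g\<close>-th
  power, so each class \<open>N r\<close> lies in one level set and exceeds its share
  \<open>p / d\<close> by at most \<open>E / d\<close>.\<close>

lemma character_sum_primitive:
  fixes n :: nat
  assumes p: "prime p" and \<gamma>: "residue_primroot p \<gamma>" and S: "S \<subseteq> {..<p}"
    and d: "d dvd p - 1" "d \<ge> 2" and gcd: "Gcd (insert d (e ` S)) = 1"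
    and e: "sum e S > 0" and n: "n ^ 4 \<le> p" "2 * (d * sum e S + 1) \<le> n"
  shows "norm (\<Sum>x\<in>nonzero_shifts p S. ec d (\<Sum>a\<in>S. e a * dlog p \<gamma> (x + a)))
    \<le> real (8 * p * (d * sum e S + 1)) / real n + card S"
proof -
  define X where "X = nonzero_shifts p S"
  define \<mu> where "\<mu> = (\<lambda>x. \<Sum>a\<in>S. e a * dlog p \<gamma> (x + a))"
  define N where "N = (\<lambda>r. card {x\<in>X. \<mu> x mod d = r})"
  define E where "E = 4 * p * (d * sum e S + 1) / n"
  have p0: "p > 1" using p prime_gt_1_nat by blast
  have finS: "finite S" using S finite_subset by blast
  have finX: "finite X" by (simp add: X_def nonzero_shifts_def)
  obtain g where g: "d * g = p - 1" using d(1) by (metis dvdE)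
  have d0: "d > 0" using d by simp
  have E0: "E \<ge> 0" by (simp add: E_def sum_nonneg)
  have ord: "ord p \<gamma> = p - 1" using \<gamma> p by (simp add: residue_primroot_def totient_prime)
  have cop: "coprime p \<gamma>" using \<gamma> by (simp add: residue_primroot_def)
  have prodcong: "[(\<Prod>a\<in>S. (x + a) ^ e a) = \<gamma> ^ \<mu> x] (mod p)" if "x \<in> X" for x
  proof -
    have "\<gamma> ^ \<mu> x = (\<Prod>a\<in>S. (\<gamma> ^ dlog p \<gamma> (x + a)) ^ e a)"
      by (simp add: \<mu>_def power_sum mult.commute flip: power_mult)
    moreover have "[(\<Prod>a\<in>S. (\<gamma> ^ dlog p \<gamma> (x + a)) ^ e a) = (\<Prod>a\<in>S. (x + a) ^ e a)] (mod p)"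
      using that by (intro cong_prod cong_pow dlog_cong p \<gamma>) (auto simp: X_def nonzero_shifts_def)
    ultimately show ?thesis by (simp add: cong_sym)
  qed
  have N_le: "real (N r) \<le> p / d + E / d" for r
  proof -
    have "{x\<in>X. \<mu> x mod d = r} \<subseteq> {x\<in>{..<p}. [(\<Prod>a\<in>S. (x + a) ^ e a) ^ g = \<gamma> ^ (r * g)] (mod p) \<and>
        \<not> p dvd (\<Prod>a\<in>S. (x + a) ^ e a)}"
    proof (rule subsetI)
      fix x assume x: "x \<in> {x\<in>X. \<mu> x mod d = r}"
      have "[\<mu> x * g = r * g] (mod (d * g))"
        using x by (auto simp: cong_def mod_mult_mult2)
      then have "[\<mu> x * g = r * g] (mod (p - 1))" unfolding g .
      then have "[\<gamma> ^ (\<mu> x * g) = \<gamma> ^ (r * g)] (mod p)"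
        using order_divides_expdiff[OF cop] ord by simp
      moreover have "[(\<Prod>a\<in>S. (x + a) ^ e a) ^ g = (\<gamma> ^ \<mu> x) ^ g] (mod p)"
        using x by (intro cong_pow prodcong) auto
      ultimately have "[(\<Prod>a\<in>S. (x + a) ^ e a) ^ g = \<gamma> ^ (r * g)] (mod p)"
        by (metis cong_trans power_mult)
      moreover have "\<not> p dvd (\<Prod>a\<in>S. (x + a) ^ e a)"
        using x p finS by (auto simp: prime_dvd_prod_iff X_def nonzero_shifts_def dest: prime_dvd_power)
      ultimately show "x \<in> {x\<in>{..<p}. [(\<Prod>a\<in>S. (x + a) ^ e a) ^ g = \<gamma> ^ (r * g)] (mod p) \<and>
        \<not> p dvd (\<Prod>a\<in>S. (x + a) ^ e a)}" using x by (simp add: X_def nonzero_shifts_def)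
    qed
    then have "real (d * N r) \<le> real (d * card {x\<in>{..<p}. [(\<Prod>a\<in>S. (x + a) ^ e a) ^ g = \<gamma> ^ (r * g)] (mod p) \<and>
        \<not> p dvd (\<Prod>a\<in>S. (x + a) ^ e a)})"
      unfolding N_def of_nat_le_iff by (intro mult_le_mono2 card_mono) auto
    also have "\<dots> \<le> p + E"
      using level_set_bound_prime[OF p] S g gcd e n unfolding level_set_bound_def E_def by blast
    finally show ?thesis using d0 by (simp add: field_simps)
  qed
  have groups: "(\<Sum>x\<in>X. h (\<mu> x mod d)) = (\<Sum>r<d. of_nat (N r) * h r)" for h :: "nat \<Rightarrow> complex"
  proof -
    have "(\<Sum>x\<in>X. h (\<mu> x mod d)) = (\<Sum>r<d. \<Sum>x\<in>{x\<in>X. \<mu> x mod d = r}. h (\<mu> x mod d))"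
      using finX d0 by (intro sum.group[symmetric]) auto
    also have "\<dots> = (\<Sum>r<d. of_nat (N r) * h r)"
      by (intro sum.cong refl) (simp add: N_def)
    finally show ?thesis .
  qed
  have total: "(\<Sum>r<d. real (N r)) = real (card X)"
  proof -
    have "of_real (\<Sum>r<d. real (N r)) = (of_real (real (card X)) :: complex)"
      using groups[of "\<lambda>_. 1"] by simp
    then show ?thesis using of_real_eq_iff by blast
  qed
  \<comment> \<open>Since the values of the character add up to zero, the share \<open>p / d\<close>
    can be subtracted from every count.\<close>
  have "(\<Sum>r<d. ec d r) = 0" using sum_ec[OF d0, of 1] d by simp
  then have "(\<Sum>x\<in>X. ec d (\<mu> x)) = (\<Sum>r<d. of_nat (N r) * ec d r) - of_real (p / d) * (\<Sum>r<d. ec d r)"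
    using groups[of "ec d"] d0 by (simp add: ec_mod)
  also have "\<dots> = (\<Sum>r<d. of_real (real (N r) - p / d) * ec d r)"
    by (simp add: sum_distrib_left sum_subtractf left_diff_distrib)
  also have "norm \<dots> \<le> (\<Sum>r<d. \<bar>real (N r) - p / d\<bar>)"
    by (rule sum_norm_le) (simp add: norm_mult del: of_real_diff)
  \<comment> \<open>If \<open>t \<le> s\<close> and \<open>s \<ge> 0\<close>, then
    \<open>\<bar>t\<bar> \<le> 2 * s - t\<close>. A one-sided bound thus becomes two-sided at the
    price of the sum of the deviations, which is \<open>card X - p\<close>.\<close>
  also have "\<dots> \<le> (\<Sum>r<d. 2 * (E / d) - (real (N r) - p / d))"
  proof (rule sum_mono)
    fix r
    have "E / d \<ge> 0" using E0 by simp
    then show "\<bar>real (N r) - p / d\<bar> \<le> 2 * (E / d) - (real (N r) - p / d)"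
      using N_le[of r] by linarith
  qed
  also have "\<dots> = 2 * E + (p - real (card X))"
    using d0 by (simp add: sum_subtractf sum.distrib total)
  also have "\<dots> \<le> 2 * E + card S"
    using nonzero_shifts_bounds(2)[of p S] finS p0 by (simp add: X_def)
  also have "2 * E = real (8 * p * (d * sum e S + 1)) / real n" by (simp add: E_def algebra_simps)
  finally show ?thesis unfolding X_def \<mu>_def .
qed

text \<open>Characters of different orders \<open>D a\<close> are written over the common modulus
  \<open>L\<close>. Their exponents may share a factor with \<open>L\<close>, whereas the primitive
  case asks for gcd 1; cancelling it leaves the modulus \<open>d = L / g\<close>, which is at least
  2 because some exponent stays strictly between 0 and \<open>d\<close>.\<close>

lemma character_sum_bound:
  fixes n :: nat
  assumes p: "prime p" and \<gamma>: "residue_primroot p \<gamma>" and S: "S \<subseteq> {..<p}"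
    and D: "\<And>a. a \<in> S \<Longrightarrow> D a dvd p - 1"
    and j: "\<And>a. a \<in> S \<Longrightarrow> j a < D a" "\<exists>a\<in>S. j a \<noteq> 0"
    and n: "n ^ 4 \<le> p" "2 * (card S * (\<Prod>a\<in>S. D a) ^ 2 + 1) \<le> n"
  shows "norm (\<Sum>x\<in>nonzero_shifts p S. \<Prod>a\<in>S. ec (D a) (j a * dlog p \<gamma> (x + a)))
    \<le> real (8 * p * (card S * (\<Prod>a\<in>S. D a) ^ 2 + 1)) / real n + card S"
proof -
  have p0: "p > 1" using p prime_gt_1_nat by blast
  have finS: "finite S" using S finite_subset by blast
  define L where "L = Lcm (D ` S)"
  have Dpos: "D a > 0" if "a \<in> S" for a using j(1)[OF that] by simp
  have L: "L dvd p - 1" unfolding L_def using D by (auto intro: Lcm_least)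
  have LD: "L dvd (\<Prod>a\<in>S. D a)" unfolding L_def using finS by (auto intro!: Lcm_least dvd_prodI)
  have prodpos: "(\<Prod>a\<in>S. D a) > 0" using Dpos by (intro prod_pos) auto
  have L0: "L > 0" using L p0 by (metis dvd_0_left gr0I not_less zero_less_diff not_less_iff_gr_or_eq)
  have DL: "D a dvd L" if "a \<in> S" for a using that by (simp add: L_def)
  have LDpos: "L div D a > 0" if "a \<in> S" for a
    using DL[OF that] L0 Dpos[OF that] by (simp add: div_greater_zero_iff dvd_imp_le)
  define F where "F = (\<lambda>a. j a * (L div D a))"
  have FL: "F a < L" if "a \<in> S" for a
  proof -
    have "F a < D a * (L div D a)" unfolding F_def
      using j(1)[OF that] LDpos[OF that] by (rule mult_strict_right_mono)
    then show ?thesis using DL[OF that] by simp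
  qed
  define g where "g = Gcd (insert L (F ` S))"
  have gL: "g dvd L" "\<And>a. a \<in> S \<Longrightarrow> g dvd F a"
    unfolding g_def by (rule Gcd_dvd, simp)+
  have g0: "g > 0" using gL(1) L0 by (metis dvd_0_left gr0I less_irrefl)
  define d where "d = L div g"
  define e where "e = (\<lambda>a. F a div g)"
  have Ld: "L = g * d" using gL by (simp add: d_def)
  have Fe: "F a = g * e a" if "a \<in> S" for a using gL(2)[OF that] by (simp add: e_def)
  have ed: "e a < d" if "a \<in> S" for a using FL[OF that] Ld Fe[OF that] g0 by simp
  obtain a0 where a0: "a0 \<in> S" "j a0 \<noteq> 0" using j(2) by blast
  have e0: "e a0 > 0"
  proof -
    have "F a0 > 0" using a0 LDpos[OF a0(1)] by (simp add: F_def)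
    then show ?thesis using Fe[OF a0(1)] by simp
  qed
  have d2: "d \<ge> 2" using ed[OF a0(1)] e0 by simp
  have ddvd: "d dvd L" using Ld by simp
  have gcd1: "Gcd (insert d (e ` S)) = 1"
  proof -
    have "insert L (F ` S) = (*) g ` insert d (e ` S)"
      using Ld Fe by (auto simp: image_iff)
    then have "g = g * Gcd (insert d (e ` S))"
      unfolding g_def by (metis Gcd_mult normalize_nat_def g_def id_apply normalize_nat_def)
    then show ?thesis using g0 by simp
  qed
  have sum0: "sum e S > 0" using a0 e0 finS by (metis gr0I less_irrefl sum_eq_0_iff)
  have dP: "d \<le> (\<Prod>a\<in>S. D a)" using ddvd LD prodpos by (meson dvd_imp_le dvd_trans)
  have "sum e S \<le> (\<Sum>a\<in>S. d)" using ed by (intro sum_mono) (simp add: less_imp_le)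
  then have "sum e S \<le> card S * d" by simp
  then have "d * sum e S \<le> card S * (d * d)"
    using mult_le_mono2[of "sum e S" "card S * d" d] by (simp add: mult_ac)
  also have "\<dots> \<le> card S * ((\<Prod>a\<in>S. D a) * (\<Prod>a\<in>S. D a))"
    using dP by (intro mult_le_mono) auto
  finally have ds: "d * sum e S \<le> card S * (\<Prod>a\<in>S. D a) ^ 2" by (simp add: power2_eq_square)
  have "(\<Prod>a\<in>S. ec (D a) (j a * dlog p \<gamma> (x + a))) = ec d (\<Sum>a\<in>S. e a * dlog p \<gamma> (x + a))" for x
    unfolding ec_sum
  proof (intro prod.cong refl)
    fix a assume a: "a \<in> S"
    have "real (j a) / real (D a) = real (e a) / real d"
    proof -
      have "j a * L = D a * F a" using DL[OF a] by (auto simp: F_def)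
      then have "g * (j a * d) = g * (D a * e a)" using Ld Fe[OF a] by (simp add: mult_ac)
      then have "j a * d = D a * e a" using g0 by simp
      then have "real (j a) * real d = real (D a) * real (e a)" by (metis of_nat_mult)
      then show ?thesis using Dpos[OF a] d2 by (simp add: field_simps)
    qed
    then have "real (j a) / real (D a) * (2 * pi * real (dlog p \<gamma> (x + a)))
        = real (e a) / real d * (2 * pi * real (dlog p \<gamma> (x + a)))" by simp
    then show "ec (D a) (j a * dlog p \<gamma> (x + a)) = ec d (e a * dlog p \<gamma> (x + a))"
      by (simp add: ec_def mult_ac)
  qed
  then have eq: "(\<Sum>x\<in>nonzero_shifts p S. \<Prod>a\<in>S. ec (D a) (j a * dlog p \<gamma> (x + a)))
      = (\<Sum>x\<in>nonzero_shifts p S. ec d (\<Sum>a\<in>S. e a * dlog p \<gamma> (x + a)))" by simp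
  have "norm (\<Sum>x\<in>nonzero_shifts p S. \<Prod>a\<in>S. ec (D a) (j a * dlog p \<gamma> (x + a)))
     \<le> real (8 * p * (d * sum e S + 1)) / real n + card S"
    unfolding eq
  proof (rule character_sum_primitive[OF p \<gamma> S _ d2 gcd1 sum0 n(1)])
    show "d dvd p - 1" using ddvd L by (rule dvd_trans)
    have "d * sum e S + 1 \<le> card S * (\<Prod>a\<in>S. D a) ^ 2 + 1" using ds by simp
    then have "2 * (d * sum e S + 1) \<le> 2 * (card S * (\<Prod>a\<in>S. D a) ^ 2 + 1)" by (rule mult_le_mono2)
    then show "2 * (d * sum e S + 1) \<le> n" using n(2) by (rule order_trans)
  qed
  also have "real (8 * p * (d * sum e S + 1)) / real n \<le> real (8 * p * (card S * (\<Prod>a\<in>S. D a) ^ 2 + 1)) / real n"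
  proof (rule divide_right_mono)
    show "real (8 * p * (d * sum e S + 1)) \<le> real (8 * p * (card S * (\<Prod>a\<in>S. D a) ^ 2 + 1))"
      unfolding of_nat_le_iff using ds by (intro mult_le_mono2) simp
  qed simp
  finally show ?thesis by simp
qed

text \<open>Each divisibility condition is an average of \<open>D a\<close> characters. After
  expanding the product, the zero tuple gives the main term and every other tuple a character sum
  with the power saving.\<close>

lemma power_residue_pattern_count:
  fixes n :: nat
  assumes p: "prime p" and \<gamma>: "residue_primroot p \<gamma>" and S: "S \<subseteq> {..<p}"
    and D: "\<And>a. a \<in> S \<Longrightarrow> D a dvd p - 1"
    and n: "n ^ 4 \<le> p" "2 * (card S * (\<Prod>a\<in>S. D a) ^ 2 + 1) \<le> n"
  shows "\<bar>real (card {x\<in>nonzero_shifts p S. \<forall>a\<in>S. D a dvd dlog p \<gamma> (x + a)}) - real p / real (\<Prod>a\<in>S. D a)\<bar>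
    \<le> real (10 * p * (card S * (\<Prod>a\<in>S. D a) ^ 2 + 1)) / real n"
proof -
  define X where "X = nonzero_shifts p S"
  define P where "P = (\<Prod>a\<in>S. D a)"
  define J where "J = (\<Pi>\<^sub>E a\<in>S. {..<D a})"
  define B where "B = real (8 * p * (card S * P ^ 2 + 1)) / real n + card S"
  define s where "s = (\<lambda>j. \<Sum>x\<in>X. \<Prod>a\<in>S. ec (D a) (j a * dlog p \<gamma> (x + a)))"
  have p0: "p > 1" using p prime_gt_1_nat by blast
  have finS: "finite S" using S finite_subset by blast
  have finX: "finite X" by (simp add: X_def nonzero_shifts_def)
  have Dpos: "D a > 0" if "a \<in> S" for a using D[OF that] p0 by (intro Nat.gr0I) auto
  have P0: "P > 0" unfolding P_def using Dpos by (intro prod_pos) auto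
  have B0: "B \<ge> 0" by (simp add: B_def)
  have finJ: "finite J" unfolding J_def by (intro finite_PiE) (use finS in auto)
  have cardJ: "card J = P" by (simp add: J_def P_def card_PiE finS)
  define z where "z = restrict (\<lambda>_. 0::nat) S"
  have zJ: "z \<in> J" using Dpos by (auto simp: z_def J_def)
  have sz: "s z = of_nat (card X)" by (simp add: s_def z_def ec_def)
  have sb: "norm (s j) \<le> B" if "j \<in> J - {z}" for j
  proof -
    have "\<exists>a\<in>S. j a \<noteq> 0"
    proof (rule ccontr)
      assume "\<not> (\<exists>a\<in>S. j a \<noteq> 0)"
      then have "j = z" using that by (intro ext) (auto simp: J_def z_def PiE_def extensional_def restrict_def)
      then show False using that by simp
    qed
    moreover have "j a < D a" if "a \<in> S" for a using that \<open>j \<in> J - {z}\<close> by (auto simp: J_def)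
    ultimately show ?thesis
      unfolding s_def X_def B_def P_def using character_sum_bound[OF p \<gamma> S D _ _ n] by blast
  qed
  define Y where "Y = {x\<in>X. \<forall>a\<in>S. D a dvd dlog p \<gamma> (x + a)}"
  have "of_nat P * of_nat (card Y) = (\<Sum>x\<in>X. if \<forall>a\<in>S. D a dvd dlog p \<gamma> (x + a) then of_nat P else (0::complex))"
    using finX by (simp add: Y_def sum.If_cases Int_def)
  also have "\<dots> = (\<Sum>x\<in>X. \<Prod>a\<in>S. if D a dvd dlog p \<gamma> (x + a) then of_nat (D a) else 0)"
    by (intro sum.cong refl) (auto simp: P_def finS)
  also have "\<dots> = (\<Sum>x\<in>X. \<Prod>a\<in>S. \<Sum>i<D a. ec (D a) (i * dlog p \<gamma> (x + a)))"
    by (intro sum.cong prod.cong refl) (simp add: sum_ec Dpos)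
  also have "\<dots> = (\<Sum>x\<in>X. \<Sum>j\<in>J. \<Prod>a\<in>S. ec (D a) (j a * dlog p \<gamma> (x + a)))"
    unfolding J_def by (intro sum.cong refl prod_sum_PiE) (use finS in auto)
  also have "\<dots> = (\<Sum>j\<in>J. s j)" unfolding s_def by (rule sum.swap)
  also have "\<dots> = of_nat (card X) + (\<Sum>j\<in>J - {z}. s j)" using finJ zJ sz by (simp add: sum.remove)
  finally have eq: "of_real (P * real (card Y) - card X) = (\<Sum>j\<in>J - {z}. s j)" by simp
  have "\<bar>P * real (card Y) - card X\<bar> = norm (\<Sum>j\<in>J - {z}. s j)"
    unfolding eq[symmetric] norm_of_real by simp
  also have "\<dots> \<le> (\<Sum>j\<in>J - {z}. B)" by (intro sum_norm_le sb)
  also have "\<dots> \<le> P * B"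
    using card_mono[of J "J - {z}"] finJ B0 cardJ by (simp add: mult_right_mono)
  finally have 1: "\<bar>P * real (card Y) - card X\<bar> \<le> P * B" .
  have 2: "\<bar>real (card X) - p\<bar> \<le> card S"
    using nonzero_shifts_bounds[of p S] finS p0 by (simp add: X_def)
  have P1: "real P \<ge> 1" using P0 by simp
  have "\<bar>P * real (card Y) - p\<bar> \<le> P * B + card S" using 1 2 by linarith
  also have "real (card S) \<le> P * card S" using P1 by (simp add: mult_le_cancel_right1)
  finally have "\<bar>P * (real (card Y) - p / P)\<bar> \<le> P * (B + card S)" using P0 by (simp add: algebra_simps)
  then have "\<bar>real (card Y) - p / P\<bar> \<le> B + card S" using P0 by (simp add: abs_mult)
  \<comment> \<open>The constant 10 is 8 from the character sums plus two copies of
    \<open>card S\<close>, each absorbed by means of \<open>n \<le> p\<close>.\<close>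
  also have "\<dots> \<le> real (10 * p * (card S * P ^ 2 + 1)) / real n"
  proof -
    have n0: "n > 0" using n(2) by simp
    have "n \<le> n ^ 4" using n0 by (intro self_le_power) auto
    then have np: "n \<le> p" using n(1) by simp
    have "card S * 1 \<le> card S * P ^ 2" using P0 by (intro mult_le_mono2) simp
    then have "card S \<le> card S * P ^ 2 + 1" by linarith
    then have "n * card S \<le> p * (card S * P ^ 2 + 1)" using np by (rule mult_le_mono[rotated])
    then have "real n * real (card S) \<le> real (p * (card S * P ^ 2 + 1))" by (metis of_nat_le_iff of_nat_mult)
    then have "real (card S) \<le> real (p * (card S * P ^ 2 + 1)) / n" using n0 by (simp add: field_simps)
    moreover define Y where "Y = real (p * (card S * P ^ 2 + 1)) / n"
    moreover have "B = 8 * Y + card S" by (simp add: B_def Y_def algebra_simps add_divide_distrib)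
    moreover have "real (10 * p * (card S * P ^ 2 + 1)) / real n = 10 * Y" by (simp add: Y_def algebra_simps add_divide_distrib)
    ultimately show ?thesis by linarith
  qed
  finally show ?thesis by (simp add: Y_def X_def P_def)
qed

subsection \<open>Truncated inclusion-exclusion\<close>

text \<open>Elementary symmetric function. With 0-1 weights it counts the \<open>j\<close>-sets of
  events that all occur; with probabilities it is the mean of that count for independent
  events.\<close>

definition esym :: "('i \<Rightarrow> real) \<Rightarrow> 'i set \<Rightarrow> nat \<Rightarrow> real" where
  "esym w I j = (\<Sum>B | B \<subseteq> I \<and> card B = j. \<Prod>i\<in>B. w i)"

lemma esym_0: "finite I \<Longrightarrow> esym w I 0 = 1"
proof -
  assume "finite I"
  then have "{B. B \<subseteq> I \<and> card B = 0} = {{}}" by (auto simp: finite_subset)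
  then show ?thesis by (simp add: esym_def)
qed

lemma esym_empty_Suc: "esym w {} (Suc j) = 0"
  by (auto simp: esym_def intro!: sum.neutral)

lemma esym_insert:
  assumes "finite I" "x \<notin> I"
  shows "esym w (insert x I) (Suc j) = esym w I (Suc j) + w x * esym w I j"
proof -
  let ?A = "{B. B \<subseteq> I \<and> card B = Suc j}" and ?C = "{B. B \<subseteq> I \<and> card B = j}"
  have fin: "finite ?A" "finite ?C" using assms(1) by auto
  have "{B. B \<subseteq> insert x I \<and> card B = Suc j} = ?A \<union> insert x ` ?C"
  proof (intro equalityI subsetI)
    fix B assume B: "B \<in> {B. B \<subseteq> insert x I \<and> card B = Suc j}"
    show "B \<in> ?A \<union> insert x ` ?C"
    proof (cases "x \<in> B")
      case True
      then have "B = insert x (B - {x})" "B - {x} \<subseteq> I" "card (B - {x}) = j" using B by auto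
      then show ?thesis by blast
    qed (use B in auto)
  next
    fix B assume "B \<in> ?A \<union> insert x ` ?C"
    moreover have "card (insert x C) = Suc j" if "C \<subseteq> I" "card C = j" for C
      using that assms finite_subset by (subst card_insert_disjoint) auto
    ultimately show "B \<in> {B. B \<subseteq> insert x I \<and> card B = Suc j}" by auto
  qed
  moreover have "?A \<inter> insert x ` ?C = {}" using assms(2) by auto
  ultimately have "esym w (insert x I) (Suc j) = esym w I (Suc j) + (\<Sum>B\<in>insert x ` ?C. \<Prod>i\<in>B. w i)"
    unfolding esym_def using fin by (simp add: sum.union_disjoint)
  also have "(\<Sum>B\<in>insert x ` ?C. \<Prod>i\<in>B. w i) = (\<Sum>C\<in>?C. \<Prod>i\<in>insert x C. w i)"
    by (subst sum.reindex) (use assms(2) in \<open>auto simp: inj_on_def\<close>)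
  also have "\<dots> = (\<Sum>C\<in>?C. w x * (\<Prod>i\<in>C. w i))"
    using assms finite_subset by (intro sum.cong refl, subst prod.insert) auto
  finally show ?thesis by (simp add: esym_def sum_distrib_left)
qed

text \<open>Weights anywhere between 0 and 1 let the same truncation serve for actual counts and for
  the independent model. The signed remainder satisfies
  \<open>R (insert x I) (Suc m) = R I (Suc m) + w x * R I m\<close>, the same recursion as
  \<open>esym\<close>, so both bounds follow by induction.\<close>

lemma bonferroni:
  assumes "finite I" "\<And>i. i \<in> I \<Longrightarrow> 0 \<le> w i \<and> w i \<le> 1"
  shows "0 \<le> (-1) ^ k * ((\<Prod>i\<in>I. 1 - w i) - (\<Sum>j<k. (-1) ^ j * esym w I j)) \<and>
    (-1) ^ k * ((\<Prod>i\<in>I. 1 - w i) - (\<Sum>j<k. (-1) ^ j * esym w I j)) \<le> esym w I k"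
proof -
  define R where "R = (\<lambda>I k. (-1) ^ k * ((\<Prod>i\<in>I. 1 - w i) - (\<Sum>j<k. (-1) ^ j * esym w I j)))"
  have "0 \<le> R I k \<and> R I k \<le> esym w I k"
    using assms
  proof (induction I arbitrary: k rule: finite_induct)
    case empty
    have e: "esym w {} j = (if j = 0 then 1 else 0)" for j
      by (cases j) (simp_all add: esym_0 esym_empty_Suc)
    have "(\<Sum>j<k. (-1) ^ j * esym w {} j) = (if k = 0 then 0 else 1)"
      by (simp add: e if_distrib cong: if_cong)
    then show ?case by (simp add: R_def e)
  next
    case (insert x I)
    have IH: "0 \<le> R I k" "R I k \<le> esym w I k" for k using insert by auto
    have wx: "0 \<le> w x" "w x \<le> 1" using insert by auto
    show ?case
    proof (cases k)
      case 0
      have "0 \<le> (\<Prod>i\<in>insert x I. 1 - w i)" "(\<Prod>i\<in>insert x I. 1 - w i) \<le> 1"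
        using insert.prems by (auto intro!: prod_nonneg prod_le_1)
      then show ?thesis using insert.hyps(1) by (simp add: R_def 0 esym_0)
    next
      case (Suc m)
      define T where "T = (\<lambda>I k. \<Sum>j<k. (-1) ^ j * esym w I j)"
      have T_Suc: "T J (Suc m) = 1 + (\<Sum>j<m. (-1) ^ Suc j * esym w J (Suc j))" if "finite J" for J
        unfolding T_def sum.lessThan_Suc_shift using that by (simp add: esym_0)
      have eqn: "(\<Sum>j<m. (-1) ^ Suc j * esym w (insert x I) (Suc j)) =
          (\<Sum>j<m. (-1) ^ Suc j * esym w I (Suc j) - w x * ((-1) ^ j * esym w I j))"
        using insert.hyps by (intro sum.cong refl) (simp add: esym_insert algebra_simps)
      have fin: "finite (insert x I)" using insert.hyps by simp
      have T_insert: "T (insert x I) (Suc m) = T I (Suc m) - w x * T I m"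
        unfolding T_Suc[OF fin] T_Suc[OF insert.hyps(1)] eqn unfolding T_def sum_subtractf sum_distrib_left
        by (simp del: power_Suc)
      have R_eq: "R J k = (-1) ^ k * ((\<Prod>i\<in>J. 1 - w i) - T J k)" for J k
        by (simp add: R_def T_def)
      have "R (insert x I) (Suc m) = (-1) ^ Suc m * ((1 - w x) * (\<Prod>i\<in>I. 1 - w i) - (T I (Suc m) - w x * T I m))"
        unfolding R_eq T_insert using insert.hyps by simp
      also have "\<dots> = R I (Suc m) + w x * R I m"
        unfolding R_eq by (simp add: algebra_simps)
      finally have "R (insert x I) (Suc m) = R I (Suc m) + w x * R I m" .
      moreover have "0 \<le> w x * R I m" "w x * R I m \<le> w x * esym w I m"
        using IH[of m] wx by (auto intro: mult_left_mono)
      ultimately show ?thesis using IH[of "Suc m"] insert.hyps by (simp add: Suc esym_insert)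
    qed
  qed
  then show ?thesis by (simp only: R_def)
qed

lemma bonferroni_abs:
  assumes "finite I" "\<And>i. i \<in> I \<Longrightarrow> 0 \<le> w i \<and> w i \<le> 1"
  shows "\<bar>(\<Prod>i\<in>I. 1 - w i) - (\<Sum>j<k. (-1) ^ j * esym w I j)\<bar> \<le> esym w I k"
proof -
  have "\<bar>(\<Prod>i\<in>I. 1 - w i) - (\<Sum>j<k. (-1) ^ j * esym w I j)\<bar>
      = \<bar>(-1) ^ k * ((\<Prod>i\<in>I. 1 - w i) - (\<Sum>j<k. (-1) ^ j * esym w I j))\<bar>"
    by (simp add: abs_mult power_abs)
  then show ?thesis using bonferroni[OF assms, where k = k] by simp
qed

lemma power_Suc_add_ge:
  assumes "0 \<le> (s::real)" "0 \<le> w"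
  shows "s ^ Suc n + real (Suc n) * w * s ^ n \<le> (s + w) ^ Suc n"
proof (induction n)
  case (Suc n)
  have "s ^ Suc (Suc n) + real (Suc (Suc n)) * w * s ^ Suc n
     \<le> s ^ Suc (Suc n) + real (Suc (Suc n)) * w * s ^ Suc n + real (Suc n) * w ^ 2 * s ^ n"
    using assms by simp
  also have "\<dots> = (s + w) * (s ^ Suc n + real (Suc n) * w * s ^ n)"
    by (simp add: algebra_simps power2_eq_square)
  also have "\<dots> \<le> (s + w) * (s + w) ^ Suc n" using Suc assms by (intro mult_left_mono) auto
  finally show ?case by simp
qed simp

text \<open>Expanding the power of the sum produces every \<open>j\<close>-set \<open>fact j\<close>
  times. The factorial is what makes truncation at a moderate depth accurate.\<close>

lemma esym_le:
  assumes "finite I" "\<And>i. i \<in> I \<Longrightarrow> 0 \<le> w i"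
  shows "esym w I j \<le> (\<Sum>i\<in>I. w i) ^ j / fact j"
  using assms
proof (induction I arbitrary: j rule: finite_induct)
  case empty
  then show ?case by (cases j) (simp_all add: esym_0 esym_empty_Suc)
next
  case (insert x I)
  define s where "s = (\<Sum>i\<in>I. w i)"
  have s: "0 \<le> s" "0 \<le> w x" using insert.prems by (auto simp: s_def intro: sum_nonneg)
  show ?case
  proof (cases j)
    case 0
    then show ?thesis using insert.hyps by (simp add: esym_0)
  next
    case (Suc m)
    have "esym w (insert x I) (Suc m) \<le> s ^ Suc m / fact (Suc m) + w x * (s ^ m / fact m)"
    proof -
      have "esym w I j \<le> s ^ j / fact j" for j using insert by (simp add: s_def)
      then have "esym w I (Suc m) \<le> s ^ Suc m / fact (Suc m)" "w x * esym w I m \<le> w x * (s ^ m / fact m)"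
        using s(2) by (blast, blast intro: mult_left_mono)
      then show ?thesis unfolding esym_insert[OF insert.hyps] by (rule add_mono)
    qed
    also have "\<dots> = (s ^ Suc m + real (Suc m) * w x * s ^ m) / fact (Suc m)"
    proof -
      have "real (Suc m) * w x * s ^ m / fact (Suc m) = w x * (s ^ m / fact m)"
        by (simp add: fact_Suc del: of_nat_Suc)
      then show ?thesis by (simp only: add_divide_distrib)
    qed
    also have "\<dots> \<le> (s + w x) ^ Suc m / fact (Suc m)"
      by (intro divide_right_mono power_Suc_add_ge s) simp
    finally show ?thesis using insert.hyps by (simp add: Suc s_def add.commute del: power_Suc)
  qed
qed

lemma esym_nonneg:
  assumes "\<And>i. i \<in> I \<Longrightarrow> 0 \<le> w i"
  shows "0 \<le> esym w I j"
  unfolding esym_def using assms by (intro sum_nonneg prod_nonneg) auto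

lemma card_subsets_of_size_le:
  assumes "finite I"
  shows "real (card {B. B \<subseteq> I \<and> card B = j}) \<le> real (card I) ^ j"
proof -
  have "real (card {B. B \<subseteq> I \<and> card B = j}) = esym (\<lambda>_. 1) I j" by (simp add: esym_def)
  also have "\<dots> \<le> real (card I) ^ j / fact j" using esym_le[OF assms, of "\<lambda>_. 1" j] by simp
  also have "\<dots> \<le> real (card I) ^ j" by (simp add: divide_le_eq mult_le_cancel_left1 fact_ge_1)
  finally show ?thesis .
qed

text \<open>The extreme case is a set of consecutive integers starting at 2, where the sum is below
  a logarithm and the product telescopes. The induction removes the maximum, which is at least the
  cardinality plus one. Applied to the primes dividing \<open>p - 1\<close>.\<close>

lemma harmonic_bounds:
  assumes "finite Q" "\<And>q. q \<in> Q \<Longrightarrow> 2 \<le> (q::nat)"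
  shows "(\<Sum>q\<in>Q. 1 / real q) \<le> ln (card Q + 1)" "1 / (card Q + 1) \<le> (\<Prod>q\<in>Q. 1 - 1 / real q)"
proof -
  have "(\<Sum>q\<in>Q. 1 / real q) \<le> ln (card Q + 1) \<and> 1 / (card Q + 1) \<le> (\<Prod>q\<in>Q. 1 - 1 / real q)"
    using assms
  proof (induction "card Q" arbitrary: Q)
    case 0
    then show ?case by simp
  next
    case (Suc n)
    define m where "m = Max Q"
    have m: "m \<in> Q" "\<And>q. q \<in> Q \<Longrightarrow> q \<le> m" using Suc by (auto simp: m_def intro!: Max_in)
    define Q' where "Q' = Q - {m}"
    have Q': "finite Q'" "card Q' = n" using Suc m by (auto simp: Q'_def)
    have IH: "(\<Sum>q\<in>Q'. 1 / real q) \<le> ln (n + 1)" "1 / (n + 1) \<le> (\<Prod>q\<in>Q'. 1 - 1 / real q)"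
      using Suc.hyps(1)[of Q'] Q' Suc.prems by (auto simp: Q'_def)
    have "Q \<subseteq> {2..m}" using m Suc.prems by auto
    then have "card Q \<le> card {2..m}" by (intro card_mono) auto
    then have mn: "m \<ge> n + 2" using Suc.hyps(2) m Suc.prems(2)[OF m(1)] by simp
    have "1 / real m \<le> 1 / (n + 2)" using mn by (simp add: frac_le)
    also have "\<dots> \<le> ln (n + 2) - ln (n + 1)"
    proof -
      have "ln ((n + 1) / (n + 2)) \<le> (n + 1) / (n + 2) - (1::real)" by (rule ln_le_minus_one) simp
      then show ?thesis by (simp add: ln_div field_simps)
    qed
    finally have m1: "1 / real m \<le> ln (n + 2) - ln (n + 1)" .
    have "(\<Sum>q\<in>Q. 1 / real q) = 1 / real m + (\<Sum>q\<in>Q'. 1 / real q)"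
      unfolding Q'_def using Suc.prems(1) m(1) by (rule sum.remove)
    then have 1: "(\<Sum>q\<in>Q. 1 / real q) \<le> ln (n + 2)" using m1 IH by simp
    have "(n + 1) / (n + 2) \<le> 1 - 1 / real m" using mn by (simp add: field_simps)
    then have "((n + 1) / (n + 2)) * (1 / (n + 1)) \<le> (1 - 1 / real m) * (\<Prod>q\<in>Q'. 1 - 1 / real q)"
      using IH mn by (intro mult_mono) auto
    also have "\<dots> = (\<Prod>q\<in>Q. 1 - 1 / real q)"
      unfolding Q'_def using Suc.prems(1) m(1) by (rule prod.remove[symmetric])
    finally have 2: "1 / (real n + 2) \<le> (\<Prod>q\<in>Q. 1 - 1 / real q)" by (simp add: add.commute)
    show ?case using 1 2 Suc.hyps(2)[symmetric] by (simp add: add_ac)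
  qed
  then show "(\<Sum>q\<in>Q. 1 / real q) \<le> ln (card Q + 1)" "1 / (card Q + 1) \<le> (\<Prod>q\<in>Q. 1 - 1 / real q)" by auto
qed

lemma prod_one_minus_ge:
  assumes "finite I" "\<And>i. i \<in> I \<Longrightarrow> 0 \<le> w i \<and> w i \<le> (1::real)"
  shows "1 - (\<Sum>i\<in>I. w i) \<le> (\<Prod>i\<in>I. 1 - w i)"
  using assms
proof (induction I rule: finite_induct)
  case (insert x I)
  have "(\<Prod>i\<in>I. 1 - w i) \<le> 1" "0 \<le> (\<Prod>i\<in>I. 1 - w i)"
    using insert.prems by (auto intro!: prod_le_1 prod_nonneg)
  then have "w x * (\<Prod>i\<in>I. 1 - w i) \<le> w x" using insert.prems by (simp add: mult_left_le)
  then show ?case using insert by (simp add: algebra_simps)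
qed simp

lemma power_diff_le:
  assumes "0 \<le> (x::real)" "x \<le> y" "y \<le> 1"
  shows "y ^ n - x ^ n \<le> n * (y - x)"
proof (induction n)
  case (Suc n)
  have "y ^ Suc n - x ^ Suc n = y * (y ^ n - x ^ n) + (y - x) * x ^ n" by (simp add: algebra_simps)
  also have "\<dots> \<le> 1 * (n * (y - x)) + (y - x) * 1"
    using assms Suc by (intro add_mono mult_mono mult_left_mono) (auto simp: power_le_one power_mono)
  finally show ?case by (simp add: algebra_simps)
qed simp

subsection \<open>Counting simultaneous primitive roots\<close>

lemma residue_primroot_not_dvd: "prime p \<Longrightarrow> residue_primroot p x \<Longrightarrow> \<not> p dvd x"
  by (metis coprime_absorb_left not_prime_unit residue_primroot_def)

text \<open>A power \<open>\<gamma> ^ i\<close> has order \<open>(p - 1) / gcd i (p - 1)\<close>,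
  and the gcd is 1 exactly if no prime divisor of \<open>p - 1\<close> divides
  \<open>i\<close>.\<close>

lemma primroot_iff_dlog:
  assumes p: "prime p" and \<gamma>: "residue_primroot p \<gamma>" and x: "\<not> p dvd x"
  shows "residue_primroot p x \<longleftrightarrow> (\<forall>q\<in>prime_factors (p - 1). \<not> q dvd dlog p \<gamma> x)"
proof -
  define i where "i = dlog p \<gamma> x"
  have p1: "p > 1" using p prime_gt_1_nat by blast
  have cop: "coprime p \<gamma>" and ord: "ord p \<gamma> = p - 1"
    using \<gamma> p by (auto simp: residue_primroot_def totient_prime)
  have "residue_primroot p x \<longleftrightarrow> residue_primroot p (\<gamma> ^ i)"
    using dlog_cong[OF p \<gamma> x] residue_primroot_cong unfolding i_def by blast
  also have "\<dots> \<longleftrightarrow> ord p (\<gamma> ^ i) = p - 1"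
    using p1 cop p by (auto simp: residue_primroot_def totient_prime)
  also have "ord p (\<gamma> ^ i) = (p - 1) div gcd i (p - 1)"
    using ord_power[OF cop] ord by simp
  also have "\<dots> = p - 1 \<longleftrightarrow> gcd i (p - 1) = 1"
    using p1 by (auto simp: div_eq_dividend_iff)
  also have "\<dots> \<longleftrightarrow> (\<forall>q\<in>prime_factors (p - 1). \<not> q dvd i)"
  proof
    assume "gcd i (p - 1) = 1"
    then show "\<forall>q\<in>prime_factors (p - 1). \<not> q dvd i"
      by (metis gcd_greatest in_prime_factors_iff not_prime_unit)
  next
    assume a: "\<forall>q\<in>prime_factors (p - 1). \<not> q dvd i"
    show "gcd i (p - 1) = 1"
    proof (rule ccontr)
      assume "gcd i (p - 1) \<noteq> 1"
      then obtain q where "prime q" "q dvd gcd i (p - 1)" using prime_factor_nat by blast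
      then show False using a p1 by (auto simp: in_prime_factors_iff)
    qed
  qed
  finally show ?thesis by (simp add: i_def)
qed

definition joint_primroots :: "nat \<Rightarrow> nat set \<Rightarrow> nat set" where
  "joint_primroots p A = {x\<in>{..<p}. \<forall>a\<in>A. residue_primroot p (x + a)}"

lemma joint_primroots_eq:
  assumes "prime p" "residue_primroot p \<gamma>"
  shows "joint_primroots p A =
    {x\<in>nonzero_shifts p A. \<forall>a\<in>A. \<forall>q\<in>prime_factors (p - 1). \<not> q dvd dlog p \<gamma> (x + a)}"
  using primroot_iff_dlog[OF assms] residue_primroot_not_dvd[OF assms(1)]
  by (auto simp: joint_primroots_def nonzero_shifts_def)

text \<open>The index modulo \<open>p - 1\<close> is injective, and there are only
  \<open>(p - 1) / q\<close> multiples of \<open>q\<close> to hit. Being uniform in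
  \<open>q\<close>, the bound handles the primes above the sieving limit.\<close>

lemma card_dlog_multiples:
  assumes p: "prime p" and \<gamma>: "residue_primroot p \<gamma>" and q: "q dvd p - 1"
  shows "real (card {x\<in>{..<p}. \<not> p dvd (x + a) \<and> q dvd dlog p \<gamma> (x + a)}) \<le> p / q"
proof -
  let ?S = "{x\<in>{..<p}. \<not> p dvd (x + a) \<and> q dvd dlog p \<gamma> (x + a)}"
  have p1: "p > 1" using p prime_gt_1_nat by blast
  have q0: "q > 0" using q p1 by (intro Nat.gr0I) auto
  have cop: "coprime p \<gamma>" and ord: "ord p \<gamma> = p - 1"
    using \<gamma> p by (auto simp: residue_primroot_def totient_prime)
  have inj: "inj_on (\<lambda>x. dlog p \<gamma> (x + a) mod (p - 1)) ?S"
  proof (rule inj_onI)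
    fix x y assume x: "x \<in> ?S" and y: "y \<in> ?S"
      and eq: "dlog p \<gamma> (x + a) mod (p - 1) = dlog p \<gamma> (y + a) mod (p - 1)"
    have "[\<gamma> ^ dlog p \<gamma> (x + a) = \<gamma> ^ dlog p \<gamma> (y + a)] (mod p)"
      using order_divides_expdiff[OF cop] ord eq by (simp add: cong_def)
    moreover have "[\<gamma> ^ dlog p \<gamma> (x + a) = x + a] (mod p)" "[\<gamma> ^ dlog p \<gamma> (y + a) = y + a] (mod p)"
      using x y by (auto intro!: dlog_cong p \<gamma>)
    ultimately have "[x + a = y + a] (mod p)" by (meson cong_sym cong_trans)
    then have "[x = y] (mod p)" by (simp add: cong_add_rcancel_nat)
    then show "x = y" using x y by (simp add: cong_def)
  qed
  have "(\<lambda>x. dlog p \<gamma> (x + a) mod (p - 1)) ` ?S \<subseteq> (\<lambda>i. q * i) ` {..<(p - 1) div q}"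
  proof (rule image_subsetI)
    fix x assume x: "x \<in> ?S"
    have "q dvd dlog p \<gamma> (x + a) mod (p - 1)" using x q by (simp add: dvd_mod)
    then obtain i where i: "dlog p \<gamma> (x + a) mod (p - 1) = q * i" by (rule dvdE)
    have "q * i < p - 1" using i p1 by (metis mod_less_divisor zero_less_diff)
    then have "i < (p - 1) div q" using q q0 by (metis dvd_mult_div_cancel nat_mult_less_cancel1)
    then show "dlog p \<gamma> (x + a) mod (p - 1) \<in> (\<lambda>i. q * i) ` {..<(p - 1) div q}" using i by auto
  qed
  then have "card ((\<lambda>x. dlog p \<gamma> (x + a) mod (p - 1)) ` ?S) \<le> card ((\<lambda>i. q * i) ` {..<(p - 1) div q})"
    by (intro card_mono) auto
  also have "\<dots> \<le> (p - 1) div q" using card_image_le[of "{..<(p - 1) div q}"] by simp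
  finally have "card ?S \<le> (p - 1) div q" using inj by (simp add: card_image)
  then have "real (card ?S) \<le> real ((p - 1) div q)" by (simp only: of_nat_le_iff)
  also have "\<dots> \<le> real (p - 1) / q"
  proof -
    have "real ((p - 1) div q * q) \<le> real (p - 1)" unfolding of_nat_le_iff by simp
    then show ?thesis using q0 by (simp add: pos_le_divide_eq)
  qed
  also have "\<dots> \<le> p / q" by (intro divide_right_mono) auto
  finally show ?thesis .
qed

lemma prod_primes_dvd_iff:
  assumes "finite R" "\<And>q. q \<in> R \<Longrightarrow> prime (q::nat)"
  shows "\<Prod>R dvd m \<longleftrightarrow> (\<forall>q\<in>R. q dvd m)"
  using assms
proof (induction R rule: finite_induct)
  case (insert q R)
  have "coprime q (\<Prod>R)"
    using insert by (intro prod_coprime_right) (auto intro!: primes_coprime)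
  then have "q * \<Prod>R dvd m \<longleftrightarrow> q dvd m \<and> \<Prod>R dvd m"
    by (metis divides_mult dvd_mult_left dvd_mult_right)
  then show ?case using insert by simp
qed simp

text \<open>The primes paired with one shift \<open>a\<close> are merged into the single modulus
  \<open>D a\<close>, their product. Depth and sieving limit then enter the character sums only
  through the product of all moduli, which is at most \<open>w ^ k\<close>.\<close>

lemma power_residue_set_count:
  fixes n w k :: nat
  assumes p: "prime p" and \<gamma>: "residue_primroot p \<gamma>" and A: "A \<subseteq> {..<p}"
    and B: "B \<subseteq> A \<times> Q" "card B \<le> k" and Q: "Q \<subseteq> prime_factors (p - 1)" "\<And>q. q \<in> Q \<Longrightarrow> q \<le> w"
    and w: "w \<ge> 1" and n: "n ^ 4 \<le> p" "2 * (card A * w ^ (2 * k) + 1) \<le> n"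
  shows "\<bar>real (card {x\<in>nonzero_shifts p A. \<forall>(a, q)\<in>B. q dvd dlog p \<gamma> (x + a)}) - p * (\<Prod>(a, q)\<in>B. 1 / real q)\<bar>
    \<le> real (10 * p * (card A * w ^ (2 * k) + 1)) / real n"
proof -
  have p1: "p > 1" using p prime_gt_1_nat by blast
  have finA: "finite A" using A finite_subset by blast
  have finQ: "finite Q" using Q(1) finite_subset by blast
  have finB: "finite B" using B(1) finA finQ finite_subset by blast
  have prQ: "prime q" "q dvd p - 1" if "q \<in> Q" for q
    using that Q(1) by (auto simp: in_prime_factors_iff)
  define R where "R = (\<lambda>a. {q. (a, q) \<in> B})"
  have R: "R a \<subseteq> Q" for a using B(1) by (auto simp: R_def)
  have finR: "finite (R a)" for a using R finQ finite_subset by blast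
  define D where "D = (\<lambda>a. \<Prod>(R a))"
  have Ddvd: "D a dvd m \<longleftrightarrow> (\<forall>q\<in>R a. q dvd m)" for a m
    unfolding D_def using finR R prQ(1) by (intro prod_primes_dvd_iff) blast+
  have BS: "B = Sigma A R" using B(1) by (auto simp: R_def)
  have prodD: "(\<Prod>a\<in>A. D a) = (\<Prod>(a, q)\<in>B. q)"
    unfolding D_def BS by (rule prod.Sigma) (use finA finR in auto)
  have "(\<Prod>(a, q)\<in>B. q) \<le> (\<Prod>b\<in>B. w)"
    using B(1) Q(2) by (intro prod_mono) auto
  also have "\<dots> \<le> w ^ k" using B(2) w by (simp add: power_increasing)
  finally have Dw: "(\<Prod>a\<in>A. D a) \<le> w ^ k" using prodD by simp
  have sq: "card A * (\<Prod>a\<in>A. D a) ^ 2 + 1 \<le> card A * w ^ (2 * k) + 1"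
    using power_mono[OF Dw, of 2] by (simp add: power_mult mult.commute[of 2] flip: power_mult)
  have set_eq: "{x\<in>nonzero_shifts p A. \<forall>(a, q)\<in>B. q dvd dlog p \<gamma> (x + a)} =
     {x\<in>nonzero_shifts p A. \<forall>a\<in>A. D a dvd dlog p \<gamma> (x + a)}"
    unfolding Ddvd using B(1) by (auto simp: R_def)
  have "real p / real (\<Prod>a\<in>A. D a) = p * (\<Prod>(a, q)\<in>B. 1 / real q)"
    unfolding prodD by (simp add: prod_dividef case_prod_unfold)
  moreover have "\<bar>real (card {x\<in>nonzero_shifts p A. \<forall>a\<in>A. D a dvd dlog p \<gamma> (x + a)}) - real p / real (\<Prod>a\<in>A. D a)\<bar>
    \<le> real (10 * p * (card A * (\<Prod>a\<in>A. D a) ^ 2 + 1)) / real n"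
  proof (rule power_residue_pattern_count[OF p \<gamma> A _ n(1)])
    show "D a dvd p - 1" for a unfolding Ddvd using R prQ by blast
    show "2 * (card A * (\<Prod>a\<in>A. D a) ^ 2 + 1) \<le> n"
      using mult_le_mono2[OF sq, of 2] n(2) by (rule order_trans)
  qed
  moreover have "real (10 * p * (card A * (\<Prod>a\<in>A. D a) ^ 2 + 1)) / real n
      \<le> real (10 * p * (card A * w ^ (2 * k) + 1)) / real n"
  proof (rule divide_right_mono)
    show "real (10 * p * (card A * (\<Prod>a\<in>A. D a) ^ 2 + 1)) \<le> real (10 * p * (card A * w ^ (2 * k) + 1))"
      unfolding of_nat_le_iff using sq by (rule mult_le_mono2)
  qed simp
  ultimately show ?thesis unfolding set_eq by linarith
qed

text \<open>The Euler product of \<open>totient (p - 1) / (p - 1)\<close>.\<close>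

definition primroot_density :: "nat \<Rightarrow> real" where
  "primroot_density p = (\<Prod>q\<in>prime_factors (p - 1). 1 - 1 / real q)"

lemma primroot_density_bounds: "0 \<le> primroot_density p" "primroot_density p \<le> 1"
proof -
  have "0 \<le> 1 - 1 / real q \<and> 1 - 1 / real q \<le> 1" if "q \<in> prime_factors (p - 1)" for q
    using prime_ge_1_nat[of q] that by (auto simp: in_prime_factors_iff divide_le_eq)
  then show "0 \<le> primroot_density p" "primroot_density p \<le> 1"
    unfolding primroot_density_def by (auto intro!: prod_nonneg prod_le_1)
qed

text \<open>
  Here \<open>w\<close> is the sieving limit, \<open>k\<close> the depth of the truncated inclusion-exclusion, and \<open>n\<close> the saving
  in the character sums.
\<close>
lemma joint_primroots_sieve:
  fixes n w k l :: nat
  assumes p: "prime p" and A: "A \<subseteq> {..<p}"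
    and l: "card (prime_factors (p - 1)) \<le> l" and w: "w \<ge> 1" and n: "n > 0" "n ^ 4 \<le> p"
  shows "\<bar>real (card (joint_primroots p A)) - p * primroot_density p ^ card A\<bar>
    \<le> p * (2 * (card A * l / w) + 2 * ((card A * ln (l + 1)) ^ k / fact k)
        + real ((k + 1) * (card A * l + 1) ^ k * (10 * (card A * w ^ (2 * k) + 1))) / n)"
proof -
  define K where "K = card A"
  define \<theta> where "\<theta> = primroot_density p"
  define Q0 where "Q0 = prime_factors (p - 1)"
  define E where "E = real (10 * (K * w ^ (2 * k) + 1)) / n"
  define U where "U = joint_primroots p A"
  define T3 where "T3 = real ((k + 1) * (K * l + 1) ^ k * (10 * (K * w ^ (2 * k) + 1))) / n"
  have T3E: "T3 = real ((k + 1) * (K * l + 1) ^ k) * E" by (simp add: T3_def E_def)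
  have p1: "p > 1" using p prime_gt_1_nat by blast
  have finA: "finite A" using A finite_subset by blast
  have E0: "E \<ge> 0" by (simp add: E_def)
  have \<theta>: "0 \<le> \<theta>" "\<theta> \<le> 1" unfolding \<theta>_def by (rule primroot_density_bounds)+
  have ln0: "0 \<le> ln (real l + 1)" by simp
  have t12: "0 \<le> 2 * (K * l / w)" "0 \<le> 2 * ((K * ln (l + 1)) ^ k / fact k)" by auto
  have "card U \<le> card {..<p}" unfolding U_def joint_primroots_def by (intro card_mono) auto
  then have Up: "real (card U) \<le> p" by simp
  have \<theta>K: "0 \<le> \<theta> ^ K" "\<theta> ^ K \<le> 1" using \<theta> by (auto intro: power_le_one)
  show ?thesis
  proof (cases "2 * (K * w ^ (2 * k) + 1) \<le> n")
    \<comment> \<open>The moduli are too large for the character sum bound, but then the last error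
      term is at least 1 and the claim is trivial.\<close>
    case False
    have "n \<le> (k + 1) * (K * l + 1) ^ k * (10 * (K * w ^ (2 * k) + 1))"
    proof -
      have "1 * (10 * (K * w ^ (2 * k) + 1)) \<le> (k + 1) * (K * l + 1) ^ k * (10 * (K * w ^ (2 * k) + 1))"
        by (intro mult_le_mono1) (simp add: Suc_le_eq)
      then show ?thesis using False by linarith
    qed
    then have "real n \<le> real ((k + 1) * (K * l + 1) ^ k * (10 * (K * w ^ (2 * k) + 1)))"
      by (simp only: of_nat_le_iff)
    then have T31: "1 \<le> T3" unfolding T3_def using n(1) by (subst le_divide_eq_1_pos) auto
    have "real p * 1 \<le> real p * (2 * (K * l / w) + 2 * ((K * ln (l + 1)) ^ k / fact k) + T3)"
    proof (rule mult_left_mono)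
      show "1 \<le> 2 * (K * l / w) + 2 * ((K * ln (l + 1)) ^ k / fact k) + T3"
        using t12 T31 by linarith
    qed simp
    moreover have "\<bar>real (card U) - p * \<theta> ^ K\<bar> \<le> p"
    proof -
      have "0 \<le> p * \<theta> ^ K" "p * \<theta> ^ K \<le> p" using \<theta>K by (auto simp: mult_left_le)
      then show ?thesis using Up by linarith
    qed
    ultimately show ?thesis unfolding U_def K_def \<theta>_def T3_def by linarith
  next
    case True
    obtain \<gamma> where \<gamma>: "residue_primroot p \<gamma>" using prime_primitive_root_exists[of p] p p1 by blast
    define X where "X = nonzero_shifts p A"
    have finX: "finite X" by (simp add: X_def nonzero_shifts_def)
    define Q where "Q = {q\<in>Q0. q \<le> w}"
    have finQ0: "finite Q0" by (simp add: Q0_def)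
    have finQ: "finite Q" using finQ0 by (simp add: Q_def)
    have Q2: "q \<ge> 2" if "q \<in> Q0" for q
      using that prime_ge_2_nat by (auto simp: Q0_def in_prime_factors_iff)
    have cQ: "card Q \<le> l"
      using card_mono[OF finQ0, of Q] l by (auto simp: Q_def Q0_def)
    define \<Omega> where "\<Omega> = A \<times> Q"
    have fin\<Omega>: "finite \<Omega>" using finA finQ by (simp add: \<Omega>_def)
    have c\<Omega>: "card \<Omega> \<le> K * l" using cQ by (simp add: \<Omega>_def K_def card_cartesian_product)
    \<comment> \<open>The weights \<open>v\<close> are the probabilities of the independent model,
      \<open>u x\<close> the indicators at \<open>x\<close>. Inclusion-exclusion is truncated for
      both, and only the partial sums are compared.\<close>
    define v where "v = (\<lambda>(a::nat, q). 1 / real q)"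
    have v01: "0 \<le> v i \<and> v i \<le> 1" if "i \<in> \<Omega>" for i
      using that Q2 by (auto simp: v_def \<Omega>_def Q_def divide_le_eq split: prod.splits)
    define u where "u = (\<lambda>x (a, q). if q dvd dlog p \<gamma> (x + a) then 1 else (0::real))"
    have u01: "0 \<le> u x i \<and> u x i \<le> 1" for x i by (auto simp: u_def split: prod.splits)
    define N where "N = (\<lambda>B. card {x\<in>X. \<forall>(a, q)\<in>B. q dvd dlog p \<gamma> (x + a)})"
    have N_sum: "real (N B) = (\<Sum>x\<in>X. \<Prod>i\<in>B. u x i)" if "finite B" for B
    proof -
      have "(\<Prod>i\<in>B. u x i) = (if \<forall>(a, q)\<in>B. q dvd dlog p \<gamma> (x + a) then 1 else 0)" for x
        using that by (induction B rule: finite_induct) (auto simp: u_def split: prod.splits)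
      then show ?thesis using finX by (simp add: N_def sum.If_cases Int_def)
    qed
    define S where "S = (\<lambda>j. \<Sum>B | B \<subseteq> \<Omega> \<and> card B = j. real (N B))"
    have S_sum: "S j = (\<Sum>x\<in>X. esym (u x) \<Omega> j)" for j
    proof -
      have "S j = (\<Sum>B | B \<subseteq> \<Omega> \<and> card B = j. \<Sum>x\<in>X. \<Prod>i\<in>B. u x i)"
        unfolding S_def using fin\<Omega> finite_subset by (intro sum.cong refl N_sum) auto
      then show ?thesis unfolding esym_def by (subst (asm) sum.swap)
    qed
    define U' where "U' = {x\<in>X. \<forall>(a, q)\<in>\<Omega>. \<not> q dvd dlog p \<gamma> (x + a)}"
    have U'_sum: "real (card U') = (\<Sum>x\<in>X. \<Prod>i\<in>\<Omega>. 1 - u x i)"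
    proof -
      have "(\<Prod>i\<in>I. 1 - u x i) = (if \<forall>(a, q)\<in>I. \<not> q dvd dlog p \<gamma> (x + a) then 1 else 0)" if "finite I" for x I
        using that by (induction I rule: finite_induct) (auto simp: u_def split: prod.splits)
      then show ?thesis using finX fin\<Omega> by (simp add: U'_def sum.If_cases Int_def)
    qed
    have NB: "\<bar>real (N B) - p * (\<Prod>i\<in>B. v i)\<bar> \<le> p * E" if "B \<subseteq> \<Omega>" "card B \<le> k" for B
    proof -
      have "\<bar>real (N B) - p * (\<Prod>(a, q)\<in>B. 1 / real q)\<bar> \<le> real (10 * p * (card A * w ^ (2 * k) + 1)) / real n"
        unfolding N_def X_def
        by (rule power_residue_set_count[OF p \<gamma> A that(1)[unfolded \<Omega>_def] that(2)])
          (use True w n in \<open>auto simp: Q_def Q0_def K_def\<close>)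
      moreover have "real (10 * p * (card A * w ^ (2 * k) + 1)) / real n = p * E"
        by (simp add: E_def K_def algebra_simps)
      ultimately show ?thesis unfolding v_def by simp
    qed
    have Sj: "\<bar>S j - p * esym v \<Omega> j\<bar> \<le> p * (real ((K * l + 1) ^ k) * E)" if "j \<le> k" for j
    proof -
      have "S j - p * esym v \<Omega> j = (\<Sum>B | B \<subseteq> \<Omega> \<and> card B = j. real (N B) - p * (\<Prod>i\<in>B. v i))"
        by (simp add: S_def esym_def sum_distrib_left sum_subtractf)
      then have "\<bar>S j - p * esym v \<Omega> j\<bar> \<le> (\<Sum>B | B \<subseteq> \<Omega> \<and> card B = j. \<bar>real (N B) - p * (\<Prod>i\<in>B. v i)\<bar>)"
        by (simp only: sum_abs)
      also have "\<dots> \<le> (\<Sum>B | B \<subseteq> \<Omega> \<and> card B = j. p * E)"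
        using NB that by (intro sum_mono) auto
      also have "\<dots> = real (card {B. B \<subseteq> \<Omega> \<and> card B = j}) * (p * E)" by simp
      also have "\<dots> \<le> real ((K * l + 1) ^ k) * (p * E)"
      proof (rule mult_right_mono)
        have "real (card {B. B \<subseteq> \<Omega> \<and> card B = j}) \<le> real (card \<Omega>) ^ j"
          by (rule card_subsets_of_size_le[OF fin\<Omega>])
        also have "\<dots> \<le> real (K * l + 1) ^ j"
        proof (rule power_mono)
          have "card \<Omega> \<le> K * l + 1" using c\<Omega> by simp
          then show "real (card \<Omega>) \<le> real (K * l + 1)" by (simp only: of_nat_le_iff)
        qed simp
        also have "\<dots> \<le> real (K * l + 1) ^ k" using that by (intro power_increasing) auto
        finally show "real (card {B. B \<subseteq> \<Omega> \<and> card B = j}) \<le> real ((K * l + 1) ^ k)" by simp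
        show "0 \<le> p * E" using E0 by simp
      qed
      finally show ?thesis by (simp only: mult_ac)
    qed
    define F where "F = real ((K * l + 1) ^ k) * E"
    have F0: "F \<ge> 0" using E0 by (simp add: F_def)
    define V where "V = (\<Prod>i\<in>\<Omega>. 1 - v i)"
    define ek where "ek = esym v \<Omega> k"
    have 1: "\<bar>real (card U') - (\<Sum>j<k. (-1) ^ j * S j)\<bar> \<le> S k"
    proof -
      have "real (card U') - (\<Sum>j<k. (-1) ^ j * S j)
          = (\<Sum>x\<in>X. (\<Prod>i\<in>\<Omega>. 1 - u x i) - (\<Sum>j<k. (-1) ^ j * esym (u x) \<Omega> j))"
      proof -
        have "(\<Sum>j<k. (-1) ^ j * S j) = (\<Sum>x\<in>X. \<Sum>j<k. (-1) ^ j * esym (u x) \<Omega> j)"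
          unfolding S_sum sum_distrib_left by (rule sum.swap)
        then show ?thesis unfolding U'_sum by (simp only: sum_subtractf)
      qed
      then have "\<bar>real (card U') - (\<Sum>j<k. (-1) ^ j * S j)\<bar>
          \<le> (\<Sum>x\<in>X. \<bar>(\<Prod>i\<in>\<Omega>. 1 - u x i) - (\<Sum>j<k. (-1) ^ j * esym (u x) \<Omega> j)\<bar>)"
        by (simp only: sum_abs)
      also have "\<dots> \<le> (\<Sum>x\<in>X. esym (u x) \<Omega> k)"
        by (intro sum_mono bonferroni_abs fin\<Omega> u01)
      finally show ?thesis by (simp only: S_sum)
    qed
    have 2: "\<bar>(\<Sum>j<k. (-1) ^ j * S j) - p * (\<Sum>j<k. (-1) ^ j * esym v \<Omega> j)\<bar> \<le> k * (p * F)"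
    proof -
      have "(\<Sum>j<k. (-1) ^ j * S j) - p * (\<Sum>j<k. (-1) ^ j * esym v \<Omega> j)
          = (\<Sum>j<k. (-1) ^ j * (S j - p * esym v \<Omega> j))"
        by (simp add: sum_distrib_left sum_subtractf algebra_simps)
      then have "\<bar>(\<Sum>j<k. (-1) ^ j * S j) - p * (\<Sum>j<k. (-1) ^ j * esym v \<Omega> j)\<bar>
          \<le> (\<Sum>j<k. \<bar>(-1) ^ j * (S j - p * esym v \<Omega> j)\<bar>)" by (simp only: sum_abs)
      also have "\<dots> \<le> (\<Sum>j<k. p * F)"
        using Sj by (intro sum_mono) (simp add: abs_mult power_abs F_def)
      finally show ?thesis by simp
    qed
    have 3: "\<bar>p * V - p * (\<Sum>j<k. (-1) ^ j * esym v \<Omega> j)\<bar> \<le> p * ek"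
    proof -
      have "\<bar>V - (\<Sum>j<k. (-1) ^ j * esym v \<Omega> j)\<bar> \<le> ek"
        unfolding V_def ek_def by (rule bonferroni_abs[OF fin\<Omega> v01])
      then have "p * \<bar>V - (\<Sum>j<k. (-1) ^ j * esym v \<Omega> j)\<bar> \<le> p * ek" by (rule mult_left_mono) simp
      then show ?thesis by (simp add: abs_mult flip: right_diff_distrib)
    qed
    have 4: "S k \<le> p * ek + p * F" using Sj[of k] by (simp add: ek_def F_def)
    have ek: "ek \<le> (K * ln (l + 1)) ^ k / fact k"
    proof -
      have "ek \<le> (\<Sum>i\<in>\<Omega>. v i) ^ k / fact k" unfolding ek_def using v01 by (intro esym_le fin\<Omega>) auto
      also have "(\<Sum>i\<in>\<Omega>. v i) = K * (\<Sum>q\<in>Q. 1 / real q)"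
        by (simp add: \<Omega>_def v_def K_def flip: sum.cartesian_product)
      also have "(K * (\<Sum>q\<in>Q. 1 / real q)) ^ k / fact k \<le> (K * ln (l + 1)) ^ k / fact k"
      proof (intro divide_right_mono power_mono mult_left_mono)
        have "(\<Sum>q\<in>Q. 1 / real q) \<le> ln (card Q + 1)"
          using Q2 by (intro harmonic_bounds(1) finQ) (auto simp: Q_def)
        also have "\<dots> \<le> ln (l + 1)" using cQ by simp
        finally show "(\<Sum>q\<in>Q. 1 / real q) \<le> ln (l + 1)" by simp
      qed (auto intro!: sum_nonneg mult_nonneg_nonneg)
      finally show ?thesis .
    qed
    define \<theta>Q where "\<theta>Q = (\<Prod>q\<in>Q. 1 - 1 / real q)"
    have VQ: "V = \<theta>Q ^ K"
    proof -
      have "V = (\<Prod>a\<in>A. \<Prod>q\<in>Q. 1 - v (a, q))"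
        unfolding V_def \<Omega>_def by (subst prod.cartesian_product) simp
      then show ?thesis by (simp add: v_def \<theta>Q_def K_def)
    qed
    \<comment> \<open>The primes above \<open>w\<close> change the model by at most
      \<open>l / w\<close> per shift, and the count by at most \<open>p\<close> times as much
      through a union bound; hence the factor 2 in the first error term.\<close>
    have big: "1 / real q \<le> 1 / w" if "q \<in> Q0 - Q" for q
      using that w by (auto simp: Q_def intro!: divide_left_mono)
    have inv01: "0 \<le> 1 / real q \<and> 1 / real q \<le> 1" if "q \<in> Q0" for q
      using Q2[OF that] by (auto simp: divide_le_eq)
    have rest: "(\<Sum>q\<in>Q0 - Q. 1 / real q) \<le> l / w"
    proof -
      have "(\<Sum>q\<in>Q0 - Q. 1 / real q) \<le> (\<Sum>q\<in>Q0 - Q. 1 / real w)" using big by (intro sum_mono) auto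
      also have "\<dots> = card (Q0 - Q) * (1 / real w)" by simp
      also have "\<dots> \<le> l * (1 / real w)"
      proof (rule mult_right_mono)
        have "card (Q0 - Q) \<le> card Q0" using finQ0 by (intro card_mono) auto
        then show "real (card (Q0 - Q)) \<le> l" using l by (simp add: Q0_def)
      qed simp
      finally show ?thesis by simp
    qed
    have \<theta>Q: "0 \<le> \<theta>Q" "\<theta>Q \<le> 1"
      unfolding \<theta>Q_def using inv01 by (auto intro!: prod_nonneg prod_le_1 simp: Q_def)
    have \<theta>diff: "\<theta> \<le> \<theta>Q" "\<theta>Q - \<theta> \<le> l / w"
    proof -
      define \<rho> where "\<rho> = (\<Prod>q\<in>Q0 - Q. 1 - 1 / real q)"
      have eq: "\<theta> = \<rho> * \<theta>Q"
        unfolding \<theta>_def primroot_density_def \<rho>_def \<theta>Q_def Q0_def[symmetric]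
        using finQ0 by (intro prod.subset_diff) (auto simp: Q_def)
      have \<rho>: "\<rho> \<le> 1" "1 - l / w \<le> \<rho>"
      proof -
        show "\<rho> \<le> 1" unfolding \<rho>_def using inv01 by (intro prod_le_1) auto
        have "1 - (\<Sum>q\<in>Q0 - Q. 1 / real q) \<le> \<rho>"
          unfolding \<rho>_def using inv01 finQ0 by (intro prod_one_minus_ge) auto
        then show "1 - l / w \<le> \<rho>" using rest by linarith
      qed
      show "\<theta> \<le> \<theta>Q" using mult_right_mono[OF \<rho>(1) \<theta>Q(1)] unfolding eq by simp
      have "\<theta>Q - \<theta> = (1 - \<rho>) * \<theta>Q" by (simp add: eq algebra_simps)
      also have "\<dots> \<le> (1 - \<rho>) * 1" using \<rho> \<theta>Q by (intro mult_left_mono) auto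
      also have "\<dots> \<le> l / w" using \<rho>(2) by simp
      finally show "\<theta>Q - \<theta> \<le> l / w" .
    qed
    have 5: "\<bar>p * V - p * \<theta> ^ K\<bar> \<le> p * (K * l / w)"
    proof -
      have "\<theta>Q ^ K - \<theta> ^ K \<le> K * (\<theta>Q - \<theta>)" using \<theta> \<theta>diff \<theta>Q by (intro power_diff_le)
      also have "\<dots> \<le> K * (l / w)" using \<theta>diff by (intro mult_left_mono) auto
      finally have "V - \<theta> ^ K \<le> K * l / w" by (simp add: VQ)
      moreover have "0 \<le> V - \<theta> ^ K" using \<theta> \<theta>diff by (simp add: VQ power_mono)
      ultimately have "p * \<bar>V - \<theta> ^ K\<bar> \<le> p * (K * l / w)" by (intro mult_left_mono) auto
      then show ?thesis by (simp add: abs_mult flip: right_diff_distrib)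
    qed
    have U_eq: "U = {x\<in>X. \<forall>a\<in>A. \<forall>q\<in>Q0. \<not> q dvd dlog p \<gamma> (x + a)}"
      unfolding U_def X_def Q0_def by (rule joint_primroots_eq[OF p \<gamma>])
    have UU': "U \<subseteq> U'" unfolding U_eq U'_def \<Omega>_def Q_def by auto
    have 6: "real (card U') \<le> card U + p * (K * l / w)"
    proof -
      define C where "C = (\<lambda>a q. {x\<in>{..<p}. \<not> p dvd (x + a) \<and> q dvd dlog p \<gamma> (x + a)})"
      have "U' - U \<subseteq> (\<Union>a\<in>A. \<Union>q\<in>Q0 - Q. C a q)"
      proof (rule subsetI)
        fix x assume x: "x \<in> U' - U"
        then have xX: "x \<in> X" by (simp add: U'_def)
        then obtain a q where aq: "a \<in> A" "q \<in> Q0" "q dvd dlog p \<gamma> (x + a)"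
          using x by (auto simp: U_eq)
        moreover have "q \<notin> Q" using x aq by (auto simp: U'_def \<Omega>_def)
        moreover have "x \<in> C a q" using xX aq by (simp add: C_def X_def nonzero_shifts_def)
        ultimately show "x \<in> (\<Union>a\<in>A. \<Union>q\<in>Q0 - Q. C a q)" by blast
      qed
      then have "card (U' - U) \<le> card (\<Union>a\<in>A. \<Union>q\<in>Q0 - Q. C a q)"
        by (intro card_mono) (use finA finQ0 in \<open>auto simp: C_def\<close>)
      also have "\<dots> \<le> (\<Sum>a\<in>A. card (\<Union>q\<in>Q0 - Q. C a q))" by (rule card_UN_le[OF finA])
      also have "\<dots> \<le> (\<Sum>a\<in>A. \<Sum>q\<in>Q0 - Q. card (C a q))"
        using finQ0 by (intro sum_mono card_UN_le) auto
      finally have "real (card (U' - U)) \<le> (\<Sum>a\<in>A. \<Sum>q\<in>Q0 - Q. real (card (C a q)))"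
        by (simp only: of_nat_sum[symmetric] of_nat_le_iff)
      also have "\<dots> \<le> (\<Sum>a\<in>A. \<Sum>q\<in>Q0 - Q. p * (1 / real q))"
      proof (intro sum_mono)
        fix a q assume "q \<in> Q0 - Q"
        then have "q dvd p - 1" by (auto simp: Q0_def in_prime_factors_iff)
        then show "real (card (C a q)) \<le> p * (1 / real q)"
          using card_dlog_multiples[OF p \<gamma>] by (simp add: C_def)
      qed
      also have "\<dots> = K * (p * (\<Sum>q\<in>Q0 - Q. 1 / real q))" by (simp add: K_def sum_distrib_left)
      also have "\<dots> \<le> K * (p * (l / w))" using rest by (intro mult_left_mono) auto
      finally have "real (card (U' - U)) \<le> p * (K * l / w)" by (simp add: mult_ac)
      moreover have "card U' = card U + card (U' - U)"
      proof -
        have fin: "finite U'" using finX by (simp add: U'_def)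
        have "card (U' - U) = card U' - card U" using finite_subset[OF UU' fin] UU' by (rule card_Diff_subset)
        moreover have "card U \<le> card U'" using fin UU' by (rule card_mono)
        ultimately show ?thesis by simp
      qed
      ultimately show ?thesis by simp
    qed
    have UU'c: "real (card U) \<le> card U'" using UU' finX by (simp add: U'_def card_mono)
    \<comment> \<open>One \<open>ek\<close> comes from the truncation of the count and one from that
      of the model; \<open>F\<close> enters \<open>k\<close> times through the partial sums and once
      through \<open>S k\<close>.\<close>
    have "\<bar>real (card U') - p * V\<bar> \<le> 2 * (p * ek) + (p * F + k * (p * F))"
      using 1 2 3 4 by linarith
    then have "\<bar>real (card U) - p * \<theta> ^ K\<bar>
        \<le> 2 * (p * (K * l / w)) + 2 * (p * ek) + (p * F + k * (p * F))"
      using 5 6 UU'c by linarith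
    also have "\<dots> = p * (2 * (K * l / w) + 2 * ek + T3)"
      unfolding T3E F_def by (simp add: algebra_simps)
    also have "\<dots> \<le> p * (2 * (K * l / w) + 2 * ((K * ln (l + 1)) ^ k / fact k) + T3)"
      using ek by (intro mult_left_mono) auto
    finally show ?thesis unfolding U_def K_def \<theta>_def T3_def .
  qed
qed

section \<open>Choice of the sieve parameters and the resulting asymptotics\<close>

lemma poly_over_power_two: "(\<lambda>k. C * (real k + 2) ^ m / 2 ^ k) \<longlonglongrightarrow> 0"
proof -
  have "filterlim (\<lambda>k. ln 2 * (real k + 2)) at_top sequentially"
    by (intro filterlim_tendsto_pos_mult_at_top[OF tendsto_const] filterlim_at_top_add_at_top
        filterlim_tendsto_add_at_top[OF tendsto_const] filterlim_real_sequentially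
        filterlim_at_top_mono[OF filterlim_real_sequentially]) auto
  then have "(\<lambda>k. (ln 2 * (real k + 2)) ^ m / exp (ln 2 * (real k + 2))) \<longlonglongrightarrow> 0"
    by (rule filterlim_compose[OF tendsto_power_div_exp_0])
  then have "(\<lambda>k. 4 * C / ln 2 ^ m * ((ln 2 * (real k + 2)) ^ m / exp (ln 2 * (real k + 2)))) \<longlonglongrightarrow> 0"
    by (rule tendsto_mult_right_zero)
  moreover have "4 * C / ln 2 ^ m * ((ln 2 * (real k + 2)) ^ m / exp (ln 2 * (real k + 2))) = C * (real k + 2) ^ m / 2 ^ k" for k
  proof -
    have "exp (ln 2 * (real k + 2)) = exp (of_nat (k + 2) * ln (2::real))" by (simp add: mult.commute)
    also have "\<dots> = 2 ^ (k + 2)" by (subst exp_of_nat_mult) simp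
    finally have e: "exp (ln 2 * (real k + 2)) = (2::real) ^ (k + 2)" .
    show ?thesis unfolding e power_mult_distrib by (simp add: power_add)
  qed
  ultimately show ?thesis by simp
qed

text \<open>
  The error of the previous sieve for \<open>2^(4k\<^sup>2) \<le> p < 2^(4(k + 1)\<^sup>2)\<close> and \<open>n = 2^(k\<^sup>2)\<close>, relative to the main
  term; the density is at least \<open>1 / (l + 1)\<close>.
\<close>
definition sieve_error :: "nat \<Rightarrow> nat \<Rightarrow> real" where
  "sieve_error K k = (let l = 4 * (k + 1) ^ 2; w = (k + 2) ^ (2 * K + 3) in
     real (l + 1) ^ K * (2 * (real (K * l) / real w) + 2 * ((real K * ln (real (l + 1))) ^ k / fact k)
        + real ((k + 1) * (K * l + 1) ^ k * (10 * (K * w ^ (2 * k) + 1))) / (2 ^ k\<^sup>2)))"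

text \<open>A single term of the exponential series at \<open>2 * x\<close>. For \<open>x\<close> a
  multiple of a logarithm the exponential is only a power, so the factor \<open>2 ^ k\<close>
  wins.\<close>

lemma power_le_fact_exp:
  assumes "0 \<le> (x::real)"
  shows "x ^ k / fact k \<le> exp (2 * x) / 2 ^ k"
proof -
  have "(2 * x) ^ k / fact k \<le> exp (2 * x)"
  proof -
    have "(\<Sum>n\<in>{k}. (2 * x) ^ n /\<^sub>R fact n) \<le> (\<Sum>n. (2 * x) ^ n /\<^sub>R fact n)"
      by (rule sum_le_suminf[OF summable_exp_generic]) (use assms in auto)
    then show ?thesis by (simp add: exp_def divide_inverse mult.commute)
  qed
  then show ?thesis by (simp add: power_mult_distrib field_simps)
qed

text \<open>The exponent \<open>2 * K + 3\<close> of the sieving limit is fixed by the first term: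
  \<open>(l + 1) ^ K * l\<close> is of order \<open>b ^ (2 * K + 2)\<close>, which leaves
  \<open>1 / b\<close>. In the last term everything raised to a power of order \<open>k\<close> is
  collected into the \<open>k\<close>-th power of a polynomial in \<open>b\<close>, to be set
  against \<open>2 ^ k\<^sup>2 = (2 ^ k) ^ k\<close>.\<close>

lemma sieve_error_le:
  fixes K k :: nat and b :: real
  defines "b \<equiv> real k + 2"
  shows "sieve_error K k \<le> (8 * K * 4 ^ K) / b + 2 * 4 ^ (3 * K) * b ^ (6 * K) / 2 ^ k
     + (10 * (K + 1) * 4 ^ K) * b ^ (2 * K + 1) * (4 * (K + 1) * b ^ (4 * K + 8) / 2 ^ k) ^ k"
proof -
  define l where "l = 4 * (k + 1) ^ 2"
  define w where "w = (k + 2) ^ (2 * K + 3)"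
  have b: "b \<ge> 2" by (simp add: b_def)
  have lb: "real (l + 1) \<le> 4 * b ^ 2" by (simp add: l_def b_def power2_eq_square algebra_simps)
  have lb': "real l \<le> 4 * b ^ 2" using lb by simp
  have wb: "real w = b ^ (2 * K + 3)" by (simp add: w_def b_def add.commute)
  have w1: "w \<ge> 1" by (simp add: w_def)
  have pre: "real (l + 1) ^ K \<le> 4 ^ K * b ^ (2 * K)"
    using power_mono[OF lb, of K] by (simp add: power_mult_distrib power_mult)
  have pre0: "0 \<le> real (l + 1) ^ K" by simp
  have A1: "real (l + 1) ^ K * (2 * (K * l / w)) \<le> (8 * K * 4 ^ K) / b"
  proof -
    have "real (l + 1) ^ K * (2 * (K * l / w)) \<le> (4 ^ K * b ^ (2 * K)) * (2 * (K * (4 * b ^ 2) / w))"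
    proof -
      have "K * l / w \<le> K * (4 * b ^ 2) / w"
        unfolding of_nat_mult by (intro divide_right_mono mult_left_mono lb') auto
      then show ?thesis using pre b by (intro mult_mono mult_left_mono) auto
    qed
    also have "\<dots> = (8 * K * 4 ^ K) * (b ^ (2 * K + 2) / b ^ (2 * K + 3))"
      unfolding wb by (simp add: power_add power2_eq_square)
    also have "b ^ (2 * K + 2) / b ^ (2 * K + 3) = 1 / b"
      using b by (simp add: power_add power2_eq_square power3_eq_cube)
    finally show ?thesis by simp
  qed
  have A2: "real (l + 1) ^ K * (2 * ((K * ln (l + 1)) ^ k / fact k)) \<le> 2 * 4 ^ (3 * K) * b ^ (6 * K) / 2 ^ k"
  proof -
    have "(K * ln (l + 1)) ^ k / fact k \<le> exp (2 * (K * ln (l + 1))) / 2 ^ k"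
      by (rule power_le_fact_exp) simp
    also have "exp (2 * (K * ln (l + 1))) = real (l + 1) ^ (2 * K)"
      using exp_of_nat_mult[of "2 * K" "ln (real (l + 1))"] by (simp add: mult.assoc)
    also have "\<dots> \<le> (4 * b ^ 2) ^ (2 * K)" using lb by (intro power_mono) auto
    finally have "(K * ln (l + 1)) ^ k / fact k \<le> (4 * b ^ 2) ^ (2 * K) / 2 ^ k"
      by (simp add: divide_right_mono)
    then have "real (l + 1) ^ K * (2 * ((K * ln (l + 1)) ^ k / fact k))
        \<le> (4 ^ K * b ^ (2 * K)) * (2 * ((4 * b ^ 2) ^ (2 * K) / 2 ^ k))"
      using pre b by (intro mult_mono mult_left_mono) auto
    also have "\<dots> = 2 * (4 ^ K * 4 ^ (2 * K)) * (b ^ (2 * K) * b ^ (4 * K)) / 2 ^ k"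
      by (simp add: power_mult_distrib flip: power_mult)
    also have "(4::real) ^ K * 4 ^ (2 * K) = 4 ^ (3 * K)" by (simp flip: power_add)
    also have "b ^ (2 * K) * b ^ (4 * K) = b ^ (6 * K)" by (simp flip: power_add)
    finally show ?thesis .
  qed
  have A3: "real (l + 1) ^ K * (real ((k + 1) * (K * l + 1) ^ k * (10 * (K * w ^ (2 * k) + 1))) / (2 ^ k\<^sup>2))
      \<le> (10 * (K + 1) * 4 ^ K) * b ^ (2 * K + 1) * (4 * (K + 1) * b ^ (4 * K + 8) / 2 ^ k) ^ k"
  proof -
    have 1: "real (k + 1) \<le> b" by (simp add: b_def)
    have 2: "real (K * l + 1) \<le> (K + 1) * (4 * b ^ 2)"
    proof -
      have "real K * real l \<le> K * (4 * b ^ 2)" using lb by (intro mult_left_mono) auto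
      moreover have "1 \<le> b ^ 2" using b by (intro one_le_power) simp
      ultimately show ?thesis by (simp add: algebra_simps)
    qed
    have 3: "real (10 * (K * w ^ (2 * k) + 1)) \<le> 10 * (K + 1) * real w ^ (2 * k)"
      using one_le_power[of "real w" "2 * k"] w1 by (simp add: algebra_simps)
    have "real ((k + 1) * (K * l + 1) ^ k * (10 * (K * w ^ (2 * k) + 1)))
       = real (k + 1) * real (K * l + 1) ^ k * real (10 * (K * w ^ (2 * k) + 1))"
      by (simp only: of_nat_mult of_nat_power)
    also have "\<dots> \<le> b * ((K + 1) * (4 * b ^ 2)) ^ k * (10 * (K + 1) * real w ^ (2 * k))"
      using 1 2 3 b by (intro mult_mono power_mono) auto
    also have "\<dots> = 10 * (K + 1) * b * (((K + 1) * (4 * b ^ 2)) * (real w ^ 2)) ^ k"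
      by (simp add: power_mult_distrib power_mult)
    also have "((K + 1) * (4 * b ^ 2)) * (real w ^ 2) = 4 * (K + 1) * b ^ (4 * K + 8)"
    proof -
      have "b ^ 2 * (real w ^ 2) = b ^ (4 * K + 8)"
        unfolding wb by (simp add: add.commute flip: power_mult power_add)
      then show ?thesis by (simp add: mult.assoc)
    qed
    finally have "real ((k + 1) * (K * l + 1) ^ k * (10 * (K * w ^ (2 * k) + 1))) / (2 ^ k\<^sup>2)
       \<le> 10 * (K + 1) * b * (4 * (K + 1) * b ^ (4 * K + 8)) ^ k / (2 ^ k\<^sup>2)"
      by (rule divide_right_mono) simp
    also have "\<dots> = 10 * (K + 1) * b * (4 * (K + 1) * b ^ (4 * K + 8) / 2 ^ k) ^ k"
      by (simp add: power_divide power2_eq_square power_mult)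
    finally have "real (l + 1) ^ K * (real ((k + 1) * (K * l + 1) ^ k * (10 * (K * w ^ (2 * k) + 1))) / (2 ^ k\<^sup>2))
       \<le> (4 ^ K * b ^ (2 * K)) * (10 * (K + 1) * b * (4 * (K + 1) * b ^ (4 * K + 8) / 2 ^ k) ^ k)"
      using pre b by (intro mult_mono) auto
    also have "\<dots> = (10 * (K + 1) * 4 ^ K) * b ^ (2 * K + 1) * (4 * (K + 1) * b ^ (4 * K + 8) / 2 ^ k) ^ k"
      by (simp add: mult_ac)
    finally show ?thesis .
  qed
  show ?thesis
    unfolding sieve_error_def Let_def l_def[symmetric] w_def[symmetric]
    using add_mono[OF add_mono[OF A1 A2] A3] by (simp only: distrib_left[of "real (l + 1) ^ K"])
qed

lemma sieve_error_tendsto: "sieve_error K \<longlonglongrightarrow> 0"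
proof -
  have L1: "(\<lambda>k. (8 * K * 4 ^ K) / (real k + 2)) \<longlonglongrightarrow> 0"
    by (intro real_tendsto_divide_at_top[OF tendsto_const]
        filterlim_at_top_mono[OF filterlim_real_sequentially]) auto
  have L2: "(\<lambda>k. 2 * 4 ^ (3 * K) * (real k + 2) ^ (6 * K) / 2 ^ k) \<longlonglongrightarrow> 0"
    by (rule poly_over_power_two)
  have L3: "(\<lambda>k. (10 * (K + 1) * 4 ^ K) * (real k + 2) ^ (2 * K + 1) *
      (4 * (K + 1) * (real k + 2) ^ (4 * K + 8) / 2 ^ k) ^ k) \<longlonglongrightarrow> 0"
  proof (rule tendsto_sandwich[OF _ _ tendsto_const])
    show "\<forall>\<^sub>F k in sequentially. 0 \<le> (10 * (K + 1) * 4 ^ K) * (real k + 2) ^ (2 * K + 1) *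
      (4 * (K + 1) * (real k + 2) ^ (4 * K + 8) / 2 ^ k) ^ k"
      by (intro always_eventually allI mult_nonneg_nonneg zero_le_power divide_nonneg_nonneg) auto
    show "(\<lambda>k. (10 * (K + 1) * 4 ^ K) * (real k + 2) ^ (2 * K + 1) / 2 ^ k) \<longlonglongrightarrow> 0"
      by (rule poly_over_power_two)
    have "(\<lambda>k. 4 * (K + 1) * (real k + 2) ^ (4 * K + 8) / 2 ^ k) \<longlonglongrightarrow> 0"
      by (rule poly_over_power_two)
    \<comment> \<open>Once the base is below 1/2, its \<open>k\<close>-th power is dominated by
      \<open>1 / 2 ^ k\<close>, which beats the polynomial factor in front.\<close>
    then have "\<forall>\<^sub>F k in sequentially. 4 * (K + 1) * (real k + 2) ^ (4 * K + 8) / 2 ^ k < 1 / 2"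
      by (rule order_tendstoD) simp
    then show "\<forall>\<^sub>F k in sequentially. (10 * (K + 1) * 4 ^ K) * (real k + 2) ^ (2 * K + 1) *
      (4 * (K + 1) * (real k + 2) ^ (4 * K + 8) / 2 ^ k) ^ k
      \<le> (10 * (K + 1) * 4 ^ K) * (real k + 2) ^ (2 * K + 1) / 2 ^ k"
    proof eventually_elim
      case (elim k)
      define y where "y = 4 * (K + 1) * (real k + 2) ^ (4 * K + 8) / 2 ^ k"
      have y: "0 \<le> y" "y < 1 / 2" using elim by (auto simp: y_def)
      have "y ^ k \<le> (1 / 2) ^ k" using y by (intro power_mono) auto
      then have "(10 * (K + 1) * 4 ^ K) * (real k + 2) ^ (2 * K + 1) * y ^ k
         \<le> (10 * (K + 1) * 4 ^ K) * (real k + 2) ^ (2 * K + 1) * (1 / 2) ^ k"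
        by (intro mult_left_mono) auto
      then show ?case unfolding y_def[symmetric] by (simp add: power_one_over)
    qed
  qed
  have "(\<lambda>k. (8 * K * 4 ^ K) / (real k + 2) + 2 * 4 ^ (3 * K) * (real k + 2) ^ (6 * K) / 2 ^ k
     + (10 * (K + 1) * 4 ^ K) * (real k + 2) ^ (2 * K + 1) *
      (4 * (K + 1) * (real k + 2) ^ (4 * K + 8) / 2 ^ k) ^ k) \<longlonglongrightarrow> 0 + 0 + 0"
    by (intro tendsto_add L1 L2 L3)
  then have lim: "(\<lambda>k. (8 * K * 4 ^ K) / (real k + 2) + 2 * 4 ^ (3 * K) * (real k + 2) ^ (6 * K) / 2 ^ k
     + (10 * (K + 1) * 4 ^ K) * (real k + 2) ^ (2 * K + 1) *
      (4 * (K + 1) * (real k + 2) ^ (4 * K + 8) / 2 ^ k) ^ k) \<longlonglongrightarrow> 0" by simp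
  show ?thesis
  proof (rule tendsto_sandwich[OF _ _ tendsto_const lim])
    show "\<forall>\<^sub>F k in sequentially. 0 \<le> sieve_error K k"
      unfolding sieve_error_def Let_def
      by (intro always_eventually allI mult_nonneg_nonneg add_nonneg_nonneg divide_nonneg_nonneg
          zero_le_power ln_ge_zero) auto
    show "\<forall>\<^sub>F k in sequentially. sieve_error K k \<le> (8 * K * 4 ^ K) / (real k + 2) +
      2 * 4 ^ (3 * K) * (real k + 2) ^ (6 * K) / 2 ^ k
     + (10 * (K + 1) * 4 ^ K) * (real k + 2) ^ (2 * K + 1) *
      (4 * (K + 1) * (real k + 2) ^ (4 * K + 8) / 2 ^ k) ^ k"
      by (intro always_eventually allI sieve_error_le)
  qed
qed

lemma dyadic_scale:
  assumes "p \<ge> (1::nat)"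
  obtains k where "2 ^ (4 * k ^ 2) \<le> p" "p < 2 ^ (4 * (k + 1) ^ 2)"
proof -
  define P where "P = (\<lambda>k::nat. (2::nat) ^ (4 * k ^ 2) \<le> p)"
  have bound: "k \<le> p" if "P k" for k
  proof -
    have "k \<le> 4 * k ^ 2" by (cases k) (simp_all add: power2_eq_square)
    also have "\<dots> < 2 ^ (4 * k ^ 2)" by (rule less_exp)
    finally show ?thesis using that by (simp add: P_def)
  qed
  have "P 0" using assms by (simp add: P_def)
  then have "P (Greatest P)" and "\<not> P (Greatest P + 1)"
    using GreatestI_nat[of P 0 p] Greatest_le_nat[of P "Greatest P + 1" p] bound by auto
  then show ?thesis using that by (auto simp: P_def not_le)
qed

text \<open>The ranges of \<open>dyadic_scale\<close> cover all positive \<open>p\<close>, and a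
  large \<open>p\<close> forces a large \<open>k\<close>; so a limit in \<open>k\<close> becomes an
  eventual statement in \<open>p\<close>.\<close>

lemma eventually_dyadic:
  assumes "\<And>k p :: nat. k0 \<le> k \<Longrightarrow> 2 ^ (4 * k ^ 2) \<le> p \<Longrightarrow> p < 2 ^ (4 * (k + 1) ^ 2) \<Longrightarrow> P p"
  shows "\<forall>\<^sub>F p in sequentially. P p"
proof -
  have "P p" if pk: "(2::nat) ^ (4 * k0 ^ 2) \<le> p" for p
  proof -
    have "(1::nat) \<le> 2 ^ (4 * k0 ^ 2)" by (rule one_le_power) simp
    then have "1 \<le> p" using pk by (rule order_trans)
    then obtain k where k: "2 ^ (4 * k ^ 2) \<le> p" "p < 2 ^ (4 * (k + 1) ^ 2)" by (rule dyadic_scale)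
    have "k0 \<le> k"
    proof (rule ccontr)
      assume "\<not> k0 \<le> k"
      then have "(k + 1) ^ 2 \<le> k0 ^ 2" by (intro power_mono) auto
      then have "(2::nat) ^ (4 * (k + 1) ^ 2) \<le> 2 ^ (4 * k0 ^ 2)" by (intro power_increasing) auto
      then show False using pk k(2) by (metis leD order_trans)
    qed
    then show ?thesis using assms k by blast
  qed
  then show ?thesis unfolding eventually_sequentially by blast
qed

lemma card_prime_factors_less:
  fixes m l :: nat
  assumes "0 < m" "m < 2 ^ l"
  shows "card (prime_factors m) \<le> l"
proof -
  have "\<Prod>(prime_factors m) dvd m"
    by (subst prod_primes_dvd_iff) (auto simp: in_prime_factors_iff)
  then have "\<Prod>(prime_factors m) \<le> m" using assms(1) by (intro dvd_imp_le) auto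
  moreover have "(\<Prod>q\<in>prime_factors m. 2) \<le> \<Prod>(prime_factors m)"
    by (intro prod_mono) (auto simp: in_prime_factors_iff prime_ge_2_nat)
  ultimately have "(2::nat) ^ card (prime_factors m) \<le> m" by simp
  then have "(2::nat) ^ card (prime_factors m) < 2 ^ l" using assms(2) by (rule le_less_trans)
  then show ?thesis by simp
qed

lemma primroot_density_ge:
  assumes "card (prime_factors (p - 1)) \<le> l"
  shows "1 / real (l + 1) \<le> primroot_density p"
proof -
  have "1 / real (l + 1) \<le> 1 / (card (prime_factors (p - 1)) + 1)"
    using assms by (intro divide_left_mono) auto
  also have "\<dots> \<le> primroot_density p"
    unfolding primroot_density_def
    by (rule harmonic_bounds(2)) (auto simp: in_prime_factors_iff prime_ge_2_nat)
  finally show ?thesis .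
qed

text \<open>The threshold depends on \<open>K\<close> and \<open>\<eta>\<close> but not on
  \<open>A\<close>. This uniformity is essential, as the shifts in a gap pattern may grow with
  \<open>p\<close>.\<close>

lemma joint_primroots_asymptotic:
  assumes "\<eta> > 0"
  shows "\<forall>\<^sub>F p in sequentially. prime p \<longrightarrow> (\<forall>A \<subseteq> {..<p}. card A = K \<longrightarrow>
    \<bar>real (card (joint_primroots p A)) - p * primroot_density p ^ K\<bar> \<le> \<eta> * (p * primroot_density p ^ K))"
proof -
  have "\<forall>\<^sub>F k in sequentially. sieve_error K k < \<eta>"
    using sieve_error_tendsto assms by (rule order_tendstoD)
  then obtain k0 where k0: "\<And>k. k \<ge> k0 \<Longrightarrow> sieve_error K k < \<eta>" by (auto simp: eventually_sequentially)
  show ?thesis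
  proof (rule eventually_dyadic[of k0], intro impI allI)
    fix k p :: nat and A
    assume "k \<ge> k0" and k: "2 ^ (4 * k ^ 2) \<le> p" "p < 2 ^ (4 * (k + 1) ^ 2)"
      and p: "prime p" and A: "A \<subseteq> {..<p}" "card A = K"
    have p1: "p > 1" using p by (rule prime_gt_1_nat)
    define l where "l = 4 * (k + 1) ^ 2"
    define w where "w = (k + 2) ^ (2 * K + 3)"
    define \<theta> where "\<theta> = primroot_density p"
    define T where "T = 2 * (K * l / w) + 2 * ((K * ln (l + 1)) ^ k / fact k)
        + real ((k + 1) * (K * l + 1) ^ k * (10 * (K * w ^ (2 * k) + 1))) / (2 ^ k\<^sup>2)"
    have cl: "card (prime_factors (p - 1)) \<le> l"
      using k(2) p1 by (intro card_prime_factors_less) (auto simp: l_def)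
    have "((2::nat) ^ k\<^sup>2) ^ 4 \<le> p" using k(1) by (simp add: mult.commute flip: power_mult)
    then have "\<bar>real (card (joint_primroots p A)) - p * \<theta> ^ card A\<bar> \<le> p * (2 * (card A * l / w) +
        2 * ((card A * ln (l + 1)) ^ k / fact k)
        + real ((k + 1) * (card A * l + 1) ^ k * (10 * (card A * w ^ (2 * k) + 1))) / real (2 ^ k\<^sup>2))"
      unfolding \<theta>_def using joint_primroots_sieve[OF p A(1) cl, of w "2 ^ k\<^sup>2" k] by (simp add: w_def)
    then have 1: "\<bar>real (card (joint_primroots p A)) - p * \<theta> ^ K\<bar> \<le> p * T" by (simp add: T_def A(2))
    have "1 \<le> real (l + 1) * \<theta>"
      using primroot_density_ge[OF cl] by (simp add: \<theta>_def field_simps)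
    then have "1 \<le> (real (l + 1) * \<theta>) ^ K" by (rule one_le_power)
    then have "1 \<le> real (l + 1) ^ K * \<theta> ^ K" by (simp only: power_mult_distrib)
    moreover have T0: "0 \<le> T" unfolding T_def
      by (intro add_nonneg_nonneg divide_nonneg_nonneg mult_nonneg_nonneg zero_le_power ln_ge_zero) auto
    ultimately have "T * 1 \<le> T * (real (l + 1) ^ K * \<theta> ^ K)" by (intro mult_left_mono)
    also have "\<dots> = sieve_error K k * \<theta> ^ K"
      by (simp only: sieve_error_def Let_def T_def l_def w_def mult_ac)
    also have "\<dots> \<le> \<eta> * \<theta> ^ K"
      using k0[OF \<open>k \<ge> k0\<close>] primroot_density_bounds[of p] by (intro mult_right_mono) (auto simp: \<theta>_def)
    finally have "p * T \<le> p * (\<eta> * \<theta> ^ K)" by (intro mult_left_mono) auto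
    then show "\<bar>real (card (joint_primroots p A)) - p * primroot_density p ^ K\<bar> \<le> \<eta> * (p * primroot_density p ^ K)"
      using 1 by (simp add: \<theta>_def mult_ac)
  qed
qed

text \<open>That is, \<open>p * \<theta> ^ 3\<close> tends to infinity. The exponent 3 is what the
  boundary terms demand: discarding the gaps that run past \<open>p\<close> costs about
  \<open>1 / \<theta> ^ 2\<close> in total, which must be negligible against
  \<open>p * \<theta>\<close>.\<close>

lemma primroot_density_cube:
  assumes "\<eta> > 0"
  shows "\<forall>\<^sub>F p in sequentially. prime p \<longrightarrow> 1 \<le> \<eta> * (p * primroot_density p ^ 3)"
proof -
  have "(\<lambda>k. 64 * (real k + 2) ^ 6 / 2 ^ k) \<longlonglongrightarrow> 0" by (rule poly_over_power_two)
  then have "\<forall>\<^sub>F k in sequentially. 64 * (real k + 2) ^ 6 / 2 ^ k < \<eta>" using assms by (rule order_tendstoD)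
  then obtain k0 where k0: "\<And>k. k \<ge> k0 \<Longrightarrow> 64 * (real k + 2) ^ 6 / 2 ^ k < \<eta>" by (auto simp: eventually_sequentially)
  show ?thesis
  proof (rule eventually_dyadic[of k0], intro impI)
    fix k p :: nat
    assume "k \<ge> k0" and k: "2 ^ (4 * k ^ 2) \<le> p" "p < 2 ^ (4 * (k + 1) ^ 2)" and p: "prime p"
    have p1: "p > 1" using p by (rule prime_gt_1_nat)
    define l where "l = 4 * (k + 1) ^ 2"
    define \<theta> where "\<theta> = primroot_density p"
    have cl: "card (prime_factors (p - 1)) \<le> l"
      using k(2) p1 by (intro card_prime_factors_less) (auto simp: l_def)
    have "1 \<le> real (l + 1) * \<theta>"
      using primroot_density_ge[OF cl] by (simp add: \<theta>_def field_simps)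
    then have "1 \<le> (real (l + 1) * \<theta>) ^ 3" by (rule one_le_power)
    also have "\<dots> = real (l + 1) ^ 3 * \<theta> ^ 3" by (rule power_mult_distrib)
    also have "real (l + 1) ^ 3 \<le> (4 * (real k + 2) ^ 2) ^ 3"
      by (intro power_mono) (simp_all add: l_def power2_eq_square algebra_simps)
    also have "\<dots> = 64 * (real k + 2) ^ 6" by (simp add: power_mult_distrib flip: power_mult)
    also have "\<dots> \<le> \<eta> * 2 ^ k" using k0[OF \<open>k \<ge> k0\<close>] by (simp add: field_simps)
    also have "(2::real) ^ k \<le> real p"
    proof -
      have "k \<le> 4 * k ^ 2" by (cases k) (simp_all add: power2_eq_square)
      then have "(2::nat) ^ k \<le> 2 ^ (4 * k ^ 2)" by (intro power_increasing) auto
      then have "2 ^ k \<le> p" using k(1) by linarith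
      then have "real (2 ^ k) \<le> real p" by (simp only: of_nat_le_iff)
      then show ?thesis by simp
    qed
    finally show "1 \<le> \<eta> * (p * primroot_density p ^ 3)"
      using assms primroot_density_bounds[of p] by (simp add: \<theta>_def mult_right_mono mult_left_mono mult_ac)
  qed
qed

subsection \<open>Gaps between primitive roots\<close>

text \<open>Being a primitive root depends only on the residue, so gaps are counted cyclically and
  may run past \<open>p\<close>. In this form the count is a combination of values of
  \<open>card (joint_primroots p A)\<close>.\<close>

definition primroot_gaps :: "nat \<Rightarrow> nat \<Rightarrow> nat set" where
  "primroot_gaps p h = {x\<in>{..<p}. residue_primroot p x \<and> residue_primroot p (x + h) \<and>
     (\<forall>j\<in>{1..<h}. \<not> residue_primroot p (x + j))}"

lemma sum_power_fact_le_exp: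
  assumes "0 \<le> (x::real)"
  shows "(\<Sum>i\<le>k. x ^ i / fact i) \<le> exp x"
proof -
  have "(\<Sum>i\<le>k. x ^ i /\<^sub>R fact i) \<le> (\<Sum>i. x ^ i /\<^sub>R fact i)"
    by (rule sum_le_suminf[OF summable_exp_generic]) (use assms in auto)
  then show ?thesis by (simp add: exp_def divide_inverse mult.commute)
qed

text \<open>The pattern \<open>{0, h}\<close> is always present and up to \<open>k\<close> interior
  points are added, hence sets of size at most \<open>k + 2\<close>. One truncation error
  \<open>C ^ k / fact k\<close> comes from the count and one from the model. The relative errors
  total at most \<open>\<eta> * exp C\<close>, because
  \<open>e i \<le> C ^ i / fact i\<close>.\<close>

lemma primroot_gaps_lower:
  fixes p h k :: nat and C \<eta> \<theta> :: real
  defines "\<theta> \<equiv> primroot_density p"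
  assumes h: "1 \<le> h" "h < p" and C: "\<theta> * h \<le> C" and \<eta>: "0 \<le> \<eta>"
    and asym: "\<And>A. A \<subseteq> {..<p} \<Longrightarrow> card A \<le> k + 2 \<Longrightarrow>
      \<bar>real (card (joint_primroots p A)) - p * \<theta> ^ card A\<bar> \<le> \<eta> * (p * \<theta> ^ card A)"
  shows "p * \<theta> ^ 2 * ((1 - \<theta>) ^ (h - 1) - (2 * C ^ k / fact k + \<eta> * exp C)) \<le> card (primroot_gaps p h)"
proof -
  define I where "I = {1..<h}"
  define Y where "Y = joint_primroots p {0, h}"
  define u where "u = (\<lambda>x j. if residue_primroot p (x + j) then 1 else (0::real))"
  define e where "e = (\<lambda>i. esym (\<lambda>_. \<theta>) I i)"
  define q where "q = p * \<theta> ^ 2"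
  define S where "S = (\<lambda>i. \<Sum>B | B \<subseteq> I \<and> card B = i. real (card (joint_primroots p (B \<union> {0, h}))))"
  have finI: "finite I" by (simp add: I_def)
  have finY: "finite Y" by (simp add: Y_def joint_primroots_def)
  have \<theta>: "0 \<le> \<theta>" "\<theta> \<le> 1" unfolding \<theta>_def by (rule primroot_density_bounds)+
  have q0: "0 \<le> q" by (simp add: q_def)
  have C0: "0 \<le> C" using C \<theta> by (meson mult_nonneg_nonneg of_nat_0_le_iff order_trans)
  have u01: "0 \<le> u x i \<and> u x i \<le> 1" for x i by (auto simp: u_def)
  have e0: "0 \<le> e i" for i unfolding e_def by (rule esym_nonneg) (use \<theta> in auto)
  have e_le: "e i \<le> C ^ i / fact i" for i
  proof -
    have "e i \<le> (\<Sum>j\<in>I. \<theta>) ^ i / fact i" unfolding e_def by (rule esym_le[OF finI]) (use \<theta> in auto)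
    also have "(\<Sum>j\<in>I. \<theta>) = (h - 1) * \<theta>" by (simp add: I_def)
    also have "((h - 1) * \<theta>) ^ i / fact i \<le> C ^ i / fact i"
    proof (intro divide_right_mono power_mono)
      have "real (h - 1) * \<theta> \<le> real h * \<theta>" using \<theta> by (intro mult_right_mono) auto
      then show "(h - 1) * \<theta> \<le> C" using C by (simp add: mult.commute)
    qed (use \<theta> in auto)
    finally show ?thesis .
  qed
  have eq: "real (card (primroot_gaps p h)) = (\<Sum>x\<in>Y. \<Prod>j\<in>I. 1 - u x j)"
  proof -
    have "(\<Prod>j\<in>J. 1 - u x j) = (if \<forall>j\<in>J. \<not> residue_primroot p (x + j) then 1 else 0)" if "finite J" for J x
      using that by (induction J rule: finite_induct) (auto simp: u_def)
    then have "(\<Sum>x\<in>Y. \<Prod>j\<in>I. 1 - u x j) = real (card {x\<in>Y. \<forall>j\<in>I. \<not> residue_primroot p (x + j)})"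
      using finY finI by (simp add: sum.If_cases Int_def)
    moreover have "{x\<in>Y. \<forall>j\<in>I. \<not> residue_primroot p (x + j)} = primroot_gaps p h"
      by (auto simp: Y_def I_def primroot_gaps_def joint_primroots_def)
    ultimately show ?thesis by simp
  qed
  have S_sum: "S i = (\<Sum>x\<in>Y. esym (u x) I i)" for i
  proof -
    have "real (card (joint_primroots p (B \<union> {0, h}))) = (\<Sum>x\<in>Y. \<Prod>j\<in>B. u x j)" if "B \<subseteq> I" for B
    proof -
      have "finite B" using that finI finite_subset by blast
      then have "(\<Prod>j\<in>B. u x j) = (if \<forall>j\<in>B. residue_primroot p (x + j) then 1 else 0)" for x
        by (induction B rule: finite_induct) (auto simp: u_def)
      then have "(\<Sum>x\<in>Y. \<Prod>j\<in>B. u x j) = real (card {x\<in>Y. \<forall>j\<in>B. residue_primroot p (x + j)})"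
        using finY by (simp add: sum.If_cases Int_def)
      moreover have "{x\<in>Y. \<forall>j\<in>B. residue_primroot p (x + j)} = joint_primroots p (B \<union> {0, h})"
        by (auto simp: Y_def joint_primroots_def)
      ultimately show ?thesis by simp
    qed
    then have "S i = (\<Sum>B | B \<subseteq> I \<and> card B = i. \<Sum>x\<in>Y. \<Prod>j\<in>B. u x j)"
      unfolding S_def by (intro sum.cong) auto
    then show ?thesis unfolding esym_def by (subst (asm) sum.swap)
  qed
  have Si: "\<bar>S i - q * e i\<bar> \<le> \<eta> * (q * e i)" if "i \<le> k" for i
  proof -
    have W: "\<bar>real (card (joint_primroots p (B \<union> {0, h}))) - q * (\<Prod>j\<in>B. \<theta>)\<bar> \<le> \<eta> * (q * (\<Prod>j\<in>B. \<theta>))"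
      if "B \<subseteq> I" "card B = i" for B
    proof -
      have fB: "finite B" using that finI finite_subset by blast
      have "0 \<notin> B" "h \<notin> B" using that by (auto simp: I_def)
      then have c: "card (B \<union> {0, h}) = i + 2" using that fB h by simp
      have "B \<union> {0, h} \<subseteq> {..<p}" using that h by (auto simp: I_def)
      then have "\<bar>real (card (joint_primroots p (B \<union> {0, h}))) - p * \<theta> ^ (i + 2)\<bar> \<le> \<eta> * (p * \<theta> ^ (i + 2))"
        using asym[of "B \<union> {0, h}"] c \<open>i \<le> k\<close> by simp
      moreover have "p * \<theta> ^ (i + 2) = q * (\<Prod>j\<in>B. \<theta>)" using that by (simp add: q_def power_add power2_eq_square)
      ultimately show ?thesis by simp
    qed
    have "S i - q * e i = (\<Sum>B | B \<subseteq> I \<and> card B = i. real (card (joint_primroots p (B \<union> {0, h}))) - q * (\<Prod>j\<in>B. \<theta>))"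
      unfolding S_def e_def esym_def sum_distrib_left sum_subtractf ..
    then have "\<bar>S i - q * e i\<bar> \<le> (\<Sum>B | B \<subseteq> I \<and> card B = i. \<bar>real (card (joint_primroots p (B \<union> {0, h}))) - q * (\<Prod>j\<in>B. \<theta>)\<bar>)"
      by (simp only: sum_abs)
    also have "\<dots> \<le> (\<Sum>B | B \<subseteq> I \<and> card B = i. \<eta> * (q * (\<Prod>j\<in>B. \<theta>)))"
      using W by (intro sum_mono) auto
    also have "\<dots> = \<eta> * (q * e i)" unfolding e_def esym_def sum_distrib_left ..
    finally show ?thesis .
  qed
  have 1: "(\<Sum>i<k. (-1) ^ i * S i) - S k \<le> card (primroot_gaps p h)"
  proof -
    have "(\<Sum>i<k. (-1) ^ i * S i) - S k = (\<Sum>x\<in>Y. (\<Sum>i<k. (-1) ^ i * esym (u x) I i) - esym (u x) I k)"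
    proof -
      have "(\<Sum>i<k. (-1) ^ i * S i) = (\<Sum>x\<in>Y. \<Sum>i<k. (-1) ^ i * esym (u x) I i)"
        unfolding S_sum sum_distrib_left by (rule sum.swap)
      then show ?thesis by (simp only: S_sum sum_subtractf)
    qed
    also have "\<dots> \<le> (\<Sum>x\<in>Y. \<Prod>j\<in>I. 1 - u x j)"
    proof (rule sum_mono)
      fix x
      have "\<bar>(\<Prod>j\<in>I. 1 - u x j) - (\<Sum>i<k. (-1) ^ i * esym (u x) I i)\<bar> \<le> esym (u x) I k"
        by (rule bonferroni_abs[OF finI u01])
      then show "(\<Sum>i<k. (-1) ^ i * esym (u x) I i) - esym (u x) I k \<le> (\<Prod>j\<in>I. 1 - u x j)"
        by linarith
    qed
    finally show ?thesis by (simp only: eq)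
  qed
  have 2: "q * (\<Sum>i<k. (-1) ^ i * e i) - (\<Sum>i<k. \<eta> * (q * e i)) \<le> (\<Sum>i<k. (-1) ^ i * S i)"
  proof -
    have "q * (\<Sum>i<k. (-1) ^ i * e i) - (\<Sum>i<k. \<eta> * (q * e i)) = (\<Sum>i<k. (-1) ^ i * (q * e i) - \<eta> * (q * e i))"
      by (simp add: sum_distrib_left sum_subtractf mult_ac)
    also have "\<dots> \<le> (\<Sum>i<k. (-1) ^ i * S i)"
    proof (rule sum_mono)
      fix i assume "i \<in> {..<k}"
      then have "\<bar>(-1) ^ i * (S i - q * e i)\<bar> \<le> \<eta> * (q * e i)" using Si[of i] by (simp add: abs_mult power_abs)
      then have "- ((-1) ^ i * (S i - q * e i)) \<le> \<eta> * (q * e i)" by linarith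
      then show "(-1) ^ i * (q * e i) - \<eta> * (q * e i) \<le> (-1) ^ i * S i" by (simp add: right_diff_distrib)
    qed
    finally show ?thesis .
  qed
  have 3: "S k \<le> q * e k + \<eta> * (q * e k)" using Si[of k] by (simp add: abs_le_iff)
  have 4: "q * ((1 - \<theta>) ^ (h - 1) - e k) \<le> q * (\<Sum>i<k. (-1) ^ i * e i)"
  proof (rule mult_left_mono[OF _ q0])
    have "\<bar>(\<Prod>i\<in>I. 1 - \<theta>) - (\<Sum>i<k. (-1) ^ i * e i)\<bar> \<le> e k"
      unfolding e_def by (rule bonferroni_abs[OF finI]) (use \<theta> in auto)
    moreover have "(\<Prod>i\<in>I. 1 - \<theta>) = (1 - \<theta>) ^ (h - 1)" by (simp add: I_def)
    ultimately show "(1 - \<theta>) ^ (h - 1) - e k \<le> (\<Sum>i<k. (-1) ^ i * e i)" by linarith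
  qed
  have 5: "(\<Sum>i<k. \<eta> * (q * e i)) + \<eta> * (q * e k) \<le> q * (\<eta> * exp C)"
  proof -
    have "(\<Sum>i<k. \<eta> * (q * e i)) + \<eta> * (q * e k) = (\<Sum>i\<le>k. \<eta> * (q * e i))"
      by (simp only: lessThan_Suc_atMost[symmetric] sum.lessThan_Suc)
    also have "\<dots> = q * (\<eta> * (\<Sum>i\<le>k. e i))" by (simp add: sum_distrib_left mult_ac)
    also have "\<dots> \<le> q * (\<eta> * exp C)"
    proof (intro mult_left_mono q0 \<eta>)
      have "(\<Sum>i\<le>k. e i) \<le> (\<Sum>i\<le>k. C ^ i / fact i)" by (intro sum_mono e_le)
      also have "\<dots> \<le> exp C" by (rule sum_power_fact_le_exp[OF C0])
      finally show "(\<Sum>i\<le>k. e i) \<le> exp C" .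
    qed
    finally show ?thesis .
  qed
  have 6: "q * e k \<le> q * (C ^ k / fact k)" using q0 e_le by (rule mult_left_mono[rotated])
  have "q * ((1 - \<theta>) ^ (h - 1) - (2 * C ^ k / fact k + \<eta> * exp C))
     = q * ((1 - \<theta>) ^ (h - 1)) - 2 * (q * (C ^ k / fact k)) - q * (\<eta> * exp C)"
  proof -
    have "2 * C ^ k / fact k = 2 * (C ^ k / fact k)" by simp
    then show ?thesis
      by (simp only: right_diff_distrib distrib_left mult.left_commute[of q 2] diff_diff_eq)
  qed
  also have "\<dots> \<le> card (primroot_gaps p h)"
    using 1 2 3 4 5 6 unfolding right_diff_distrib by linarith
  finally show ?thesis by (simp only: q_def)
qed

section \<open>From cyclic gaps to the parity sequence\<close>

lemma strict_sorted_consecutive: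
  fixes L :: "nat list"
  assumes L: "sorted_wrt (<) L" and xy: "x \<in> set L" "y \<in> set L" "x < y"
    and none: "\<And>z. z \<in> set L \<Longrightarrow> \<not> (x < z \<and> z < y)"
  obtains n where "Suc n < length L" "L ! n = x" "L ! Suc n = y"
proof -
  obtain n where n: "n < length L" "L ! n = x" using xy by (auto simp: in_set_conv_nth)
  obtain m where m: "m < length L" "L ! m = y" using xy by (auto simp: in_set_conv_nth)
  have mono: "L ! i < L ! j" if "i < j" "j < length L" for i j
    using L that by (rule sorted_wrt_nth_less)
  have "n < m"
  proof (rule ccontr)
    assume "\<not> n < m"
    then have "m = n \<or> m < n" by auto
    then show False using mono[of m n] n m xy(3) by auto
  qed
  moreover have "\<not> Suc n < m"
  proof
    assume s: "Suc n < m"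
    then have "x < L ! Suc n" "L ! Suc n < y" using mono[of n "Suc n"] mono[of "Suc n" m] n m by auto
    then show False using none[of "L ! Suc n"] s m by auto
  qed
  ultimately have "m = Suc n" by auto
  then show ?thesis using that n m by blast
qed

lemma primitive_roots_eq: "prime p \<Longrightarrow> primitive_roots p = {g\<in>{..<p}. residue_primroot p g}"
proof (intro equalityI subsetI)
  fix g assume p: "prime p" and g: "g \<in> {g\<in>{..<p}. residue_primroot p g}"
  have "g \<noteq> 0" using p g by (metis mem_Collect_eq not_prime_1 not_residue_primroot_0_right)
  then show "g \<in> primitive_roots p" using g by (auto simp: primitive_roots_def)
qed (auto simp: primitive_roots_def dest: prime_gt_0_nat)

lemma card_primitive_roots: "prime p \<Longrightarrow> card (primitive_roots p) = totient (p - 1)"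
proof -
  assume p: "prime p"
  have "{g\<in>{..<p}. residue_primroot p g} = {x\<in>{..<p}. ord p x = p - 1}"
  proof (intro Collect_cong conj_cong refl)
    fix x
    have "coprime p x" if "ord p x = p - 1"
      using that p prime_gt_1_nat[OF p] ord_eq_0[of p x] by auto
    then show "residue_primroot p x \<longleftrightarrow> ord p x = p - 1"
      using p prime_gt_0_nat[OF p] by (auto simp: residue_primroot_def totient_prime)
  qed
  then show ?thesis using prime_card_primitive_roots(2)[of p] p prime_gt_1_nat[OF p] primitive_roots_eq[OF p] by simp
qed

text \<open>Consecutive roots \<open>x\<close> and \<open>x + h\<close> have a sum of the parity of
  \<open>h\<close>. A gap that runs past \<open>p\<close> starts among the last \<open>h\<close>
  residues, which accounts for the subtracted \<open>h\<close>.\<close>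

lemma symbol_count_ge_gaps:
  assumes p: "prime p" and b: "\<And>h. h \<in> H \<Longrightarrow> h mod 2 = b \<and> h \<ge> 1" and H: "finite H"
  shows "(\<Sum>h\<in>H. real (card (primroot_gaps p h)) - h) \<le> symbol_count p b"
proof -
  define L where "L = sorted_list_of_set (primitive_roots p)"
  define T where "T = period_length p"
  define G where "G = (\<lambda>h. {x\<in>primroot_gaps p h. x + h < p})"
  define N where "N = {n\<in>{..<T}. parity_seq p n = b}"
  have finG: "finite (G h)" for h by (simp add: G_def primroot_gaps_def)
  have fin: "finite (primitive_roots p)" by (simp add: primitive_roots_def)
  have setL: "set L = primitive_roots p" using fin by (simp add: L_def)
  have lenL: "length L = Suc T"
  proof -
    have "totient (p - 1) > 0" using prime_gt_1_nat[OF p] by simp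
    then show ?thesis using card_primitive_roots[OF p] by (simp add: L_def T_def period_length_def)
  qed
  have sortedL: "sorted_wrt (<) L" unfolding L_def by simp
  have par: "parity_seq p n = (L ! n + L ! Suc n) mod 2" if "n < T" for n
    using that by (simp add: parity_seq_def Let_def primitive_root_nth_def T_def L_def)
  \<comment> \<open>An index determines its gap and the starting point, so there are at most as many
    pairs as indices.\<close>
  have "Sigma H G \<subseteq> (\<lambda>n. (L ! Suc n - L ! n, L ! n)) ` N"
  proof (rule subsetI)
    fix z assume "z \<in> Sigma H G"
    then obtain h x where z: "z = (h, x)" "h \<in> H" "x \<in> G h" by auto
    have x: "x \<in> primitive_roots p" "x + h \<in> primitive_roots p"
      using z by (auto simp: G_def primroot_gaps_def primitive_roots_eq[OF p])
    have none: "\<not> (x < w \<and> w < x + h)" if "w \<in> primitive_roots p" for w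
    proof
      assume w: "x < w \<and> w < x + h"
      then have "w - x \<in> {1..<h}" by auto
      then have "\<not> residue_primroot p (x + (w - x))" using z by (simp add: G_def primroot_gaps_def)
      then show False using w that by (simp add: primitive_roots_def)
    qed
    obtain n where n: "Suc n < length L" "L ! n = x" "L ! Suc n = x + h"
      using strict_sorted_consecutive[OF sortedL, of x "x + h"] x none b[OF z(2)] setL by auto
    have "parity_seq p n = (x + (x + h)) mod 2" using par[of n] n lenL by simp
    also have "\<dots> = b" using b[OF z(2)] by presburger
    finally have "n \<in> N" using n lenL by (simp add: N_def)
    then show "z \<in> (\<lambda>n. (L ! Suc n - L ! n, L ! n)) ` N" using n z by (auto intro!: image_eqI[of _ _ n])
  qed
  then have "card (Sigma H G) \<le> card ((\<lambda>n. (L ! Suc n - L ! n, L ! n)) ` N)"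
    by (intro card_mono) (auto simp: N_def)
  also have "\<dots> \<le> card N" by (rule card_image_le) (simp add: N_def)
  also have "card N = symbol_count p b" by (simp add: N_def symbol_count_def T_def)
  also have "card (Sigma H G) = (\<Sum>h\<in>H. card (G h))" using H finG by simp
  finally have "(\<Sum>h\<in>H. real (card (G h))) \<le> symbol_count p b" by (simp flip: of_nat_sum)
  moreover have "(\<Sum>h\<in>H. real (card (primroot_gaps p h)) - h) \<le> (\<Sum>h\<in>H. real (card (G h)))"
  proof (rule sum_mono)
    fix h
    have "primroot_gaps p h \<subseteq> G h \<union> {p - h..<p}" by (auto simp: G_def primroot_gaps_def)
    then have "card (primroot_gaps p h) \<le> card (G h \<union> {p - h..<p})"
      by (intro card_mono) (use finG in auto)
    also have "\<dots> \<le> card (G h) + card {p - h..<p}" by (rule card_Un_le)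
    also have "\<dots> \<le> card (G h) + h" by simp
    finally show "real (card (primroot_gaps p h)) - h \<le> real (card (G h))" by linarith
  qed
  ultimately show ?thesis by linarith
qed

lemma symbol_count_sum:
  "symbol_count p 0 + symbol_count p 1 = period_length p"
proof -
  have "{..<period_length p} = {n\<in>{..<period_length p}. parity_seq p n = 0} \<union> {n\<in>{..<period_length p}. parity_seq p n = 1}"
    by (auto simp: parity_seq_def Let_def)
  then have "card {..<period_length p} = card ({n\<in>{..<period_length p}. parity_seq p n = 0} \<union> {n\<in>{..<period_length p}. parity_seq p n = 1})"
    by (rule arg_cong)
  also have "\<dots> = symbol_count p 0 + symbol_count p 1"
    unfolding symbol_count_def by (rule card_Un_disjoint) auto
  finally show ?thesis by simp
qed

text \<open>The case \<open>r = 0\<close> counts odd gaps, the case \<open>r = 1\<close> even ones.\<close>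
lemma symbol_count_lower:
  fixes C0 C \<eta> \<theta> :: real and p k r :: nat
  defines "\<theta> \<equiv> primroot_density p"
  defines "C \<equiv> C0 + 2"
  assumes p: "prime p" and \<theta>0: "\<theta> > 0" and C0: "C0 > 0" and r: "r \<le> 1"
    and \<eta>: "0 < \<eta>" "C * \<eta> < 1" "1 \<le> \<eta> * (p * \<theta> ^ 3)"
    and asym: "\<And>A. A \<subseteq> {..<p} \<Longrightarrow> card A \<le> k + 2 \<Longrightarrow>
      \<bar>real (card (joint_primroots p A)) - p * \<theta> ^ card A\<bar> \<le> \<eta> * (p * \<theta> ^ card A)"
  shows "p * \<theta> * ((1 - \<theta>) ^ r / (2 - \<theta>) - (exp (- C0) + C * (2 * C ^ k / fact k + \<eta> * exp C) + C ^ 2 * \<eta>))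
    \<le> symbol_count p ((r + 1) mod 2)"
proof -
  \<comment> \<open>Enough gaps of one parity to bring the geometric tail
    \<open>(1 - \<theta>) ^ (2 * M)\<close> below \<open>exp (- C0)\<close>. Rounding up adds at
    most \<open>2 * \<theta>\<close> to \<open>2 * M * \<theta>\<close>, which is the reason for
    \<open>C = C0 + 2\<close>.\<close>
  define M where "M = nat \<lceil>C0 / (2 * \<theta>)\<rceil>"
  define \<epsilon> where "\<epsilon> = 2 * C ^ k / fact k + \<eta> * exp C"
  have \<theta>1: "\<theta> \<le> 1" unfolding \<theta>_def by (rule primroot_density_bounds)
  have p0: "real p > 0" using prime_gt_0_nat[OF p] by simp
  have M_ge: "C0 \<le> 2 * M * \<theta>"
  proof -
    have "C0 / (2 * \<theta>) \<le> M" unfolding M_def by (rule real_nat_ceiling_ge)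
    then show ?thesis using \<theta>0 by (simp add: field_simps)
  qed
  have M_le: "2 * M * \<theta> \<le> C"
  proof -
    have "real M \<le> C0 / (2 * \<theta>) + 1"
    proof -
      have "0 \<le> C0 / (2 * \<theta>)" using C0 \<theta>0 by simp
      then have "0 \<le> \<lceil>C0 / (2 * \<theta>)\<rceil>" by linarith
      then have "real M = real_of_int \<lceil>C0 / (2 * \<theta>)\<rceil>" by (simp add: M_def)
      then show ?thesis using of_int_ceiling_le_add_one[of "C0 / (2 * \<theta>)"] by simp
    qed
    then have "2 * \<theta> * real M \<le> 2 * \<theta> * (C0 / (2 * \<theta>) + 1)" using \<theta>0 by (intro mult_left_mono) auto
    also have "\<dots> = C0 + 2 * \<theta>" using \<theta>0 by (simp add: algebra_simps)
    finally show ?thesis using \<theta>1 by (simp add: C_def mult_ac)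
  qed
  have C2: "C > 2" using C0 by (simp add: C_def)
  have \<epsilon>0: "0 \<le> \<epsilon>" using C2 \<eta> by (simp add: \<epsilon>_def)
  have p\<theta>: "p * \<theta> ^ 3 \<le> p * \<theta>"
    using \<theta>0 \<theta>1 p0 power_decreasing[of 1 3 \<theta>] by (intro mult_left_mono) auto
  have Mp: "2 * M < p"
  proof -
    have "1 \<le> \<eta> * (p * \<theta>)" using \<eta> mult_left_mono[OF p\<theta>, of \<eta>] by linarith
    then have "C * 1 \<le> C * (\<eta> * (p * \<theta>))" using C2 by (intro mult_left_mono) auto
    also have "\<dots> = (C * \<eta>) * (p * \<theta>)" by simp
    also have "\<dots> < 1 * (p * \<theta>)" using \<eta> p0 \<theta>0 by (intro mult_strict_right_mono) auto
    finally have "2 * M * \<theta> < p * \<theta>" using M_le by simp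
    then have "real (2 * M) < real p" using \<theta>0 by simp
    then show ?thesis by (simp only: of_nat_less_iff)
  qed
  define hh where "hh = (\<lambda>i. 2 * i + 1 + r)"
  have inj: "inj_on hh {..<M}" by (auto simp: inj_on_def hh_def)
  have gap: "p * \<theta> ^ 2 * ((1 - \<theta>) ^ r * ((1 - \<theta>) ^ 2) ^ i - \<epsilon>) \<le> card (primroot_gaps p (hh i))" if "i < M" for i
  proof -
    have hb: "1 \<le> hh i" "hh i \<le> 2 * M" using that r by (auto simp: hh_def)
    have "p * \<theta> ^ 2 * ((1 - \<theta>) ^ (hh i - 1) - (2 * C ^ k / fact k + \<eta> * exp C)) \<le> card (primroot_gaps p (hh i))"
    proof (rule primroot_gaps_lower[of "hh i" p C \<eta> k, folded \<theta>_def])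
      show "hh i < p" using hb Mp by simp
      have "\<theta> * hh i \<le> \<theta> * real (2 * M)" using hb(2) \<theta>0 by (intro mult_left_mono) (simp_all only: of_nat_le_iff less_imp_le)
      then show "\<theta> * hh i \<le> C" using M_le by (simp add: mult_ac)
    qed (use hb \<eta> asym in auto)
    moreover have "(1 - \<theta>) ^ (hh i - 1) = (1 - \<theta>) ^ r * ((1 - \<theta>) ^ 2) ^ i"
      by (simp add: hh_def add.commute power_add flip: power_mult)
    ultimately show ?thesis by (simp only: \<epsilon>_def)
  qed
  \<comment> \<open>The denominator \<open>2 - \<theta>\<close> arises from
    \<open>1 - (1 - \<theta>) ^ 2 = \<theta> * (2 - \<theta>)\<close>, as gaps of one parity advance
    in steps of 2.\<close>
  have geo: "\<theta> * (\<Sum>i<M. ((1 - \<theta>) ^ 2) ^ i) = (1 - (1 - \<theta>) ^ (2 * M)) / (2 - \<theta>)"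
  proof -
    have ne: "(1 - \<theta>) ^ 2 \<noteq> 1"
      using \<theta>0 \<theta>1 power_strict_decreasing[of 0 2 "1 - \<theta>"] by (cases "\<theta> = 1") (auto simp: power2_eq_1_iff)
    have f: "(1 - \<theta>) ^ 2 - 1 = - \<theta> * (2 - \<theta>)" by (simp add: power2_eq_square algebra_simps)
    have "(\<Sum>i<M. ((1 - \<theta>) ^ 2) ^ i) = (((1 - \<theta>) ^ 2) ^ M - 1) / ((1 - \<theta>) ^ 2 - 1)"
      by (rule geometric_sum[OF ne])
    also have "\<dots> = ((1 - \<theta>) ^ (2 * M) - 1) / (- \<theta> * (2 - \<theta>))" by (simp only: f power_mult)
    finally show ?thesis using \<theta>0 \<theta>1 by (simp add: field_simps)
  qed
  have tail: "(1 - \<theta>) ^ (2 * M) \<le> exp (- C0)"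
  proof -
    have "(1 - \<theta>) ^ (2 * M) \<le> exp (- \<theta>) ^ (2 * M)"
      using \<theta>1 exp_ge_add_one_self[of "- \<theta>"] by (intro power_mono) auto
    also have "\<dots> = exp (- (2 * M * \<theta>))" using exp_of_nat_mult[of "2 * M" "- \<theta>"] by simp
    also have "\<dots> \<le> exp (- C0)" using M_ge by simp
    finally show ?thesis .
  qed
  have r1: "0 \<le> (1 - \<theta>) ^ r" "(1 - \<theta>) ^ r \<le> 1" using \<theta>0 \<theta>1 by (auto intro: power_le_one)
  have main: "(1 - \<theta>) ^ r / (2 - \<theta>) - exp (- C0) \<le> \<theta> * ((1 - \<theta>) ^ r * (\<Sum>i<M. ((1 - \<theta>) ^ 2) ^ i))"
  proof -
    have "(1 - \<theta>) ^ r / (2 - \<theta>) * (1 - \<theta>) ^ (2 * M) \<le> 1 * exp (- C0)"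
    proof (rule mult_mono)
      have "(1 - \<theta>) ^ r \<le> 2 - \<theta>" using r1 \<theta>1 by linarith
      then show "(1 - \<theta>) ^ r / (2 - \<theta>) \<le> 1" using \<theta>1 by (simp add: divide_le_eq)
    qed (use tail \<theta>1 in auto)
    moreover have "\<theta> * ((1 - \<theta>) ^ r * (\<Sum>i<M. ((1 - \<theta>) ^ 2) ^ i)) = (1 - \<theta>) ^ r * (\<theta> * (\<Sum>i<M. ((1 - \<theta>) ^ 2) ^ i))"
      by (simp only: mult_ac)
    moreover have "\<dots> = (1 - \<theta>) ^ r / (2 - \<theta>) - (1 - \<theta>) ^ r / (2 - \<theta>) * (1 - \<theta>) ^ (2 * M)"
      unfolding geo by (simp add: diff_divide_distrib right_diff_distrib)
    ultimately show ?thesis by linarith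
  qed
  have "p * \<theta> * ((1 - \<theta>) ^ r / (2 - \<theta>) - (exp (- C0) + C * \<epsilon> + C ^ 2 * \<eta>))
     \<le> (\<Sum>i<M. p * \<theta> ^ 2 * ((1 - \<theta>) ^ r * ((1 - \<theta>) ^ 2) ^ i - \<epsilon>) - hh i)"
  proof -
    have s1: "(\<Sum>i<M. p * \<theta> ^ 2 * ((1 - \<theta>) ^ r * ((1 - \<theta>) ^ 2) ^ i - \<epsilon>))
       = p * \<theta> * (\<theta> * ((1 - \<theta>) ^ r * (\<Sum>i<M. ((1 - \<theta>) ^ 2) ^ i))) - p * \<theta> * (M * \<theta> * \<epsilon>)"
    proof -
      define g where "g = (\<lambda>i. ((1 - \<theta>) ^ 2) ^ i)"
      have "(\<Sum>i<M. p * \<theta> ^ 2 * ((1 - \<theta>) ^ r * g i - \<epsilon>))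
          = (\<Sum>i<M. (p * \<theta> ^ 2 * (1 - \<theta>) ^ r) * g i) - (\<Sum>i<M. p * \<theta> ^ 2 * \<epsilon>)"
        by (simp only: right_diff_distrib sum_subtractf mult.assoc)
      also have "\<dots> = (p * \<theta> ^ 2 * (1 - \<theta>) ^ r) * (\<Sum>i<M. g i) - M * (p * \<theta> ^ 2 * \<epsilon>)"
        by (simp only: sum_distrib_left[symmetric] sum_constant card_lessThan) (simp only: mult_ac)
      also have "\<dots> = p * \<theta> * (\<theta> * ((1 - \<theta>) ^ r * (\<Sum>i<M. g i))) - p * \<theta> * (M * \<theta> * \<epsilon>)"
        by (simp add: power2_eq_square)
      finally show ?thesis by (simp only: g_def)
    qed
    \<comment> \<open>The discarded boundary gaps number at most \<open>2 * M ^ 2\<close>, of order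
      \<open>1 / \<theta> ^ 2\<close>; the lower bound on \<open>\<eta> * (p * \<theta> ^ 3)\<close>
      makes this small against \<open>p * \<theta>\<close>.\<close>
    have s2: "(\<Sum>i<M. real (hh i)) \<le> p * \<theta> * (C ^ 2 * \<eta>)"
    proof -
      have "(\<Sum>i<M. real (hh i)) \<le> (\<Sum>i<M. real (2 * M))"
        using r by (intro sum_mono) (auto simp: hh_def)
      also have "\<dots> = 2 * real M * real M" by simp
      finally have "\<theta> ^ 2 * (\<Sum>i<M. real (hh i)) \<le> \<theta> ^ 2 * (2 * real M * real M)" by (intro mult_left_mono) auto
      also have "\<dots> \<le> (2 * M * \<theta>) ^ 2"
        using \<theta>0 by (simp add: power2_eq_square mult_nonneg_nonneg)
      also have "\<dots> \<le> C ^ 2" using M_le \<theta>0 by (intro power_mono) auto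
      also have "\<dots> \<le> C ^ 2 * (\<eta> * (p * \<theta> ^ 3))" using mult_left_mono[OF \<eta>(3), of "C ^ 2"] by simp
      also have "\<dots> = \<theta> ^ 2 * (p * \<theta> * (C ^ 2 * \<eta>))" by (simp add: power2_eq_square power3_eq_cube)
      finally show ?thesis using \<theta>0 by simp
    qed
    have s3: "p * \<theta> * (M * \<theta> * \<epsilon>) \<le> p * \<theta> * (C * \<epsilon>)"
    proof -
      have "0 \<le> real M * \<theta>" using \<theta>0 by simp
      moreover have "real M * \<theta> + real M * \<theta> \<le> C" using M_le by (simp add: algebra_simps)
      ultimately have "M * \<theta> \<le> C" by linarith
      then show ?thesis using p0 \<theta>0 \<epsilon>0 by (intro mult_left_mono mult_right_mono) auto
    qed
    have s4: "p * \<theta> * ((1 - \<theta>) ^ r / (2 - \<theta>) - exp (- C0)) \<le> p * \<theta> * (\<theta> * ((1 - \<theta>) ^ r * (\<Sum>i<M. ((1 - \<theta>) ^ 2) ^ i)))"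
      using main p0 \<theta>0 by (intro mult_left_mono) auto
    have "p * \<theta> * ((1 - \<theta>) ^ r / (2 - \<theta>) - (exp (- C0) + C * \<epsilon> + C ^ 2 * \<eta>))
      = p * \<theta> * ((1 - \<theta>) ^ r / (2 - \<theta>) - exp (- C0)) - p * \<theta> * (C * \<epsilon>) - p * \<theta> * (C ^ 2 * \<eta>)"
      by (simp add: algebra_simps)
    then show ?thesis using s1 s2 s3 s4 unfolding sum_subtractf by linarith
  qed
  also have "\<dots> \<le> (\<Sum>i<M. real (card (primroot_gaps p (hh i))) - hh i)"
    using gap by (intro sum_mono diff_right_mono) auto
  also have "\<dots> = (\<Sum>h\<in>hh ` {..<M}. real (card (primroot_gaps p h)) - h)"
    by (simp add: sum.reindex[OF inj])
  also have "\<dots> \<le> symbol_count p ((r + 1) mod 2)"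
    by (rule symbol_count_ge_gaps[OF p]) (auto simp: hh_def mod_simps)
  finally show ?thesis by (simp only: \<epsilon>_def)
qed

text \<open>The order of choices matters: \<open>C0\<close> controls the tail of long gaps, then
  \<open>k\<close> the truncation, then \<open>\<eta>\<close> the relative error of the counts, and
  only then \<open>p\<close> is taken large. Of five shares \<open>\<epsilon> / 5\<close>, four pay
  for \<open>E\<close> and the fifth for passing from \<open>\<theta>\<close> to
  \<open>totient (p - 1) / p\<close>.\<close>

lemma symbol_frequency:
  assumes "\<epsilon> > 0"
  shows "\<forall>\<^sub>F p in sequentially. prime p \<longrightarrow> p \<ge> 11 \<longrightarrow>
    \<bar>real (symbol_count p 1) / real (period_length p) - 1 / (2 - real (totient (p - 1)) / real p)\<bar> \<le> \<epsilon>"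
proof -
  define C0 where "C0 = max 1 (ln (5 / \<epsilon>))"
  define C where "C = C0 + 2"
  have C0: "C0 > 0" by (simp add: C0_def)
  have C: "C > 0" using C0 by (simp add: C_def)
  have E1: "exp (- C0) \<le> \<epsilon> / 5"
  proof -
    have "exp (- C0) \<le> exp (- ln (5 / \<epsilon>))" by (simp add: C0_def)
    also have "\<dots> = \<epsilon> / 5" using assms by (simp add: exp_minus)
    finally show ?thesis .
  qed
  have "(\<lambda>k. C ^ k /\<^sub>R fact k) \<longlonglongrightarrow> 0" by (rule summable_LIMSEQ_zero[OF summable_exp_generic])
  then have "\<forall>\<^sub>F k in sequentially. C ^ k /\<^sub>R fact k < \<epsilon> / (10 * C)"
    by (rule order_tendstoD) (use assms C in simp)
  then obtain k where "C ^ k /\<^sub>R fact k < \<epsilon> / (10 * C)" by (auto simp: eventually_sequentially)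
  moreover have "C ^ k /\<^sub>R fact k = C ^ k / fact k" by (simp add: divide_inverse mult.commute)
  ultimately have "C ^ k / fact k \<le> \<epsilon> / (10 * C)" by linarith
  then have "2 * C * (C ^ k / fact k) \<le> 2 * C * (\<epsilon> / (10 * C))" using C by (intro mult_left_mono) auto
  then have E2: "C * (2 * C ^ k / fact k) \<le> \<epsilon> / 5" using C by (simp add: mult_ac)
  define \<eta> where "\<eta> = min (1 / (2 * C)) (min (\<epsilon> / (5 * C * exp C)) (\<epsilon> / (5 * C ^ 2)))"
  have \<eta>: "\<eta> > 0" using assms C by (simp add: \<eta>_def)
  have C\<eta>: "C * \<eta> < 1"
  proof -
    have "C * \<eta> \<le> C * (1 / (2 * C))" using C by (intro mult_left_mono) (auto simp: \<eta>_def)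
    then show ?thesis using C by simp
  qed
  have E3: "C * (\<eta> * exp C) \<le> \<epsilon> / 5"
  proof -
    have "(C * exp C) * \<eta> \<le> (C * exp C) * (\<epsilon> / (5 * C * exp C))"
      using C by (intro mult_left_mono) (auto simp: \<eta>_def)
    then show ?thesis using C by (simp add: mult_ac)
  qed
  have E4: "C ^ 2 * \<eta> \<le> \<epsilon> / 5"
  proof -
    have "C ^ 2 * \<eta> \<le> C ^ 2 * (\<epsilon> / (5 * C ^ 2))" using C by (intro mult_left_mono) (auto simp: \<eta>_def)
    then show ?thesis using C by simp
  qed
  define E where "E = exp (- C0) + C * (2 * C ^ k / fact k + \<eta> * exp C) + C ^ 2 * \<eta>"
  have E: "E \<le> 4 * \<epsilon> / 5" using E1 E2 E3 E4 by (simp add: E_def distrib_left)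
  have ev1: "\<forall>\<^sub>F p in sequentially. \<forall>K\<in>{..k + 2}. prime p \<longrightarrow> (\<forall>A \<subseteq> {..<p}. card A = K \<longrightarrow>
    \<bar>real (card (joint_primroots p A)) - p * primroot_density p ^ K\<bar> \<le> \<eta> * (p * primroot_density p ^ K))"
    by (intro eventually_ball_finite ballI joint_primroots_asymptotic \<eta>) simp
  have ev2: "\<forall>\<^sub>F p in sequentially. prime p \<longrightarrow> 1 \<le> \<eta> * (p * primroot_density p ^ 3)"
    by (rule primroot_density_cube[OF \<eta>])
  have ev3: "\<forall>\<^sub>F p in sequentially. nat \<lceil>5 / \<epsilon>\<rceil> \<le> p" by (rule eventually_ge_at_top)
  show ?thesis
    using ev1 ev2 ev3
  proof eventually_elim
    case (elim p)
    show ?case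
    proof (intro impI)
      assume p: "prime p" and p11: "p \<ge> 11"
      define \<theta> where "\<theta> = primroot_density p"
      define T where "T = real (period_length p)"
      define \<phi> where "\<phi> = real (totient (p - 1))"
      define N1 where "N1 = real (symbol_count p 1)"
      define N0 where "N0 = real (symbol_count p 0)"
      have cube: "1 \<le> \<eta> * (p * \<theta> ^ 3)" using elim(2) p by (simp add: \<theta>_def)
      have \<theta>1: "0 \<le> \<theta>" "\<theta> \<le> 1" unfolding \<theta>_def by (rule primroot_density_bounds)+
      have \<theta>0: "\<theta> > 0" using \<theta>1 cube by (cases "\<theta> = 0") auto
      have asym: "\<bar>real (card (joint_primroots p A)) - p * \<theta> ^ card A\<bar> \<le> \<eta> * (p * \<theta> ^ card A)"
        if "A \<subseteq> {..<p}" "card A \<le> k + 2" for A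
        using elim(1) p that by (auto simp: \<theta>_def)
      have low: "p * \<theta> * ((1 - \<theta>) ^ r / (2 - \<theta>) - E) \<le> symbol_count p ((r + 1) mod 2)" if "r \<le> 1" for r
        unfolding E_def C_def \<theta>_def
        using symbol_count_lower[of p C0 r \<eta> k] p \<theta>0 C0 that \<eta> C\<eta> cube asym
        by (simp only: C_def \<theta>_def)
      have L1: "p * \<theta> * (1 / (2 - \<theta>) - E) \<le> N1" using low[of 0] by (simp add: N1_def)
      have L0: "p * \<theta> * ((1 - \<theta>) / (2 - \<theta>) - E) \<le> N0" using low[of 1] by (simp add: N0_def)
      have \<phi>_eq: "\<phi> = (real p - 1) * \<theta>"
        unfolding \<phi>_def totient_formula2 \<theta>_def primroot_density_def using p11 by (simp add: of_nat_diff)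
      have "totient (p - 1) > 1" using p11 by (intro totient_gt_1) simp
      then have T: "T = \<phi> - 1" "T > 0" by (auto simp: T_def \<phi>_def period_length_def of_nat_diff)
      have "T \<le> \<phi>" using T by simp
      also have "\<dots> \<le> p * \<theta>" unfolding \<phi>_eq using \<theta>0 by (intro mult_right_mono) auto
      finally have Tp: "T \<le> p * \<theta>" .
      \<comment> \<open>As \<open>T\<close> is at most \<open>p * \<theta>\<close>, replacing the
        one by the other preserves a lower bound only for nonnegative \<open>x\<close>; for negative
        \<open>x\<close> the claim is trivial.\<close>
      have scale: "x \<le> N / T" if "p * \<theta> * x \<le> N" "0 \<le> N" for x N
      proof (cases "0 \<le> x")
        case True
        with Tp have "T * x \<le> p * \<theta> * x" by (rule mult_right_mono)
        then have "x * T \<le> N" using that by (simp add: mult.commute)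
        then show ?thesis using T by (simp add: pos_le_divide_eq)
      next
        case False
        have "0 \<le> N / T" using that T by simp
        then show ?thesis using False by linarith
      qed
      have sum: "N0 / T + N1 / T = 1"
      proof -
        have "N0 + N1 = T" using symbol_count_sum[of p] by (simp add: N0_def N1_def T_def flip: of_nat_add)
        then show ?thesis using T by (simp flip: add_divide_distrib)
      qed
      have m: "(1 - \<theta>) / (2 - \<theta>) = 1 - 1 / (2 - \<theta>)" using \<theta>1 by (simp add: field_simps)
      have A1: "1 / (2 - \<theta>) - E \<le> N1 / T" by (rule scale[OF L1]) (simp add: N1_def)
      have A0: "(1 - \<theta>) / (2 - \<theta>) - E \<le> N0 / T" by (rule scale[OF L0]) (simp add: N0_def)
      have mid: "\<bar>N1 / T - 1 / (2 - \<theta>)\<bar> \<le> E" using A1 A0 m sum by linarith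
      \<comment> \<open>The formula to be proved has \<open>p\<close> in the denominator where
        \<open>\<theta>\<close> has \<open>p - 1\<close>; the two ratios differ by
        \<open>\<theta> / p\<close>.\<close>
      define \<delta> where "\<delta> = \<phi> / p"
      have p0: "real p > 0" using p11 by simp
      have \<delta>: "\<theta> - \<delta> = \<theta> / p" using p0 by (simp add: \<delta>_def \<phi>_eq field_simps)
      have d1: "0 \<le> \<theta> - \<delta>" "\<theta> - \<delta> \<le> 1 / p"
        unfolding \<delta> using \<theta>1 p0 by (auto intro: divide_right_mono)
      have "\<delta> \<le> 1" using d1 \<theta>1 by linarith
      have "1 / (2 - \<theta>) - 1 / (2 - \<delta>) = (\<theta> - \<delta>) / ((2 - \<theta>) * (2 - \<delta>))"
        using \<theta>1 \<open>\<delta> \<le> 1\<close> by (simp add: field_simps)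
      also have "\<dots> \<le> (\<theta> - \<delta>) / 1"
      proof (rule divide_left_mono)
        have "1 * 1 \<le> (2 - \<theta>) * (2 - \<delta>)" using \<theta>1 \<open>\<delta> \<le> 1\<close> by (intro mult_mono) auto
        then show "1 \<le> (2 - \<theta>) * (2 - \<delta>)" by simp
        then show "0 < (2 - \<theta>) * (2 - \<delta>) * 1" by simp
      qed (use d1 in simp)
      finally have up: "1 / (2 - \<theta>) - 1 / (2 - \<delta>) \<le> 1 / p" using d1 by simp
      have lo: "1 / (2 - \<delta>) \<le> 1 / (2 - \<theta>)" using d1 \<theta>1 \<open>\<delta> \<le> 1\<close> by (intro divide_left_mono) auto
      have "1 / p \<le> \<epsilon> / 5"
      proof -
        have "5 / \<epsilon> \<le> p" using elim(3) real_nat_ceiling_ge[of "5 / \<epsilon>"] by linarith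
        then show ?thesis using assms p0 by (simp add: field_simps)
      qed
      then have "\<bar>N1 / T - 1 / (2 - \<delta>)\<bar> \<le> \<epsilon>" using mid up lo E by linarith
      then show "\<bar>real (symbol_count p 1) / real (period_length p) - 1 / (2 - real (totient (p - 1)) / real p)\<bar> \<le> \<epsilon>"
        by (simp only: N1_def T_def \<delta>_def \<phi>_def)
    qed
  qed
qed

theorem theorem1:
  shows "\<exists>e1 e0 :: nat \<Rightarrow> real.
    (e1 \<longlongrightarrow> 0) primes_at_top \<and> (e0 \<longlongrightarrow> 0) primes_at_top \<and>
    (\<forall>p. prime p \<and> p \<ge> 11 \<longrightarrow>
      real (symbol_count p 1) =
        (1 / (2 - real (totient (p - 1)) / real p) + e1 p) * real (period_length p) \<and>
      real (symbol_count p 0) =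
        ((1 - real (totient (p - 1)) / real p) / (2 - real (totient (p - 1)) / real p) + e0 p)
          * real (period_length p))"
proof -
  define e1 where "e1 = (\<lambda>p. real (symbol_count p 1) / real (period_length p) - 1 / (2 - real (totient (p - 1)) / real p))"
  have lim: "(e1 \<longlongrightarrow> 0) primes_at_top"
  proof (rule tendstoI)
    fix \<epsilon> :: real assume "\<epsilon> > 0"
    then have "\<epsilon> / 2 > 0" by simp
    from symbol_frequency[OF this] eventually_ge_at_top[of 11]
    have "\<forall>\<^sub>F p in sequentially. p \<in> {p. prime p} \<longrightarrow> dist (e1 p) 0 < \<epsilon>"
      by eventually_elim (use \<open>\<epsilon> > 0\<close> in \<open>auto simp: e1_def\<close>)
    then show "\<forall>\<^sub>F p in primes_at_top. dist (e1 p) 0 < \<epsilon>"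
      unfolding primes_at_top_def eventually_inf_principal .
  qed
  \<comment> \<open>The main terms add up to 1 and the counts to the period length, so the error for
    the zeros is the negative of that for the ones.\<close>
  have lim0: "((\<lambda>p. - e1 p) \<longlongrightarrow> 0) primes_at_top" using tendsto_minus[OF lim] by simp
  have main: "real (symbol_count p 1) =
        (1 / (2 - real (totient (p - 1)) / real p) + e1 p) * real (period_length p) \<and>
      real (symbol_count p 0) =
        ((1 - real (totient (p - 1)) / real p) / (2 - real (totient (p - 1)) / real p) + (- e1 p))
          * real (period_length p)" if "prime p" "p \<ge> 11" for p
  proof -
    define \<delta> where "\<delta> = real (totient (p - 1)) / real p"
    define T where "T = real (period_length p)"
    \<comment> \<open>The bound \<open>p \<ge> 11\<close> makes the period positive, so that the
      quotient in \<open>e1\<close> is a genuine frequency rather than a division by zero.\<close>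
    have "totient (p - 1) > 1" using that by (intro totient_gt_1) simp
    then have T: "T > 0" by (simp add: T_def period_length_def)
    have "totient (p - 1) \<le> p" using totient_le[of "p - 1"] by simp
    then have "\<delta> \<le> 1" using that by (simp add: \<delta>_def divide_le_eq)
    then have m: "(1 - \<delta>) / (2 - \<delta>) = 1 - 1 / (2 - \<delta>)" by (simp add: field_simps)
    have s: "real (symbol_count p 0) + real (symbol_count p 1) = T"
      using symbol_count_sum[of p] by (simp add: T_def flip: of_nat_add)
    have e: "e1 p = real (symbol_count p 1) / T - 1 / (2 - \<delta>)" by (simp add: e1_def T_def \<delta>_def)
    have "(1 / (2 - \<delta>) + e1 p) * T = real (symbol_count p 1)" using T by (simp add: e)
    moreover have "((1 - \<delta>) / (2 - \<delta>) + (- e1 p)) * T = T - real (symbol_count p 1)"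
      using T unfolding m e by (simp add: algebra_simps)
    ultimately show ?thesis using s unfolding \<delta>_def T_def by simp
  qed
  show ?thesis
  proof (rule exI[of _ e1], rule exI[of _ "\<lambda>p. - e1 p"], intro conjI allI impI)
    fix p :: nat
    assume p: "prime p \<and> 11 \<le> p"
    show "real (symbol_count p 1) =
        (1 / (2 - real (totient (p - 1)) / real p) + e1 p) * real (period_length p)"
      using main[of p] p by blast
    show "real (symbol_count p 0) =
        ((1 - real (totient (p - 1)) / real p) / (2 - real (totient (p - 1)) / real p) + - e1 p)
          * real (period_length p)"
      using main[of p] p by blast
  qed (rule lim, rule lim0)
qed

end
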